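(* Let $\Omega\subset\mathbb{R}^n$ ($n\ge2$) be a bounded domain and let $\phi\in\Phi_{\mathrm w}(\Omega)$ satisfy (A0), (aInc)$_p$, (aDec)$_q$ (constant $L$) and (A1-$\frac{n}{1-\gamma}$) (constant $L_\omega$) with $1<p\le q$ and $\gamma\in(0,1)$. If $u\in W^{1,\phi}_{\mathrm{loc}}(\Omega)\cap C^{0,\gamma}(B_{4r})$ is a quasiminimizer (with constant $Q$) in a ball $B_{4r}\Subset\Omega$, then there is $\sigma>0$ such that $\phi(\cdot,|Du|)^{1+\sigma}\in L^1(B_r)$ and \[ \bigg(\fint_{B_r}\phi(x,|Du|)^{1+\sigma}\,dx\bigg)^{\frac1{1+\sigma}}\le c\,\phi^-_{B_{2r}}\bigg(\fint_{B_{2r}}|Du|\,dx\bigg)+c, \] where $\sigma$ and $c$ depend only on $n,p,q,L,L_\omega,Q$ and $[u]_{\gamma,B_{2r}}$.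
   Context: For $\phi:\Omega\times[0,\infty)\to[0,\infty)$, $\gamma'\in\mathbb{R}$, constant $L\ge1$: (aInc)$_{\gamma'}$: $\phi(x,s)/s^{\gamma'}\le L\phi(x,t)/t^{\gamma'}$ for $0<s\le t$; (aDec)$_{\gamma'}$: $\phi(x,t)/t^{\gamma'}\le L\phi(x,s)/s^{\gamma'}$ for $0<s\le t$; (A0): $L^{-1}\le\phi(x,1)\le L$. $\Phi_{\mathrm w}(\Omega)$: $x\mapsto\phi(x,|f(x)|)$ measurable for measurable $f$, $t\mapsto\phi(x,t)$ increasing, $\phi(x,0)=\lim_{t\to0^+}\phi(x,t)=0$, $\lim_{t\to\infty}\phi(x,t)=\infty$, (aInc)$_1$. (A1-$s$): there is $L_\omega>0$ such that for all $\rho\in(0,1]$, balls $B_\rho$, $x,y\in B_\rho\cap\Omega$, $t\ge0$ with $t^s\le|B_\rho|^{-1}$: $|\phi(x,t)-\phi(y,t)|\le L_\omega(\phi(y,t)+1)$. $\phi^-_{B}(t)=\inf_{x\in B\cap\Omega}\phi(x,t)$. $W^{1,\phi}_{\mathrm{loc}}$: functions in $W^{1,1}_{\mathrm{loc}}$ whose value and gradient lie locally in the generalized Orlicz space $L^\phi$ (Luxemburg norm $\inf\{\lambda>0:\int\phi(x,|f|/\lambda)\le1\}$). $u$ is a quasiminimizer in $B_{4r}$ with constant $Q\ge1$ if $\int_{\operatorname{supp}(u-v)}\phi(x,|Du|)\,dx\le Q\int_{\operatorname{supp}(u-v)}\phi(x,|Dv|)\,dx$ for all $v\in W^{1,\phi}_{\mathrm{loc}}(B_{4r})$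 with $\operatorname{supp}(u-v)\Subset B_{4r}$. $[u]_{\gamma,B}=\sup_{x\ne y\in B}|u(x)-u(y)|/|x-y|^\gamma$. *)

theory Defs
  imports "HOL-Analysis.Analysis"
begin

type_synonym 'n phi_fun = "real ^ 'n \<Rightarrow> real \<Rightarrow> real"

definition aInc :: "(real ^ 'n) set \<Rightarrow> 'n phi_fun \<Rightarrow> real \<Rightarrow> real \<Rightarrow> bool" where
  "aInc \<Omega> \<phi> g L \<longleftrightarrow> (\<forall>x\<in>\<Omega>. \<forall>s t. 0 < s \<longrightarrow> s \<le> t \<longrightarrow>
      \<phi> x s / s powr g \<le> L * (\<phi> x t / t powr g))"

definition aDec :: "(real ^ 'n) set \<Rightarrow> 'n phi_fun \<Rightarrow> real \<Rightarrow> real \<Rightarrow> bool" where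
  "aDec \<Omega> \<phi> g L \<longleftrightarrow> (\<forall>x\<in>\<Omega>. \<forall>s t. 0 < s \<longrightarrow> s \<le> t \<longrightarrow>
      \<phi> x t / t powr g \<le> L * (\<phi> x s / s powr g))"

definition A0 :: "(real ^ 'n) set \<Rightarrow> 'n phi_fun \<Rightarrow> real \<Rightarrow> bool" where
  "A0 \<Omega> \<phi> L \<longleftrightarrow> (\<forall>x\<in>\<Omega>. 1 / L \<le> \<phi> x 1 \<and> \<phi> x 1 \<le> L)"

definition Phi_w :: "(real ^ 'n) set \<Rightarrow> 'n phi_fun \<Rightarrow> bool" where
  "Phi_w \<Omega> \<phi> \<longleftrightarrow>
     (\<forall>x\<in>\<Omega>. \<forall>t\<ge>0. 0 \<le> \<phi> x t) \<and>
     (\<forall>f. f \<in> borel_measurable (lebesgue_on \<Omega>) \<longrightarrow>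
          (\<lambda>x. \<phi> x \<bar>f x\<bar>) \<in> borel_measurable (lebesgue_on \<Omega>)) \<and>
     (\<forall>x\<in>\<Omega>. mono_on {0..} (\<phi> x)) \<and>
     (\<forall>x\<in>\<Omega>. \<phi> x 0 = 0 \<and> ((\<phi> x) \<longlongrightarrow> 0) (at_right 0)) \<and>
     (\<forall>x\<in>\<Omega>. filterlim (\<phi> x) at_top at_top) \<and>
     (\<exists>L\<ge>1. aInc \<Omega> \<phi> 1 L)"

definition A1 :: "(real ^ 'n) set \<Rightarrow> 'n phi_fun \<Rightarrow> real \<Rightarrow> real \<Rightarrow> bool" where
  "A1 \<Omega> \<phi> s Lw \<longleftrightarrow> (\<forall>\<rho>\<in>{0<..1}. \<forall>z. \<forall>x\<in>ball z \<rho> \<inter> \<Omega>. \<forall>y\<in>ball z \<rho> \<inter> \<Omega>. \<forall>t\<ge>0.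
      t powr s \<le> 1 / measure lebesgue (ball z \<rho>) \<longrightarrow>
      \<bar>\<phi> x t - \<phi> y t\<bar> \<le> Lw * (\<phi> y t + 1))"

definition phi_minus :: "(real ^ 'n) set \<Rightarrow> 'n phi_fun \<Rightarrow> (real ^ 'n) set \<Rightarrow> real \<Rightarrow> real" where
  "phi_minus \<Omega> \<phi> B t = Inf ((\<lambda>x. \<phi> x t) ` (B \<inter> \<Omega>))"

definition weak_gradient :: "(real ^ 'n \<Rightarrow> real) \<Rightarrow> (real ^ 'n \<Rightarrow> real ^ 'n) \<Rightarrow> (real ^ 'n) set \<Rightarrow> bool" where
  "weak_gradient u Du U \<longleftrightarrow>
     (\<forall>K. compact K \<longrightarrow> K \<subseteq> U \<longrightarrow>
        integrable (lebesgue_on K) u \<and> integrable (lebesgue_on K) Du) \<and>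
     (\<forall>\<psi> D\<psi>. (\<forall>x. (\<psi> has_derivative (\<lambda>h. D\<psi> x \<bullet> h)) (at x)) \<and> continuous_on UNIV D\<psi> \<and>
        compact (closure {x. \<psi> x \<noteq> 0}) \<and> closure {x. \<psi> x \<noteq> 0} \<subseteq> U \<longrightarrow>
        (\<forall>i. integral\<^sup>L (lebesgue_on U) (\<lambda>x. u x * (D\<psi> x $ i))
             = - integral\<^sup>L (lebesgue_on U) (\<lambda>x. (Du x $ i) * \<psi> x)))"

text \<open>Membership in the generalized Orlicz space L^phi(K): finite Luxemburg norm.\<close>
definition in_Lphi :: "'n phi_fun \<Rightarrow> (real ^ 'n) set \<Rightarrow> (real ^ 'n \<Rightarrow> real) \<Rightarrow> bool" where
  "in_Lphi \<phi> K f \<longleftrightarrow> f \<in> borel_measurable (lebesgue_on K) \<and>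
     (\<exists>lam>0. (\<integral>\<^sup>+ x\<in>K. ennreal (\<phi> x (\<bar>f x\<bar> / lam)) \<partial>lebesgue) \<le> 1)"

definition W1phi_loc :: "'n phi_fun \<Rightarrow> (real ^ 'n) set \<Rightarrow> (real ^ 'n \<Rightarrow> real) \<Rightarrow> (real ^ 'n \<Rightarrow> real ^ 'n) \<Rightarrow> bool" where
  "W1phi_loc \<phi> U v Dv \<longleftrightarrow> weak_gradient v Dv U \<and>
     (\<forall>K. compact K \<longrightarrow> K \<subseteq> U \<longrightarrow> in_Lphi \<phi> K v \<and> in_Lphi \<phi> K (\<lambda>x. norm (Dv x)))"

definition quasiminimizer :: "'n phi_fun \<Rightarrow> (real ^ 'n) set \<Rightarrow> (real ^ 'n \<Rightarrow> real) \<Rightarrow> (real ^ 'n \<Rightarrow> real ^ 'n) \<Rightarrow> real \<Rightarrow> bool" where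
  "quasiminimizer \<phi> U u Du Q \<longleftrightarrow>
     (\<forall>v Dv. W1phi_loc \<phi> U v Dv \<longrightarrow>
        (let S = closure {x\<in>U. u x \<noteq> v x} in
          compact S \<and> S \<subseteq> U \<longrightarrow>
          (\<integral>\<^sup>+ x\<in>S. ennreal (\<phi> x (norm (Du x))) \<partial>lebesgue)
            \<le> ennreal Q * (\<integral>\<^sup>+ x\<in>S. ennreal (\<phi> x (norm (Dv x))) \<partial>lebesgue)))"

definition holder_seminorm :: "real \<Rightarrow> (real ^ 'n \<Rightarrow> real) \<Rightarrow> (real ^ 'n) set \<Rightarrow> real" where
  "holder_seminorm g u B = (SUP (x,y)\<in>{(x,y). x \<in> B \<and> y \<in> B \<and> x \<noteq> y}. \<bar>u x - u y\<bar> / dist x y powr g)"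

definition holder_on :: "real \<Rightarrow> (real ^ 'n \<Rightarrow> real) \<Rightarrow> (real ^ 'n) set \<Rightarrow> bool" where
  "holder_on g u B \<longleftrightarrow> continuous_on B u \<and>
     bdd_above ((\<lambda>(x,y). \<bar>u x - u y\<bar> / dist x y powr g) ` {(x,y). x \<in> B \<and> y \<in> B \<and> x \<noteq> y})"

definition avg :: "(real ^ 'n) set \<Rightarrow> (real ^ 'n \<Rightarrow> real) \<Rightarrow> real" where
  "avg B f = integral\<^sup>L (lebesgue_on B) f / measure lebesgue B"

end

theory Submission
  imports Defs
begin

text \<open>
  Write \<open>g x = \<phi> x \<bar>Du x\<bar>\<close> and \<open>\<psi> = phi_minus \<Omega> \<phi> B\<^sub>R\<close>. Quasiminimality, tested with \<open>u - \<eta> (u - k)\<close>, and hole filling give a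
  Caccioppoli inequality with \<open>\<phi> x (\<bar>u - k\<bar> / R)\<close> on the right. Hoelder continuity gives \<open>\<bar>u - k\<bar> / R \<le> c R\<^sup>\<gamma>\<^sup>-\<^sup>1\<close>, which is exactly
  the range in which (A1) allows to replace \<open>\<phi> x\<close> by \<open>\<psi>\<close> (for \<open>R > 1\<close> the right-hand side is simply bounded). For \<open>k\<close> a kernel average
  at a small scale \<open>l\<close>, the telescoping sum of the kernel averages at the scales \<open>l / 2\<^sup>j\<close> and Jensen's inequality bound
  \<open>\<psi> (\<bar>u - k\<bar> / R)\<close> by a small multiple of the integral of \<open>\<psi> \<bar>Du\<bar>\<close>, which is absorbed, plus a multiple of \<open>\<psi>\<close> at the mean
  of \<open>\<bar>Du\<bar>\<close>. So \<open>g\<close> satisfies \<open>avg g \<le> c \<psi> (avg \<bar>Du\<bar>) + c\<close> on concentric balls; by (aInc) with exponent \<open>p > 1\<close> this is a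
  reverse Hoelder inequality, and Gehring's lemma yields the exponent \<open>1 + \<sigma>\<close>.
\<close>

text \<open>(A1) is never applied to \<open>Du\<close>: it needs an argument of size
  \<open>R powr (\<gamma> - 1)\<close>, which only the Hoelder bound on \<open>u - k\<close>
  supplies. On the gradient side there is just the trivial bound of \<open>\<psi>\<close> by
  \<open>\<phi> x\<close>. No exponent is gained from a Sobolev embedding either. Instead the
  oscillation is split into a part at scale \<open>l\<close>, made small by the choice of
  \<open>l\<close>, and a translation of kernel averages to the common centre, which costs a power
  of \<open>R / l\<close> but sees only the mean of \<open>norm (Du x)\<close>. This cost blows up
  as the gap \<open>t - s\<close> between two radii shrinks, and \<open>absorb_iteration\<close> is
  there to survive that. Smooth kernels replace plain ball means because
  \<open>weak_gradient\<close> tests with continuously differentiable functions. The theorem fixes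
  \<open>\<sigma>\<close> and \<open>c\<close> before \<open>\<Omega>\<close>, \<open>\<phi>\<close>
  and \<open>\<gamma>\<close>. Hence the constants of the energy estimate are explicit functions of
  \<open>q\<close>, \<open>L\<close>, \<open>Lw\<close>, \<open>Q\<close>, \<open>K\<close> and the
  dimension, and \<open>\<gamma>\<close> has to be kept out of all of them.\<close>

abbreviation lint :: "'a::euclidean_space set \<Rightarrow> ('a \<Rightarrow> 'b::{banach, second_countable_topology}) \<Rightarrow> 'b" where
  "lint S f \<equiv> integral\<^sup>L (lebesgue_on S) f"

section \<open>Integrals over Lebesgue measurable sets\<close>

lemma integrable_on_subset_lebesgue:
  fixes f :: "'a::euclidean_space \<Rightarrow> 'b::euclidean_space"
  assumes "integrable (lebesgue_on T) f" "S \<subseteq> T" "S \<in> sets lebesgue" "T \<in> sets lebesgue"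
  shows "integrable (lebesgue_on S) f"
proof -
  have "set_integrable lebesgue T f" using assms by (simp add: set_integrable_def integrable_restrict_space)
  then have "set_integrable lebesgue S f" by (rule set_integrable_subset) (use assms in auto)
  then show ?thesis using assms by (simp add: set_integrable_def integrable_restrict_space)
qed

lemma integral_on_mono_set:
  fixes f :: "'a::euclidean_space \<Rightarrow> real"
  assumes "integrable (lebesgue_on T) f" "S \<subseteq> T" "S \<in> sets lebesgue" "T \<in> sets lebesgue"
    and "\<And>x. x \<in> T \<Longrightarrow> 0 \<le> f x"
  shows "lint S f \<le> lint T f"
proof -
  have "set_integrable lebesgue T f" using assms by (simp add: set_integrable_def integrable_restrict_space)
  moreover from this have "set_integrable lebesgue S f" by (rule set_integrable_subset) (use assms in auto)
  ultimately have "(\<integral>x. indicator S x *\<^sub>R f x \<partial>lebesgue) \<le> (\<integral>x. indicator T x *\<^sub>R f x \<partial>lebesgue)"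
    unfolding set_integrable_def using assms by (intro integral_mono) (auto simp: indicator_def)
  then show ?thesis using assms by (simp add: integral_restrict_space)
qed

lemma integral_on_zero_outside:
  fixes f :: "'a::euclidean_space \<Rightarrow> 'b::euclidean_space"
  assumes "S \<subseteq> T" "S \<in> sets lebesgue" "T \<in> sets lebesgue" "\<And>x. x \<in> T \<Longrightarrow> x \<notin> S \<Longrightarrow> f x = 0"
  shows "lint T f = lint S f"
proof -
  have "(\<integral>x. indicator T x *\<^sub>R f x \<partial>lebesgue) = (\<integral>x. indicator S x *\<^sub>R f x \<partial>lebesgue)"
    using assms by (intro Bochner_Integration.integral_cong) (auto simp: indicator_def)
  then show ?thesis using assms by (simp add: integral_restrict_space)
qed

lemma integrable_on_zero_outside:
  fixes f :: "'a::euclidean_space \<Rightarrow> 'b::euclidean_space"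
  assumes "S \<subseteq> T" "S \<in> sets lebesgue" "T \<in> sets lebesgue" "\<And>x. x \<in> T \<Longrightarrow> x \<notin> S \<Longrightarrow> f x = 0"
    and "integrable (lebesgue_on S) f"
  shows "integrable (lebesgue_on T) f"
proof -
  have "(\<lambda>x. indicator T x *\<^sub>R f x) = (\<lambda>x. indicator S x *\<^sub>R f x)"
    using assms by (auto simp: indicator_def fun_eq_iff)
  then show ?thesis using assms by (simp add: integrable_restrict_space)
qed

lemma integral_on_Diff:
  fixes f :: "'a::euclidean_space \<Rightarrow> real"
  assumes "integrable (lebesgue_on T) f" "S \<subseteq> T" "S \<in> sets lebesgue" "T \<in> sets lebesgue"
  shows "lint (T - S) f = lint T f - lint S f"
proof -
  have T: "set_integrable lebesgue T f" using assms by (simp add: set_integrable_def integrable_restrict_space)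
  have S: "set_integrable lebesgue S f" by (rule set_integrable_subset[OF T]) (use assms in auto)
  have "(\<integral>x. indicator (T - S) x *\<^sub>R f x \<partial>lebesgue)
     = (\<integral>x. indicator T x *\<^sub>R f x - indicator S x *\<^sub>R f x \<partial>lebesgue)"
    using assms by (intro Bochner_Integration.integral_cong) (auto simp: indicator_def)
  also have "\<dots> = (\<integral>x. indicator T x *\<^sub>R f x \<partial>lebesgue) - (\<integral>x. indicator S x *\<^sub>R f x \<partial>lebesgue)"
    using S T unfolding set_integrable_def by (rule Bochner_Integration.integral_diff[rotated])
  finally show ?thesis using assms by (simp add: integral_restrict_space)
qed

lemma nn_set_integral_eq_integral_on:
  fixes f :: "'a::euclidean_space \<Rightarrow> real"
  assumes "integrable (lebesgue_on S) f" "S \<in> sets lebesgue" "\<And>x. x \<in> S \<Longrightarrow> 0 \<le> f x"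
  shows "(\<integral>\<^sup>+x\<in>S. ennreal (f x) \<partial>lebesgue) = ennreal (lint S f)"
proof -
  have "(\<integral>\<^sup>+x\<in>S. ennreal (f x) \<partial>lebesgue) = (\<integral>\<^sup>+x. ennreal (f x) \<partial>lebesgue_on S)"
    using assms by (subst nn_integral_restrict_space) auto
  also have "\<dots> = ennreal (lint S f)"
    using assms by (intro nn_integral_eq_integral) auto
  finally show ?thesis .
qed

lemma integrable_on_if_nn_set_integral:
  fixes f :: "'a::euclidean_space \<Rightarrow> real"
  assumes "f \<in> borel_measurable (lebesgue_on S)" "S \<in> sets lebesgue" "\<And>x. x \<in> S \<Longrightarrow> 0 \<le> f x"
    and "(\<integral>\<^sup>+x\<in>S. ennreal (f x) \<partial>lebesgue) < \<infinity>"
  shows "integrable (lebesgue_on S) f"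
proof (rule integrableI_bounded[OF assms(1)])
  have "(\<integral>\<^sup>+x. ennreal (norm (f x)) \<partial>lebesgue_on S) = (\<integral>\<^sup>+x. ennreal (f x) \<partial>lebesgue_on S)"
    using assms by (intro nn_integral_cong) auto
  also have "\<dots> = (\<integral>\<^sup>+x\<in>S. ennreal (f x) \<partial>lebesgue)"
    using assms by (subst nn_integral_restrict_space) auto
  finally show "(\<integral>\<^sup>+x. ennreal (norm (f x)) \<partial>lebesgue_on S) < \<infinity>" using assms by simp
qed

lemma integrable_on_mult_continuous:
  fixes f h :: "'a::euclidean_space \<Rightarrow> real"
  assumes "compact S" "integrable (lebesgue_on S) f" "continuous_on S h"
  shows "integrable (lebesgue_on S) (\<lambda>x. f x * h x)"
proof -
  obtain B where B: "\<And>x. x \<in> S \<Longrightarrow> norm (h x) \<le> B" 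
    using compact_imp_bounded[OF compact_continuous_image[OF assms(3,1)]] by (auto simp: bounded_iff)
  have S: "S \<in> sets lebesgue" using assms(1) by (simp add: lmeasurable_compact fmeasurableD)
  have h: "h \<in> borel_measurable (lebesgue_on S)"
    using assms(3) S by (rule continuous_imp_measurable_on_sets_lebesgue)
  show ?thesis
  proof (rule Bochner_Integration.integrable_bound)
    show "integrable (lebesgue_on S) (\<lambda>x. B * f x)" using assms(2) by simp
    show "(\<lambda>x. f x * h x) \<in> borel_measurable (lebesgue_on S)"
      using assms(2) h by (intro borel_measurable_times) auto
    show "AE x in lebesgue_on S. norm (f x * h x) \<le> norm (B * f x)"
    proof (rule AE_I2)
      fix x assume "x \<in> space (lebesgue_on S)"
      then have "\<bar>h x\<bar> \<le> B" using B by simp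
      then have "\<bar>h x\<bar> * \<bar>f x\<bar> \<le> \<bar>B\<bar> * \<bar>f x\<bar>" by (intro mult_right_mono) auto
      then show "norm (f x * h x) \<le> norm (B * f x)" by (simp add: abs_mult mult.commute)
    qed
  qed
qed

lemma continuous_imp_integrable_on_compact:
  fixes f :: "'a::euclidean_space \<Rightarrow> real"
  assumes "compact S" "continuous_on S f"
  shows "integrable (lebesgue_on S) f"
proof -
  have "finite_measure (lebesgue_on S)"
    using assms(1) by (intro finite_measure_lebesgue_on lmeasurable_compact)
  then have "integrable (lebesgue_on S) (\<lambda>x. 1 :: real)"
    by (rule finite_measure.integrable_const)
  from integrable_on_mult_continuous[OF assms(1) this assms(2)] show ?thesis by simp
qed

subsection \<open>Absorption and growth conditions\<close>

definition absorb_const :: "real \<Rightarrow> real \<Rightarrow> real" where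
  "absorb_const \<theta> a = 1 / ((1 - ((1 + \<theta>) / 2) powr (1 / a)) powr a * (1 - 2 * \<theta> / (1 + \<theta>)))"

text \<open>The supremum of \<open>Z s * (r1 - s) powr a\<close> over \<open>s\<close> is finite and bounded by a fraction of itself plus a multiple of \<open>B\<close>;
  the point \<open>t\<close> belonging to \<open>s\<close> divides \<open>[s, r1]\<close> in a fixed ratio.\<close>

lemma absorb_iteration:
  fixes Z :: "real \<Rightarrow> real"
  assumes Z0: "\<And>s. r0 \<le> s \<Longrightarrow> s < r1 \<Longrightarrow> 0 \<le> Z s" and ZM: "\<And>s. r0 \<le> s \<Longrightarrow> s < r1 \<Longrightarrow> Z s \<le> M"
    and th: "0 \<le> \<theta>" "\<theta> < 1" and a: "0 < a" and r: "r0 < r1" 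
    and step: "\<And>s t. r0 \<le> s \<Longrightarrow> s < t \<Longrightarrow> t < r1 \<Longrightarrow> Z s \<le> \<theta> * Z t + B / (t - s) powr a"
  shows "Z r0 \<le> absorb_const \<theta> a * B / (r1 - r0) powr a"
proof -
  \<comment> \<open>\<open>l\<close> is the fraction of \<open>r1 - s\<close> left beyond
    \<open>t\<close>. As \<open>l powr a\<close> is the midpoint of \<theta> and 1, passing from
    \<open>s\<close> to \<open>t\<close> turns the factor \<theta> into
    \<open>2 * \<theta> / (1 + \<theta>)\<close>, which is still below 1.\<close>
  define l where "l = ((1 + \<theta>) / 2) powr (1 / a)"
  have l0: "0 < l" using th by (simp add: l_def)
  have l1: "l < 1" unfolding l_def using th a powr_less_mono2[of "1/a" "(1+\<theta>)/2" 1] by simp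
  have la: "l powr a = (1 + \<theta>) / 2" using th a by (simp add: l_def powr_powr)
  define S where "S = (\<lambda>s. Z s * (r1 - s) powr a) ` {r0..<r1}"
  have M0: "0 \<le> M" using Z0[of r0] ZM[of r0] r by simp
  \<comment> \<open>\<open>M\<close> serves only to make the supremum finite, so that a fraction of
    it can be absorbed. It leaves no trace in the constant.\<close>
  have bdd: "bdd_above S"
    unfolding S_def
  proof (rule bdd_aboveI2)
    fix s assume "s \<in> {r0..<r1}"
    then show "Z s * (r1 - s) powr a \<le> M * (r1 - r0) powr a"
      using ZM[of s] Z0[of s] M0 a by (intro mult_mono powr_mono2) auto
  qed
  have ne: "S \<noteq> {}" using r by (auto simp: S_def)
  define Y where "Y = Sup S"
  have YU: "Z s * (r1 - s) powr a \<le> Y" if "r0 \<le> s" "s < r1" for s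
    unfolding Y_def by (rule cSup_upper[OF _ bdd]) (use that in \<open>auto simp: S_def\<close>)
  have key: "Z s * (r1 - s) powr a \<le> 2 * \<theta> / (1 + \<theta>) * Y + B / (1 - l) powr a"
    if s: "r0 \<le> s" "s < r1" for s
  proof -
    define t where "t = r1 - l * (r1 - s)"
    have ts: "t - s = (1 - l) * (r1 - s)" by (simp add: t_def algebra_simps)
    have "t - s > 0" unfolding ts using l1 s by simp
    then have "s < t" by simp
    moreover have "t < r1" using l0 s by (simp add: t_def)
    ultimately have "Z s \<le> \<theta> * Z t + B / (t - s) powr a" using step s by blast
    then have "Z s * (r1 - s) powr a \<le> (\<theta> * Z t + B / (t - s) powr a) * (r1 - s) powr a"
      by (intro mult_right_mono) auto
    also have "\<dots> = \<theta> * (Z t * (r1 - s) powr a) + B / (1 - l) powr a"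
    proof -
      have "(t - s) powr a = (1 - l) powr a * (r1 - s) powr a"
        unfolding ts using s l1 by (simp add: powr_mult)
      then show ?thesis using s l1 by (simp add: field_simps)
    qed
    also have "Z t * (r1 - s) powr a = Z t * (r1 - t) powr a * (2 / (1 + \<theta>))"
    proof -
      have "(r1 - t) powr a = (1 + \<theta>) / 2 * (r1 - s) powr a"
        using s l0 by (simp add: t_def powr_mult la)
      then show ?thesis using th by (simp add: field_simps)
    qed
    also have "\<theta> * (Z t * (r1 - t) powr a * (2 / (1 + \<theta>))) \<le> \<theta> * (Y * (2 / (1 + \<theta>)))"
      using th YU[of t] \<open>s < t\<close> \<open>t < r1\<close> s by (intro mult_left_mono mult_right_mono) auto
    finally show ?thesis by (simp add: mult_ac)
  qed
  have "Y \<le> 2 * \<theta> / (1 + \<theta>) * Y + B / (1 - l) powr a"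
    unfolding Y_def using key unfolding Y_def by (intro cSup_least[OF ne]) (auto simp: S_def)
  then have "Y * (1 - 2 * \<theta> / (1 + \<theta>)) \<le> B / (1 - l) powr a" by (simp add: algebra_simps)
  moreover have pos: "0 < 1 - 2 * \<theta> / (1 + \<theta>)" using th by (simp add: field_simps)
  ultimately have "Y \<le> B / (1 - l) powr a / (1 - 2 * \<theta> / (1 + \<theta>))" by (simp only: pos_le_divide_eq[OF pos])
  then have "Z r0 * (r1 - r0) powr a \<le> B / (1 - l) powr a / (1 - 2 * \<theta> / (1 + \<theta>))"
    using YU[of r0] r by simp
  also have "\<dots> = absorb_const \<theta> a * B" by (simp add: absorb_const_def l_def)
  finally show ?thesis using r by (simp add: pos_le_divide_eq)
qed

lemma absorb_const_nonneg:
  assumes "0 \<le> \<theta>" "\<theta> < 1"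
  shows "0 \<le> absorb_const \<theta> a"
proof -
  have "2 * \<theta> / (1 + \<theta>) \<le> 1" using assms by (simp add: field_simps)
  then show ?thesis unfolding absorb_const_def by (intro divide_nonneg_nonneg mult_nonneg_nonneg) auto
qed

text \<open>One calculus for a single function of \<open>t\<close>, applied both to
  \<open>\<phi> x\<close> at a fixed point and to the infimum of \<phi> over a ball. Neither
  convexity nor continuity is assumed; every estimate rests on monotonicity and the two
  almost-monotonicity conditions.\<close>

locale growth =
  fixes p q L :: real and \<psi> :: "real \<Rightarrow> real"
  assumes p1: "1 \<le> p" and pq: "p \<le> q" and L1: "1 \<le> L"
    and at_0: "\<psi> 0 = 0"
    and mono: "\<And>s t. 0 \<le> s \<Longrightarrow> s \<le> t \<Longrightarrow> \<psi> s \<le> \<psi> t"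
    and at_1: "\<psi> 1 \<le> L"
    and inc: "\<And>s t. 0 < s \<Longrightarrow> s \<le> t \<Longrightarrow> \<psi> s / s powr p \<le> L * (\<psi> t / t powr p)"
    and dec: "\<And>s t. 0 < s \<Longrightarrow> s \<le> t \<Longrightarrow> \<psi> t / t powr q \<le> L * (\<psi> s / s powr q)"
begin

lemma nonneg: "0 \<le> t \<Longrightarrow> 0 \<le> \<psi> t"
  using mono[of 0 t] at_0 by simp

lemma scale_up:
  assumes "1 \<le> c" "0 \<le> t"
  shows "\<psi> (c * t) \<le> L * c powr q * \<psi> t"
proof (cases "t = 0")
  case True then show ?thesis by (simp add: at_0)
next
  case False
  then have t: "0 < t" using assms by simp
  have "t * 1 \<le> t * c" using t assms by (intro mult_left_mono) auto
  then have "\<psi> (c * t) / (c * t) powr q \<le> L * (\<psi> t / t powr q)"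
    using t dec[of t "c * t"] by (simp add: mult.commute)
  moreover have "(c * t) powr q = c powr q * t powr q" using assms t by (simp add: powr_mult)
  moreover have "0 < c powr q" "0 < t powr q" using assms t by auto
  ultimately show ?thesis by (simp add: field_simps)
qed

lemma scale_down:
  assumes "0 \<le> c" "c \<le> 1" "0 \<le> t"
  shows "\<psi> (c * t) \<le> L * c powr p * \<psi> t"
proof (cases "t = 0 \<or> c = 0")
  case True then show ?thesis using nonneg[of t] assms by (auto simp add: at_0)
next
  case False
  then have t: "0 < t" "0 < c" using assms by auto
  have "\<psi> (c * t) / (c * t) powr p \<le> L * (\<psi> t / t powr p)"
    using t assms inc[of "c * t" t] by (simp add: mult_left_le_one_le)
  moreover have "(c * t) powr p = c powr p * t powr p" using assms t by (simp add: powr_mult)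
  moreover have "0 < c powr p" "0 < t powr p" using t by auto
  ultimately show ?thesis by (simp add: field_simps)
qed

lemma scale_down1:
  assumes "0 \<le> c" "c \<le> 1" "0 \<le> t"
  shows "\<psi> (c * t) \<le> L * c * \<psi> t"
proof -
  have "c powr p \<le> c" using assms p1 powr_mono'[of 1 p c] by simp
  then have "L * c powr p * \<psi> t \<le> L * c * \<psi> t"
    using L1 nonneg[of t] assms by (intro mult_right_mono mult_left_mono) auto
  then show ?thesis using scale_down[OF assms] by simp
qed

lemma scale_max:
  assumes "0 \<le> c" "0 \<le> t"
  shows "\<psi> (c * t) \<le> L * max 1 c powr q * \<psi> t"
proof -
  have "\<psi> (c * t) \<le> \<psi> (max 1 c * t)" using assms by (intro mono mult_nonneg_nonneg mult_right_mono) auto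
  then show ?thesis using scale_up[of "max 1 c" t] assms by simp
qed

lemma subadditive:
  assumes "0 \<le> a" "0 \<le> b"
  shows "\<psi> (a + b) \<le> L * 2 powr q * (\<psi> a + \<psi> b)"
proof -
  have "\<psi> (a + b) \<le> \<psi> (2 * max a b)" using assms by (intro mono) auto
  also have "\<dots> \<le> L * 2 powr q * \<psi> (max a b)" using assms by (intro scale_up) auto
  also have "\<dots> \<le> L * 2 powr q * (\<psi> a + \<psi> b)"
    using L1 assms nonneg[of a] nonneg[of b] by (intro mult_left_mono) (auto simp: max_def)
  finally show ?thesis .
qed

lemma upper:
  assumes "0 \<le> t"
  shows "\<psi> t \<le> L\<^sup>2 * max 1 t powr q"
proof -
  have "\<psi> t \<le> L * max 1 t powr q * \<psi> 1" using scale_max[of t 1] assms by simp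
  also have "\<dots> \<le> L * max 1 t powr q * L" using at_1 L1 by (intro mult_left_mono) auto
  finally show ?thesis by (simp add: power2_eq_square mult_ac)
qed

text \<open>A substitute for convexity: averaging over \<open>a\<close> with mean \<open>m\<close> gives Jensen's inequality up to constants.\<close>

lemma supporting_line:
  assumes "0 \<le> a" "0 < m"
  shows "\<psi> (m / 2) * (2 * a / m - 1) \<le> L * \<psi> a"
proof (cases "a \<le> m / 2")
  case True
  then have "2 * a / m - 1 \<le> 0" using assms by (simp add: field_simps)
  then have "\<psi> (m / 2) * (2 * a / m - 1) \<le> 0" using nonneg[of "m/2"] assms by (simp add: mult_nonneg_nonpos)
  then show ?thesis using nonneg[of a] assms L1 by (meson mult_nonneg_nonneg order_trans zero_le_one)
next
  case False
  then have a: "0 < a" "m / (2 * a) \<le> 1" using assms by (auto simp: field_simps)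
  have "\<psi> (m / (2 * a) * a) \<le> L * (m / (2 * a)) * \<psi> a" using a assms by (intro scale_down1) auto
  then have "\<psi> (m / 2) \<le> L * (m / (2 * a)) * \<psi> a" using a by simp
  then have "\<psi> (m / 2) * (2 * a / m) \<le> L * \<psi> a" using a assms by (simp add: field_simps)
  moreover have "0 \<le> \<psi> (m/2)" using assms nonneg by simp
  ultimately show ?thesis by (simp add: algebra_simps)
qed

text \<open>(aInc) with exponent \<open>p\<close> for \<psi> is (aInc) with exponent 1 for its
  \<open>p\<close>-th root, so the argument for \<open>supporting_line\<close> repeats for the
  root.\<close>

lemma root_supporting_line:
  assumes "0 \<le> a" "0 < m"
  shows "\<psi> (m / 2) powr (1 / p) * (2 * a / m - 1) \<le> L * \<psi> a powr (1 / p)"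
proof (cases "a \<le> m / 2")
  case True
  then have "2 * a / m - 1 \<le> 0" using assms by (simp add: field_simps)
  then have "\<psi> (m / 2) powr (1 / p) * (2 * a / m - 1) \<le> 0" by (simp add: mult_nonneg_nonpos)
  then show ?thesis using L1 by (meson mult_nonneg_nonneg order_trans zero_le_one powr_ge_zero)
next
  case False
  then have a: "0 < a" "m / (2 * a) \<le> 1" using assms by (auto simp: field_simps)
  have "\<psi> (m / (2 * a) * a) \<le> L * (m / (2 * a)) powr p * \<psi> a" using a assms by (intro scale_down) auto
  then have "\<psi> (m / 2) powr (1 / p) \<le> (L * (m / (2 * a)) powr p * \<psi> a) powr (1 / p)"
    using a assms p1 nonneg[of "m/2"] by (intro powr_mono2) auto
  also have "\<dots> = L powr (1 / p) * (m / (2 * a)) * \<psi> a powr (1 / p)"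
    using L1 assms a p1 nonneg[of a] by (simp add: powr_mult powr_powr)
  also have "\<dots> \<le> L * (m / (2 * a)) * \<psi> a powr (1 / p)"
    using L1 p1 assms a powr_mono[of "1/p" 1 L] by (intro mult_right_mono) auto
  finally have "\<psi> (m / 2) powr (1 / p) * (2 * a / m) \<le> L * \<psi> a powr (1 / p)"
    using a assms by (simp add: field_simps)
  moreover have "0 \<le> \<psi> (m/2) powr (1 / p)" by simp
  ultimately show ?thesis by (simp only: right_diff_distrib)
qed

end

subsection \<open>Kernel averages of weakly differentiable functions\<close>

lemma pos_part_square_deriv:
  "((\<lambda>z::real. (max 0 z)\<^sup>2) has_real_derivative 2 * max 0 z) (at z)"
proof -
  consider "z > 0" | "z < 0" | "z = 0" by linarith
  then show ?thesis
  proof cases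
    case 1
    have "((\<lambda>z::real. z\<^sup>2) has_real_derivative 2 * max 0 z) (at z)"
      using 1 by (auto intro!: derivative_eq_intros)
    then show ?thesis
      by (rule has_field_derivative_transform_within_open[of _ _ _ "{0<..}"]) (use 1 in auto)
  next
    case 2
    have "((\<lambda>z::real. 0) has_real_derivative 2 * max 0 z) (at z)"
      using 2 by (auto intro!: derivative_eq_intros)
    then show ?thesis
      by (rule has_field_derivative_transform_within_open[of _ _ _ "{..<0}"]) (use 2 in auto)
  next
    case 3
    have "((\<lambda>h::real. (max 0 h)\<^sup>2 / h) \<longlongrightarrow> 0) (at 0)"
    proof (rule Lim_null_comparison[OF _ tendsto_rabs_zero])
      show "\<forall>\<^sub>F h::real in at 0. norm ((max 0 h)\<^sup>2 / h) \<le> \<bar>h\<bar>"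
        by (rule always_eventually) (auto simp: max_def power2_eq_square divide_simps)
    qed (rule tendsto_ident_at)
    then show ?thesis using 3 by (simp add: has_field_derivative_iff)
  qed
qed

lemmas pos_part_square_deriv' [derivative_intros] =
  pos_part_square_deriv[THEN DERIV_chain2]

text \<open>Squaring the positive part makes the kernel continuously differentiable across the
  boundary of its supporting ball, hence admissible as a test function for
  \<open>weak_gradient\<close>. The power of \<open>s\<close> makes the total mass independent of
  the scale.\<close>

definition ker :: "real \<Rightarrow> real ^ 'n \<Rightarrow> real ^ 'n \<Rightarrow> real" where
  "ker s c y = (max 0 (1 - (y - c) \<bullet> (y - c) / s\<^sup>2))\<^sup>2 / s ^ CARD('n)"

definition grad_ker :: "real \<Rightarrow> real ^ 'n \<Rightarrow> real ^ 'n \<Rightarrow> real ^ 'n" where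
  "grad_ker s c y = (- (4 * max 0 (1 - (y - c) \<bullet> (y - c) / s\<^sup>2)) / (s\<^sup>2 * s ^ CARD('n))) *\<^sub>R (y - c)"

definition moll :: "(real ^ 'n \<Rightarrow> real) \<Rightarrow> real ^ 'n \<Rightarrow> real \<Rightarrow> real" where
  "moll u c s = (LINT y:cball c s|lebesgue. u y * ker s c y)"

lemma ker_nonneg: "0 < s \<Longrightarrow> 0 \<le> ker s c y"
  by (simp add: ker_def)

lemma ker_le: "0 < s \<Longrightarrow> ker s (c :: real^'n) y \<le> 1 / s ^ CARD('n)"
  unfolding ker_def by (intro divide_right_mono power_le_one) auto

lemma inner_div_ge_1:
  assumes "0 < s" "s \<le> dist c y"
  shows "1 \<le> (y - c) \<bullet> (y - c) / s\<^sup>2"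
proof -
  have "s\<^sup>2 \<le> (dist c y)\<^sup>2" using assms by (intro power_mono) auto
  then show ?thesis using assms by (simp add: dist_norm norm_minus_commute dot_square_norm)
qed

lemma ker_outside: "0 < s \<Longrightarrow> s \<le> dist c y \<Longrightarrow> ker s c y = 0"
  using inner_div_ge_1[of s c y] by (simp add: ker_def max_def)

lemma grad_ker_outside: "0 < s \<Longrightarrow> s \<le> dist c y \<Longrightarrow> grad_ker s c y = 0"
  using inner_div_ge_1[of s c y] by (simp add: grad_ker_def max_def)

lemma ker_continuous_on: "0 < s \<Longrightarrow> continuous_on S (ker s c)"
  unfolding ker_def by (intro continuous_intros) auto

lemma grad_ker_continuous_on: "0 < s \<Longrightarrow> continuous_on S (grad_ker s c)"
  unfolding grad_ker_def by (intro continuous_intros) auto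

lemma ker_has_derivative:
  fixes c :: "real ^ 'n"
  assumes "0 < s"
  shows "(ker s c has_derivative (\<lambda>h. grad_ker s c y \<bullet> h)) (at y)"
proof -
  have 1: "((\<lambda>y. 1 - (y - c) \<bullet> (y - c) / s\<^sup>2) has_derivative (\<lambda>h. - (2 / s\<^sup>2 * ((y - c) \<bullet> h)))) (at y)"
  proof -
    have "((\<lambda>y. 1 - k * ((y - c) \<bullet> (y - c))) has_derivative (\<lambda>h. - (k * (2 * ((y - c) \<bullet> h))))) (at y)" for k
      by (auto intro!: derivative_eq_intros simp: inner_commute algebra_simps)
    from this[of "1 / s\<^sup>2"] show ?thesis by simp
  qed
  have "((\<lambda>z. (max 0 z)\<^sup>2) has_derivative (\<lambda>h. 2 * max 0 (1 - (y - c) \<bullet> (y - c) / s\<^sup>2) * h))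
      (at (1 - (y - c) \<bullet> (y - c) / s\<^sup>2))"
    using pos_part_square_deriv unfolding has_field_derivative_def .
  from has_derivative_compose[OF 1 this]
  have 2: "((\<lambda>y. (max 0 (1 - (y - c) \<bullet> (y - c) / s\<^sup>2))\<^sup>2) has_derivative
      (\<lambda>h. 2 * max 0 (1 - (y - c) \<bullet> (y - c) / s\<^sup>2) * (- (2 / s\<^sup>2 * ((y - c) \<bullet> h))))) (at y)" .
  have 3: "(\<lambda>h. grad_ker s c y \<bullet> h) = (\<lambda>h. (2 * max 0 (1 - (y - c) \<bullet> (y - c) / s\<^sup>2) * (- (2 / s\<^sup>2 * ((y - c) \<bullet> h)))) * (1 / s ^ CARD('n)))"
  proof -
    have "(- (4 * m) / (S * P)) *\<^sub>R w \<bullet> h = 2 * m * (- (2 / S * (w \<bullet> h))) * (1 / P)"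
      for m S P :: real and w h :: "real ^ 'n" by simp
    then show ?thesis unfolding grad_ker_def by blast
  qed
  have 4: "ker s c = (\<lambda>y. (max 0 (1 - (y - c) \<bullet> (y - c) / s\<^sup>2))\<^sup>2 * (1 / s ^ CARD('n)))"
    by (auto simp: ker_def fun_eq_iff)
  show ?thesis unfolding 3 4 by (rule has_derivative_mult_left[OF 2])
qed

text \<open>The continuity equation for a kernel that is translated with velocity \<open>a\<close> and dilated with velocity \<open>b\<close>: the right-hand side is
  minus the divergence of \<open>ker\<close> times the vector field \<open>a + (b / s) (y - c)\<close>, so that \<open>weak_gradient_ker\<close> applies.\<close>

lemma ker_path_deriv:
  fixes c a :: "real ^ 'n"
  assumes s: "s + t * b \<noteq> 0"
  shows "((\<lambda>t. ker (s + t * b) (c + t *\<^sub>R a) y) has_real_derivative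
     - (CARD('n) * (b / (s + t * b)) * ker (s + t * b) (c + t *\<^sub>R a) y
        + (a + (b / (s + t * b)) *\<^sub>R (y - (c + t *\<^sub>R a))) \<bullet> grad_ker (s + t * b) (c + t *\<^sub>R a) y)) (at t)"
proof -
  define S where "S = s + t * b"
  define C where "C = c + t *\<^sub>R a"
  define z where "z = (y - C) \<bullet> (y - C)"
  have S: "S \<noteq> 0" using s by (simp add: S_def)
  have 1: "((\<lambda>t. (y - (c + t *\<^sub>R a)) \<bullet> (y - (c + t *\<^sub>R a))) has_real_derivative - (2 * ((y - C) \<bullet> a))) (at t)"
    unfolding has_field_derivative_def C_def
    by (auto intro!: derivative_eq_intros simp: inner_commute algebra_simps)
  have 2: "((\<lambda>t. 1 - (y - (c + t *\<^sub>R a)) \<bullet> (y - (c + t *\<^sub>R a)) / (s + t * b)\<^sup>2) has_real_derivative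
      (2 * ((y - C) \<bullet> a) / S\<^sup>2 + 2 * b * z / S ^ 3)) (at t)"
    apply (rule derivative_eq_intros 1 refl)+
    using s S unfolding S_def[symmetric] C_def[symmetric] z_def[symmetric]
      apply simp
     apply simp
    using s S unfolding S_def[symmetric] C_def[symmetric] z_def[symmetric]
    apply (simp add: field_simps power2_eq_square power3_eq_cube power4_eq_xxxx)
    done
  have n: "CARD('n) > 0" by simp
  have Sn: "S ^ CARD('n) = S * S ^ (CARD('n) - 1)" using n by (metis power_eq_if not_gr0)
  have 3: "((\<lambda>t. ker (s + t * b) (c + t *\<^sub>R a) y) has_real_derivative
     2 * max 0 (1 - z / S\<^sup>2) * (2 * ((y - C) \<bullet> a) / S\<^sup>2 + 2 * b * z / S ^ 3) / S ^ CARD('n)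
      - CARD('n) * b * (max 0 (1 - z / S\<^sup>2))\<^sup>2 / (S * S ^ CARD('n))) (at t)"
  proof -
    have N: "((\<lambda>t. (max 0 (1 - (y - (c + t *\<^sub>R a)) \<bullet> (y - (c + t *\<^sub>R a)) / (s + t * b)\<^sup>2))\<^sup>2) has_real_derivative
        2 * max 0 (1 - z / S\<^sup>2) * (2 * ((y - C) \<bullet> a) / S\<^sup>2 + 2 * b * z / S ^ 3)) (at t)"
      using pos_part_square_deriv'[OF 2] by (simp add: S_def[symmetric] C_def[symmetric] z_def[symmetric])
    have "((\<lambda>t. s + t * b) has_real_derivative b) (at t)"
      by (auto intro!: derivative_eq_intros)
    from DERIV_power[OF this, of "CARD('n)"]
    have D: "((\<lambda>t. (s + t * b) ^ CARD('n)) has_real_derivative CARD('n) * (b * S ^ (CARD('n) - 1))) (at t)"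
      by (simp add: S_def[symmetric])
    have alg: "(A * P - B * (m * (b * R))) / (P * P) = A / P - m * b * B / (S * P)"
      if "P = S * R" "R \<noteq> 0" for A B P R m :: real
      using that S by (simp add: field_simps)
    show ?thesis
      using DERIV_divide[OF N D] s S alg[OF Sn]
      unfolding ker_def by (simp add: S_def[symmetric] C_def[symmetric] z_def[symmetric])
  qed
  have 4: "- (CARD('n) * (b / S) * ker S C y + (a + (b / S) *\<^sub>R (y - C)) \<bullet> grad_ker S C y)
     = 2 * max 0 (1 - z / S\<^sup>2) * (2 * ((y - C) \<bullet> a) / S\<^sup>2 + 2 * b * z / S ^ 3) / S ^ CARD('n)
      - CARD('n) * b * (max 0 (1 - z / S\<^sup>2))\<^sup>2 / (S * S ^ CARD('n))"
  proof -
    have "- (CARD('n) * (b / S) * (m\<^sup>2 / P) + (a + (b / S) *\<^sub>R w) \<bullet> ((- (4 * m) / (S\<^sup>2 * P)) *\<^sub>R w))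
      = 2 * m * (2 * (w \<bullet> a) / S\<^sup>2 + 2 * b * (w \<bullet> w) / S ^ 3) / P - CARD('n) * b * m\<^sup>2 / (S * P)"
      if "P \<noteq> 0" for m P :: real and w :: "real ^ 'n"
      using S that
      by (simp add: inner_add_left inner_commute[of a] field_simps power2_eq_square power3_eq_cube)
    then show ?thesis using S unfolding ker_def grad_ker_def z_def by simp
  qed
  show ?thesis by (rule 3[folded 4, unfolded S_def C_def])
qed

text \<open>The test function is the \<open>i\<close>-th component of the field
  \<open>a + \<beta> *\<^sub>R (x - c)\<close> times the kernel; its \<open>i\<close>-th partial
  derivative is the bracket on the left. Summed over \<open>i\<close>, this becomes the divergence
  in \<open>weak_gradient_ker\<close>.\<close>

lemma weak_gradient_component:
  fixes c a :: "real ^ 'n"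
  assumes wg: "weak_gradient u Du \<Omega>" and \<Omega>: "\<Omega> \<in> sets lebesgue" and s: "0 < s" and sub: "cball c s \<subseteq> \<Omega>"
  shows "lint (cball c s) (\<lambda>x. u x * (\<beta> * ker s c x + (a $ i + \<beta> * (x $ i - c $ i)) * grad_ker s c x $ i))
    = - lint (cball c s) (\<lambda>x. Du x $ i * ((a $ i + \<beta> * (x $ i - c $ i)) * ker s c x))"
proof -
  define \<psi> where "\<psi> = (\<lambda>x. (a $ i + \<beta> * (x $ i - c $ i)) * ker s c x)"
  define D where "D = (\<lambda>x. (\<beta> * ker s c x) *\<^sub>R axis i 1 + (a $ i + \<beta> * (x $ i - c $ i)) *\<^sub>R grad_ker s c x)"
  have lin: "((\<lambda>x. a $ i + \<beta> * (x $ i - c $ i)) has_derivative (\<lambda>h. \<beta> * (h $ i))) (at x)" for x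
  proof -
    have "((\<lambda>x. x $ i) has_derivative (\<lambda>h. h $ i)) (at x)"
      by (rule bounded_linear_imp_has_derivative[OF bounded_linear_vec_nth])
    from has_derivative_add[OF has_derivative_const[of "a $ i"] has_derivative_mult_right[OF has_derivative_diff[OF this has_derivative_const[of "c $ i"]], of \<beta>]]
    show ?thesis by simp
  qed
  have der: "(\<psi> has_derivative (\<lambda>h. D x \<bullet> h)) (at x)" for x
  proof -
    have "(\<psi> has_derivative (\<lambda>h. (a $ i + \<beta> * (x $ i - c $ i)) * (grad_ker s c x \<bullet> h) + \<beta> * (h $ i) * ker s c x)) (at x)"
      unfolding \<psi>_def by (rule has_derivative_mult[OF lin ker_has_derivative[OF s]])
    also have "(\<lambda>h. (a $ i + \<beta> * (x $ i - c $ i)) * (grad_ker s c x \<bullet> h) + \<beta> * (h $ i) * ker s c x) = (\<lambda>h. D x \<bullet> h)"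
      by (auto simp: D_def inner_add_left inner_axis' fun_eq_iff)
    finally show ?thesis .
  qed
  have cont: "continuous_on UNIV D"
    unfolding D_def by (intro continuous_intros ker_continuous_on grad_ker_continuous_on s)
  have "{x. \<psi> x \<noteq> 0} \<subseteq> cball c s"
    using ker_outside[OF s, of c] by (force simp: \<psi>_def)
  then have cl: "closure {x. \<psi> x \<noteq> 0} \<subseteq> cball c s" by (simp add: closure_minimal)
  then have cp: "compact (closure {x. \<psi> x \<noteq> 0})"
    using bounded_subset[OF bounded_cball] by (simp add: compact_eq_bounded_closed)
  have "integral\<^sup>L (lebesgue_on \<Omega>) (\<lambda>x. u x * (D x $ i)) = - integral\<^sup>L (lebesgue_on \<Omega>) (\<lambda>x. (Du x $ i) * \<psi> x)"
  proof -
    have "\<forall>i. integral\<^sup>L (lebesgue_on \<Omega>) (\<lambda>x. u x * (D x $ i)) = - integral\<^sup>L (lebesgue_on \<Omega>) (\<lambda>x. (Du x $ i) * \<psi> x)"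
      using wg[unfolded weak_gradient_def, THEN conjunct2, rule_format, of \<psi> D] der cont cp cl sub by auto
    then show ?thesis ..
  qed
  moreover have "integral\<^sup>L (lebesgue_on \<Omega>) (\<lambda>x. u x * (D x $ i)) = lint (cball c s) (\<lambda>x. u x * (D x $ i))"
    by (rule integral_on_zero_outside) (use sub \<Omega> s in \<open>auto simp: D_def ker_outside grad_ker_outside\<close>)
  moreover have "integral\<^sup>L (lebesgue_on \<Omega>) (\<lambda>x. (Du x $ i) * \<psi> x) = lint (cball c s) (\<lambda>x. (Du x $ i) * \<psi> x)"
    by (rule integral_on_zero_outside) (use sub \<Omega> s in \<open>auto simp: \<psi>_def ker_outside\<close>)
  ultimately show ?thesis by (simp add: D_def \<psi>_def)
qed

lemma weak_gradient_ker:
  fixes c a :: "real ^ 'n"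
  assumes wg: "weak_gradient u Du \<Omega>" and \<Omega>: "\<Omega> \<in> sets lebesgue" and s: "0 < s" and sub: "cball c s \<subseteq> \<Omega>"
  shows "lint (cball c s) (\<lambda>x. u x * (real CARD('n) * \<beta> * ker s c x + (a + \<beta> *\<^sub>R (x - c)) \<bullet> grad_ker s c x))
    = - lint (cball c s) (\<lambda>x. Du x \<bullet> (a + \<beta> *\<^sub>R (x - c)) * ker s c x)"
proof -
  have u: "integrable (lebesgue_on (cball c s)) u" and Du: "integrable (lebesgue_on (cball c s)) Du"
    using wg sub unfolding weak_gradient_def by auto
  have Dui: "integrable (lebesgue_on (cball c s)) (\<lambda>x. Du x $ i)" for i
    by (rule integrable_bounded_linear[OF bounded_linear_vec_nth Du])
  have I1: "integrable (lebesgue_on (cball c s)) (\<lambda>x. u x * (\<beta> * ker s c x + (a $ i + \<beta> * (x $ i - c $ i)) * grad_ker s c x $ i))" for i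
    by (intro integrable_on_mult_continuous u continuous_intros ker_continuous_on grad_ker_continuous_on s compact_cball)
  have I2: "integrable (lebesgue_on (cball c s)) (\<lambda>x. Du x $ i * ((a $ i + \<beta> * (x $ i - c $ i)) * ker s c x))" for i
    by (intro integrable_on_mult_continuous Dui continuous_intros ker_continuous_on s compact_cball)
  have "lint (cball c s) (\<lambda>x. u x * (real CARD('n) * \<beta> * ker s c x + (a + \<beta> *\<^sub>R (x - c)) \<bullet> grad_ker s c x))
    = lint (cball c s) (\<lambda>x. \<Sum>i\<in>UNIV. u x * (\<beta> * ker s c x + (a $ i + \<beta> * (x $ i - c $ i)) * grad_ker s c x $ i))"
    by (intro Bochner_Integration.integral_cong)
       (simp_all add: inner_vec_def sum.distrib distrib_left sum_distrib_left right_diff_distrib left_diff_distrib sum_subtractf mult_ac)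
  also have "\<dots> = (\<Sum>i\<in>UNIV. lint (cball c s) (\<lambda>x. u x * (\<beta> * ker s c x + (a $ i + \<beta> * (x $ i - c $ i)) * grad_ker s c x $ i)))"
    by (rule Bochner_Integration.integral_sum) (rule I1)
  also have "\<dots> = (\<Sum>i\<in>UNIV. - lint (cball c s) (\<lambda>x. Du x $ i * ((a $ i + \<beta> * (x $ i - c $ i)) * ker s c x)))"
    by (intro sum.cong refl weak_gradient_component[OF assms])
  also have "\<dots> = - lint (cball c s) (\<lambda>x. \<Sum>i\<in>UNIV. Du x $ i * ((a $ i + \<beta> * (x $ i - c $ i)) * ker s c x))"
    by (subst Bochner_Integration.integral_sum) (auto simp: sum_negf intro!: I2)
  also have "(\<lambda>x. \<Sum>i\<in>UNIV. Du x $ i * ((a $ i + \<beta> * (x $ i - c $ i)) * ker s c x)) = (\<lambda>x. Du x \<bullet> (a + \<beta> *\<^sub>R (x - c)) * ker s c x)"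
    by (simp add: inner_vec_def sum_distrib_left sum_distrib_right mult_ac)
  finally show ?thesis .
qed

text \<open>On the ball the field has norm at most \<open>norm a + \<bar>b\<bar>\<close>, because
  \<open>norm (x - c) \<le> s\<close> cancels the division by \<open>s\<close>. The bound is stated
  with \<open>E\<close> and \<open>\<sigma>\<close> instead of \<open>c\<close> and \<open>s\<close>
  to be uniform along a path of balls.\<close>

lemma weak_gradient_ker_bound:
  fixes c a :: "real ^ 'n"
  assumes wg: "weak_gradient u Du \<Omega>" and \<Omega>: "\<Omega> \<in> sets lebesgue" and s: "0 < s" and sub: "cball c s \<subseteq> E" "E \<subseteq> \<Omega>"
    and E: "compact E" and \<sigma>: "0 < \<sigma>" "\<sigma> \<le> s"
  shows "\<bar>lint (cball c s) (\<lambda>x. u x * (real CARD('n) * (b / s) * ker s c x + (a + (b / s) *\<^sub>R (x - c)) \<bullet> grad_ker s c x))\<bar>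
    \<le> (norm a + \<bar>b\<bar>) / \<sigma> ^ CARD('n) * lint E (\<lambda>x. norm (Du x))"
proof -
  have Es: "E \<in> sets lebesgue" using E by (simp add: lmeasurable_compact fmeasurableD)
  have DE: "integrable (lebesgue_on E) Du"
    using wg sub E unfolding weak_gradient_def by auto
  have D: "integrable (lebesgue_on (cball c s)) (\<lambda>x. norm (Du x))"
    using integrable_on_subset_lebesgue[OF DE sub(1)] Es by auto
  define M where "M = (norm a + \<bar>b\<bar>) / \<sigma> ^ CARD('n)"
  have M: "0 \<le> M" using \<sigma> by (simp add: M_def)
  have pt: "\<bar>Du x \<bullet> (a + (b / s) *\<^sub>R (x - c)) * ker s c x\<bar> \<le> norm (Du x) * M" if "x \<in> cball c s" for x
  proof -
    have "norm (x - c) \<le> s" using that by (simp add: dist_norm norm_minus_commute)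
    then have "\<bar>b / s\<bar> * norm (x - c) \<le> \<bar>b / s\<bar> * s" by (intro mult_left_mono) auto
    then have "norm ((b / s) *\<^sub>R (x - c)) \<le> \<bar>b\<bar>" using s by simp
    then have "norm (a + (b / s) *\<^sub>R (x - c)) \<le> norm a + \<bar>b\<bar>" using norm_triangle_ineq[of a "(b / s) *\<^sub>R (x - c)"] by linarith
    then have "\<bar>Du x \<bullet> (a + (b / s) *\<^sub>R (x - c))\<bar> \<le> norm (Du x) * (norm a + \<bar>b\<bar>)"
      using Cauchy_Schwarz_ineq2[of "Du x" "a + (b / s) *\<^sub>R (x - c)"] by (meson mult_left_mono norm_ge_zero order_trans)
    moreover have "\<bar>ker s c x\<bar> \<le> 1 / \<sigma> ^ CARD('n)"
    proof -
      have "\<bar>ker s c x\<bar> \<le> 1 / s ^ CARD('n)" using ker_le[OF s, of c x] ker_nonneg[OF s, of c x] by simp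
      also have "\<dots> \<le> 1 / \<sigma> ^ CARD('n)" using \<sigma> by (intro divide_left_mono power_mono) auto
      finally show ?thesis .
    qed
    ultimately have "\<bar>Du x \<bullet> (a + (b / s) *\<^sub>R (x - c))\<bar> * \<bar>ker s c x\<bar> \<le> norm (Du x) * (norm a + \<bar>b\<bar>) * (1 / \<sigma> ^ CARD('n))"
      by (intro mult_mono) auto
    then show ?thesis by (simp add: abs_mult M_def mult_ac)
  qed
  have "\<bar>lint (cball c s) (\<lambda>x. Du x \<bullet> (a + (b / s) *\<^sub>R (x - c)) * ker s c x)\<bar>
    \<le> lint (cball c s) (\<lambda>x. norm (Du x) * M)"
  \<comment> \<open>The Bochner integral of a non-integrable function is 0, so in that case the
    bound holds trivially.\<close>
  proof (cases "integrable (lebesgue_on (cball c s)) (\<lambda>x. Du x \<bullet> (a + (b / s) *\<^sub>R (x - c)) * ker s c x)")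
    case True
    show ?thesis
      by (rule integral_abs_bound_integral[OF True]) (use D pt in auto)
  next
    case False
    then show ?thesis using M by (simp add: not_integrable_integral_eq integral_nonneg_AE del: Bochner_Integration.integral_mult_left)
  qed
  also have "\<dots> = M * lint (cball c s) (\<lambda>x. norm (Du x))" by simp
  also have "\<dots> \<le> M * lint E (\<lambda>x. norm (Du x))"
    by (intro mult_left_mono M integral_on_mono_set) (use DE sub Es in auto)
  finally have "\<bar>lint (cball c s) (\<lambda>x. Du x \<bullet> (a + (b / s) *\<^sub>R (x - c)) * ker s c x)\<bar>
    \<le> M * lint E (\<lambda>x. norm (Du x))" .
  then show ?thesis
    using weak_gradient_ker[OF wg \<Omega> s order_trans[OF sub], where a = a and \<beta> = "b / s"] unfolding M_def by (simp only: abs_minus)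
qed

text \<open>A mean value theorem along the segment from \<open>(c0, s0)\<close> to
  \<open>(c0 + a, s0 + b)\<close>. Differentiation under the integral produces, by
  \<open>ker_path_deriv\<close>, exactly the expression that \<open>weak_gradient_ker_bound\<close>
  estimates, so \<open>u\<close> need not be approximated by smooth functions.\<close>

lemma moll_path_bound:
  fixes c0 a :: "real ^ 'n"
  assumes wg: "weak_gradient u Du \<Omega>" and \<Omega>: "\<Omega> \<in> sets lebesgue" and E: "compact E" "E \<subseteq> \<Omega>" and cu: "continuous_on E u"
    and \<sigma>: "0 < \<sigma>" and s: "\<And>t. 0 \<le> t \<Longrightarrow> t \<le> 1 \<Longrightarrow> \<sigma> \<le> s0 + t * b"
    and sub: "\<And>t. 0 \<le> t \<Longrightarrow> t \<le> 1 \<Longrightarrow> cball (c0 + t *\<^sub>R a) (s0 + t * b) \<subseteq> E"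
  shows "\<bar>moll u (c0 + a) (s0 + b) - moll u c0 s0\<bar> \<le> (norm a + \<bar>b\<bar>) / \<sigma> ^ CARD('n) * lint E (\<lambda>x. norm (Du x))"
proof -
  obtain B where B: "\<And>x. x \<in> E \<Longrightarrow> norm (u x) \<le> B" "0 \<le> B"
    using compact_imp_bounded[OF compact_continuous_image[OF cu E(1)]]
    by (metis bounded_pos image_eqI less_imp_le)
  \<comment> \<open>The Leibniz rule wants a domain of integration that does not move with
    \<open>t\<close>. A continuous extension \<open>U\<close> of \<open>u\<close> allows one fixed
    box for all \<open>t\<close>.\<close>
  have "closedin (top_of_set UNIV) E" using E compact_imp_closed by simp
  then obtain U where U: "continuous_on UNIV U" "\<And>x. x \<in> E \<Longrightarrow> U x = u x"
    using Tietze[OF cu _ B(2) B(1), of UNIV] by metis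
  obtain lo hi where box: "E \<subseteq> cbox lo hi"
    using bounded_subset_cbox_symmetric[OF compact_imp_bounded[OF E(1)]] by blast
  define S where "S = (\<lambda>t. s0 + t * b)"
  define C where "C = (\<lambda>t. c0 + t *\<^sub>R a)"
  have S: "0 < S t" if "t \<in> {0..1}" for t using s[of t] \<sigma> that by (simp add: S_def)
  define k' where "k' = (\<lambda>t y. real CARD('n) * (b / S t) * ker (S t) (C t) y + (a + (b / S t) *\<^sub>R (y - C t)) \<bullet> grad_ker (S t) (C t) y)"
  define F where "F = (\<lambda>t. integral (cbox lo hi) (\<lambda>y. U y * ker (S t) (C t) y))"
  define F' where "F' = (\<lambda>t. integral (cbox lo hi) (\<lambda>y. U y * (- k' t y)))"
  have on_ball: "integral (cbox lo hi) (\<lambda>y. U y * f y) = lint (cball (C t) (S t)) (\<lambda>y. u y * f y)"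
    if t: "t \<in> {0..1}" and f: "continuous_on UNIV f" "\<And>y. y \<notin> cball (C t) (S t) \<Longrightarrow> f y = 0" for t f
  proof -
    have sb: "cball (C t) (S t) \<subseteq> E" using sub[of t] t by (simp add: S_def C_def)
    have "integrable (lebesgue_on (cbox lo hi)) (\<lambda>y. U y * f y)"
      by (intro continuous_imp_integrable continuous_intros continuous_on_subset[OF U(1)] continuous_on_subset[OF f(1)]) auto
    then have "integral (cbox lo hi) (\<lambda>y. U y * f y) = lint (cbox lo hi) (\<lambda>y. U y * f y)"
      by (simp add: lebesgue_integral_eq_integral)
    also have "\<dots> = lint (cball (C t) (S t)) (\<lambda>y. U y * f y)"
      using sb box f(2) by (intro integral_on_zero_outside) auto
    also have "\<dots> = lint (cball (C t) (S t)) (\<lambda>y. u y * f y)"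
      using sb U(2) by (intro Bochner_Integration.integral_cong) auto
    finally show ?thesis .
  qed
  have k'_cont: "continuous_on UNIV (k' t)" if "t \<in> {0..1}" for t
    unfolding k'_def using S[OF that] by (intro continuous_intros ker_continuous_on grad_ker_continuous_on) auto
  have Fm: "F t = moll u (C t) (S t)" if t: "t \<in> {0..1}" for t
    unfolding F_def moll_def set_lebesgue_integral_def
    using on_ball[OF t ker_continuous_on[OF S[OF t]]] ker_outside[OF S[OF t], of "C t"] S[OF t]
    by (simp add: integral_restrict_space not_le)
  have der: "(F has_field_derivative F' t) (at t within {0..1})" if t: "t \<in> {0..1}" for t
    unfolding F_def F'_def
  proof (rule leibniz_rule_field_derivative[OF _ _ _ t])
    fix x :: real and y :: "real ^ 'n" assume x: "x \<in> {0..1}"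
    have "((\<lambda>t. ker (S t) (C t) y) has_field_derivative - k' x y) (at x)"
      using ker_path_deriv[of s0 x b c0 a y] S[OF x] by (simp add: S_def C_def k'_def)
    from DERIV_cmult[OF this, of "U y"]
    show "((\<lambda>x. U y * ker (S x) (C x) y) has_field_derivative U y * - k' x y) (at x within {0..1})"
      by (rule has_field_derivative_at_within)
  next
    fix x :: real assume x: "x \<in> {0..1}"
    show "(\<lambda>y. U y * ker (S x) (C x) y) integrable_on cbox lo hi"
      by (intro integrable_continuous continuous_intros ker_continuous_on S x continuous_on_subset[OF U(1)]) auto
  next
    have "continuous_on ({0..1} \<times> cbox lo hi) (\<lambda>z. U (snd z) * - k' (fst z) (snd z))"
      unfolding k'_def ker_def grad_ker_def S_def C_def
      using S by (intro continuous_intros continuous_on_compose2[OF U(1)]) (force simp: S_def)+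
    then show "continuous_on ({0..1} \<times> cbox lo hi) (\<lambda>(x, t). U t * - k' x t)"
      by (simp add: split_beta')
  qed auto
  have bound: "norm (F' t) \<le> (norm a + \<bar>b\<bar>) / \<sigma> ^ CARD('n) * lint E (\<lambda>x. norm (Du x))"
    if t: "t \<in> {0..1}" for t
  proof -
    have sb: "cball (C t) (S t) \<subseteq> E" using sub[of t] t by (simp add: S_def C_def)
    have \<sigma>S: "\<sigma> \<le> S t" using s[of t] t by (simp add: S_def)
    have "F' t = lint (cball (C t) (S t)) (\<lambda>y. u y * - k' t y)"
      unfolding F'_def using ker_outside[OF S[OF t], of "C t"] grad_ker_outside[OF S[OF t], of "C t"] t k'_cont[OF t]
      by (intro on_ball continuous_intros) (auto simp: k'_def)
    also have "\<dots> = - lint (cball (C t) (S t)) (\<lambda>y. u y * k' t y)" by simp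
    finally show ?thesis
      using weak_gradient_ker_bound[OF wg \<Omega> S[OF t] sb E(2,1) \<sigma> \<sigma>S, where a = a and b = b]
      by (simp only: real_norm_def abs_minus k'_def)
  qed
  have "norm (F 1 - F 0) \<le> (norm a + \<bar>b\<bar>) / \<sigma> ^ CARD('n) * lint E (\<lambda>x. norm (Du x)) * norm (1 - 0 :: real)"
    by (rule field_differentiable_bound[of "{0..1}" F F']) (use der bound in auto)
  then show ?thesis using Fm[of 0] Fm[of 1] by (simp add: S_def C_def)
qed

definition kmass :: "'n::finite itself \<Rightarrow> real" where
  "kmass _ = lint (cball 0 1) (ker 1 (0 :: real ^ 'n))"

lemma integral_ker:
  fixes c :: "real ^ 'n"
  assumes s: "0 < s"
  shows "lint (cball c s) (ker s c) = kmass TYPE('n)"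
proof -
  have all: "lint (cball c s) (ker s c) = integral\<^sup>L lborel (ker s c)" if "0 < s" for s and c :: "real ^ 'n"
  proof -
    have "lint UNIV (ker s c) = lint (cball c s) (ker s c)"
      using ker_outside[OF that, of c] by (intro integral_on_zero_outside) (auto simp: not_le)
    moreover have "ker s c \<in> borel_measurable lborel"
      using ker_continuous_on[OF that, of UNIV c] by (simp add: borel_measurable_continuous_onI)
    ultimately show ?thesis by (simp add: lebesgue_on_UNIV_eq integral_completion)
  qed
  have m: "ker s c \<in> borel_measurable borel"
    using ker_continuous_on[OF s, of UNIV c] by (simp add: borel_measurable_continuous_onI)
  have sc: "ker s c (c + s *\<^sub>R x) = ker 1 0 x / s ^ CARD('n)" for x :: "real ^ 'n"
    using s by (simp add: ker_def power2_eq_square)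
  have "integral\<^sup>L lborel (ker s c) = integral\<^sup>L (density (distr lborel borel (\<lambda>x. c + s *\<^sub>R x)) (\<lambda>_. \<bar>s\<bar> ^ DIM(real ^ 'n))) (ker s c)"
    using lborel_affine[of s c] s by simp
  also have "\<dots> = integral\<^sup>L (distr lborel borel (\<lambda>x. c + s *\<^sub>R x)) (\<lambda>x. (s ^ CARD('n)) *\<^sub>R ker s c x)"
    using s m by (subst integral_density) (auto simp: ennreal_power)
  also have "\<dots> = integral\<^sup>L lborel (\<lambda>x. (s ^ CARD('n)) *\<^sub>R ker s c (c + s *\<^sub>R x))"
    using m by (intro integral_distr) auto
  also have "\<dots> = integral\<^sup>L lborel (ker 1 (0 :: real ^ 'n))"
    using s by (intro Bochner_Integration.integral_cong) (auto simp: sc)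
  finally show ?thesis using all[OF s, of c] all[of 1 0] by (simp add: kmass_def)
qed

lemma kmass_pos: "0 < kmass TYPE('n::finite)"
proof -
  have I: "integrable (lebesgue_on (cball 0 1)) (ker 1 (0 :: real ^ 'n))"
    by (intro continuous_imp_integrable_on_compact ker_continuous_on) auto
  have ge: "9 / 16 \<le> ker 1 (0 :: real ^ 'n) x" if "x \<in> cball 0 (1/2)" for x
  proof -
    have "x \<bullet> x \<le> (1/2)\<^sup>2" using that power_mono[of "norm x" "1/2" 2] by (simp add: dot_square_norm)
    then have "3/4 \<le> max 0 (1 - x \<bullet> x)" by (simp add: power2_eq_square)
    then have "(3/4)\<^sup>2 \<le> (max 0 (1 - x \<bullet> x))\<^sup>2" by (rule power_mono) simp
    moreover have "ker 1 (0 :: real ^ 'n) x = (max 0 (1 - x \<bullet> x))\<^sup>2" by (simp add: ker_def)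
    moreover have "(3/4)\<^sup>2 = (9/16 :: real)" by (simp add: power2_eq_square)
    ultimately show ?thesis by linarith
  qed
  have "9 / 16 * measure lebesgue (cball (0 :: real ^ 'n) (1/2)) = lint (cball (0 :: real ^ 'n) (1/2)) (\<lambda>x. 9 / 16)"
    by (simp add: measure_restrict_space)
  also have "\<dots> \<le> lint (cball (0 :: real ^ 'n) (1/2)) (ker 1 0)"
    using ge by (intro integral_mono continuous_imp_integrable_on_compact ker_continuous_on) (auto intro!: continuous_intros)
  also have "\<dots> \<le> kmass TYPE('n)" unfolding kmass_def
    by (rule integral_on_mono_set[OF I]) (auto simp: ker_nonneg)
  finally have "9 / 16 * measure lebesgue (cball (0 :: real ^ 'n) (1/2)) \<le> kmass TYPE('n)" .
  moreover have "0 < measure lebesgue (cball (0 :: real ^ 'n) (1/2))"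
    by (simp add: content_cball_pos)
  ultimately show ?thesis by linarith
qed

section \<open>Normalised kernel averages and their dependence on centre and scale\<close>

definition kavg :: "(real ^ 'n \<Rightarrow> real) \<Rightarrow> real ^ 'n \<Rightarrow> real \<Rightarrow> real" where
  "kavg u c s = moll u c s / kmass TYPE('n)"

lemma kavg_close:
  fixes c :: "real ^ 'n"
  assumes s: "0 < s" and u: "continuous_on (cball c s) u" and B: "\<And>y. y \<in> cball c s \<Longrightarrow> \<bar>u y - k\<bar> \<le> B"
  shows "\<bar>kavg u c s - k\<bar> \<le> B"
proof -
  have Iu: "integrable (lebesgue_on (cball c s)) (\<lambda>y. u y * ker s c y)" and Ik: "integrable (lebesgue_on (cball c s)) (\<lambda>y. k * ker s c y)"
    and Iuk: "integrable (lebesgue_on (cball c s)) (\<lambda>y. (u y - k) * ker s c y)" and IB: "integrable (lebesgue_on (cball c s)) (\<lambda>y. B * ker s c y)"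
    by (auto intro!: continuous_imp_integrable_on_compact continuous_intros ker_continuous_on u s)
  have mm: "moll u c s = lint (cball c s) (\<lambda>y. u y * ker s c y)"
    by (simp add: moll_def set_lebesgue_integral_def integral_restrict_space)
  have "moll u c s - k * kmass TYPE('n) = lint (cball c s) (\<lambda>y. u y * ker s c y) - lint (cball c s) (\<lambda>y. k * ker s c y)"
    by (simp add: mm integral_ker[OF s])
  also have "\<dots> = lint (cball c s) (\<lambda>y. (u y - k) * ker s c y)"
    using Iu Ik by (simp add: left_diff_distrib)
  finally have "\<bar>moll u c s - k * kmass TYPE('n)\<bar> = \<bar>lint (cball c s) (\<lambda>y. (u y - k) * ker s c y)\<bar>" by simp
  also have "\<dots> \<le> lint (cball c s) (\<lambda>y. B * ker s c y)"
    by (rule integral_abs_bound_integral[OF Iuk IB])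
       (use B ker_nonneg[OF s, of c] in \<open>auto simp: abs_mult intro!: mult_right_mono\<close>)
  also have "\<dots> = B * kmass TYPE('n)" by (simp add: integral_ker[OF s])
  finally have "\<bar>moll u c s - k * kmass TYPE('n)\<bar> \<le> B * kmass TYPE('n)" .
  moreover have "kavg u c s - k = (moll u c s - k * kmass TYPE('n)) / kmass TYPE('n)"
    using kmass_pos[where 'n = 'n] by (simp add: kavg_def field_simps)
  ultimately show ?thesis using kmass_pos[where 'n = 'n] by (simp add: abs_divide pos_divide_le_eq)
qed

text \<open>A pure dilation: the centre is fixed and the radius grows from \<open>l / 2\<close> to
  \<open>l\<close>, so \<open>l / 2\<close> is the lower radius bound in
  \<open>moll_path_bound\<close>.\<close>

lemma kavg_dyadic:
  fixes x :: "real ^ 'n"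
  assumes "weak_gradient u Du \<Omega>" "\<Omega> \<in> sets lebesgue" "0 < l" "cball x l \<subseteq> \<Omega>" "continuous_on (cball x l) u"
  shows "\<bar>kavg u x l - kavg u x (l / 2)\<bar> \<le> l / 2 / (l / 2) ^ CARD('n) / kmass TYPE('n) * lint (cball x l) (\<lambda>y. norm (Du y))"
proof -
  have "\<bar>moll u (x + 0) (l / 2 + l / 2) - moll u x (l / 2)\<bar> \<le> (norm (0 :: real^'n) + \<bar>l / 2\<bar>) / (l / 2) ^ CARD('n) * lint (cball x l) (\<lambda>y. norm (Du y))"
  proof (rule moll_path_bound)
    fix t :: real assume t: "0 \<le> t" "t \<le> 1"
    have "t * (l / 2) \<le> 1 * (l / 2)" using t assms by (intro mult_right_mono) auto
    then show "cball (x + t *\<^sub>R 0) (l / 2 + t * (l / 2)) \<subseteq> cball x l"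
      by (simp add: cball_subset_cball_iff)
  qed (use assms in auto)
  moreover have "kavg u x l - kavg u x (l / 2) = (moll u x l - moll u x (l / 2)) / kmass TYPE('n)"
    by (simp add: kavg_def diff_divide_distrib)
  ultimately show ?thesis using kmass_pos[where 'n = 'n] assms
    by (simp add: abs_divide pos_divide_le_eq)
qed

text \<open>A pure translation at fixed radius. The factor \<open>1 / l ^ CARD('n)\<close> bounds
  the height of the kernel; relative to the mean of the gradient over \<open>cball c R\<close> it
  costs a power of \<open>R / l\<close>.\<close>

lemma kavg_translate:
  fixes x :: "real ^ 'n"
  assumes "weak_gradient u Du \<Omega>" "\<Omega> \<in> sets lebesgue" "0 < l" "cball c R \<subseteq> \<Omega>" "continuous_on (cball c R) u" "dist c x + l \<le> R"
  shows "\<bar>kavg u x l - kavg u c l\<bar> \<le> dist c x / l ^ CARD('n) / kmass TYPE('n) * lint (cball c R) (\<lambda>y. norm (Du y))"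
proof -
  have "\<bar>moll u (c + (x - c)) (l + 0) - moll u c l\<bar> \<le> (norm (x - c) + \<bar>0 :: real\<bar>) / l ^ CARD('n) * lint (cball c R) (\<lambda>y. norm (Du y))"
  proof (rule moll_path_bound)
    fix t :: real assume t: "0 \<le> t" "t \<le> 1"
    have "dist c (c + t *\<^sub>R (x - c)) \<le> dist c x"
      using t mult_left_le_one_le[of "norm (x - c)" t] by (simp add: dist_norm norm_minus_commute)
    then show "cball (c + t *\<^sub>R (x - c)) (l + t * 0) \<subseteq> cball c R"
      using assms(6) by (simp add: cball_subset_cball_iff dist_commute)
  qed (use assms in auto)
  moreover have "kavg u x l - kavg u c l = (moll u x l - moll u c l) / kmass TYPE('n)"
    by (simp add: kavg_def diff_divide_distrib)
  ultimately show ?thesis using kmass_pos[where 'n = 'n] assms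
    by (simp add: abs_divide pos_divide_le_eq dist_norm norm_minus_commute)
qed

subsection \<open>A modular Poincare inequality\<close>

abbreviation ubv :: "'n::finite itself \<Rightarrow> real" where
  "ubv _ \<equiv> unit_ball_vol (real CARD('n))"

lemma measure_lebesgue_ball:
  "0 \<le> r \<Longrightarrow> measure lebesgue (ball (c :: real ^ 'n) r) = ubv TYPE('n) * r ^ CARD('n)"
  by (simp add: content_ball)

lemma measure_lebesgue_cball:
  "0 \<le> r \<Longrightarrow> measure lebesgue (cball (c :: real ^ 'n) r) = ubv TYPE('n) * r ^ CARD('n)"
  by (simp add: content_cball)

lemma ubv_pos: "0 < ubv TYPE('n::finite)"
  by (simp add: unit_ball_vol_pos)

text \<open>Fubini's theorem is applied to Borel measures, so a Lebesgue measurable integrand is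
  first replaced by a Borel one that vanishes almost everywhere off \<open>S\<close>.\<close>

lemma borel_nonneg_version:
  fixes f :: "'a::euclidean_space \<Rightarrow> real"
  assumes "f \<in> borel_measurable (lebesgue_on S)" "S \<in> sets lebesgue" "\<And>x. x \<in> S \<Longrightarrow> 0 \<le> f x"
  obtains h where "h \<in> borel_measurable borel" "\<And>x. 0 \<le> h x" "AE x in lebesgue. x \<in> S \<longrightarrow> f x = h x"
    "AE x in lebesgue. x \<notin> S \<longrightarrow> h x = 0"
proof -
  have "(\<lambda>x. if x \<in> S then f x else 0) \<in> borel_measurable lebesgue"
    using assms by (simp add: borel_measurable_if)
  from completion_ex_borel_measurable_real[OF this]
  obtain g where g: "g \<in> borel_measurable lborel" "AE x in lborel. (if x \<in> S then f x else 0) = g x" by blast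
  show thesis
  proof
    show "(\<lambda>x. max 0 (g x)) \<in> borel_measurable borel" using g(1) by simp
    have ae: "AE x in lebesgue. (if x \<in> S then f x else 0) = g x" using AE_completion[OF g(2)] .
    show "AE x in lebesgue. x \<in> S \<longrightarrow> f x = max 0 (g x)"
      using ae by (rule eventually_mono) (metis assms(3) max.absorb2)
    show "AE x in lebesgue. x \<notin> S \<longrightarrow> max 0 (g x) = 0"
      using ae by (rule eventually_mono) auto
  qed auto
qed

text \<open>The centres \<open>x\<close> with \<open>y\<close> in \<open>cball x s\<close> form a
  ball of radius \<open>s\<close>, so exchanging the integrations cancels the normalisation of the
  average. The margin \<open>t' + s \<le> t\<close> keeps all these balls inside
  \<open>cball c t\<close>.\<close>

lemma avg_ball_Fubini:
  fixes c :: "real ^ 'n" and f :: "real ^ 'n \<Rightarrow> real"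
  assumes f: "integrable (lebesgue_on (cball c t)) f" and f0: "\<And>x. x \<in> cball c t \<Longrightarrow> 0 \<le> f x"
    and s: "0 < s" "t' + s \<le> t"
  shows "integrable (lebesgue_on (cball c t')) (\<lambda>x. avg (cball x s) f)"
    and "lint (cball c t') (\<lambda>x. avg (cball x s) f) \<le> lint (cball c t) f"
proof -
  obtain h where h: "h \<in> borel_measurable borel" "\<And>x. 0 \<le> h x"
    "AE x in lebesgue. x \<in> cball c t \<longrightarrow> f x = h x" "AE x in lebesgue. x \<notin> cball c t \<longrightarrow> h x = 0"
    using borel_nonneg_version[OF borel_measurable_integrable[OF f] _ f0] by auto
  have hm[measurable]: "h \<in> borel_measurable borel" by (rule h(1))
  have hI: "(\<integral>\<^sup>+y. ennreal (h y) \<partial>lborel) = ennreal (lint (cball c t) f)"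
  proof -
    have "(\<integral>\<^sup>+y. ennreal (h y) \<partial>lborel) = (\<integral>\<^sup>+y. ennreal (h y) \<partial>lebesgue)" by (simp add: nn_integral_completion)
    also have "\<dots> = (\<integral>\<^sup>+y\<in>cball c t. ennreal (f y) \<partial>lebesgue)"
      using h(3,4) by (intro nn_integral_cong_AE) (auto simp: indicator_def)
    also have "\<dots> = ennreal (lint (cball c t) f)"
      using f f0 by (intro nn_set_integral_eq_integral_on) auto
    finally show ?thesis .
  qed
  define V where "V = ubv TYPE('n) * s ^ CARD('n)"
  have V: "0 < V" using ubv_pos[where 'n = 'n] s by (simp add: V_def)
  have mV: "measure lebesgue (cball x s) = V" "emeasure lborel (cball x s) = ennreal V" for x :: "real ^ 'n"
    unfolding V_def using measure_lebesgue_cball[of s x] emeasure_cball[of s x] s by simp_all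
  define H where "H = (\<lambda>x. \<integral>\<^sup>+y. ennreal (h y) * indicator (cball x s) y \<partial>lborel)"
  have ind: "indicator (cball x s) y = (indicator {z. dist (fst z) (snd z) \<le> s} (x, y) :: ennreal)" for x y :: "real ^ 'n"
    by (simp add: indicator_def)
  have [measurable]: "{z :: (real ^ 'n) \<times> (real ^ 'n). dist (fst z) (snd z) \<le> s} \<in> sets (borel \<Otimes>\<^sub>M borel)"
    unfolding borel_prod by (intro borel_closed closed_Collect_le continuous_intros)
  have Hm: "H \<in> borel_measurable borel"
    unfolding H_def ind by measurable
  have avgH: "ennreal (avg (cball x s) f) = H x / ennreal V" if x: "x \<in> cball c t'" for x
  proof -
    have sub: "cball x s \<subseteq> cball c t" using x s by (simp add: cball_subset_cball_iff dist_commute)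
    have If: "integrable (lebesgue_on (cball x s)) f" by (rule integrable_on_subset_lebesgue[OF f sub]) auto
    have "H x = (\<integral>\<^sup>+y. ennreal (h y) * indicator (cball x s) y \<partial>lebesgue)" by (simp add: H_def nn_integral_completion)
    also have "\<dots> = (\<integral>\<^sup>+y\<in>cball x s. ennreal (f y) \<partial>lebesgue)"
      using h(3) sub by (intro nn_integral_cong_AE) (auto simp: indicator_def elim!: eventually_mono)
    also have "\<dots> = ennreal (lint (cball x s) f)"
      using If f0 sub by (intro nn_set_integral_eq_integral_on) auto
    finally have "H x = ennreal (lint (cball x s) f)" .
    moreover have "0 \<le> lint (cball x s) f"
      using f0 sub by (intro integral_nonneg_AE AE_I2) auto
    ultimately show ?thesis using V by (simp add: avg_def mV divide_ennreal)
  qed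
  have avg0: "0 \<le> avg (cball x s) f" if x: "x \<in> cball c t'" for x
  proof -
    have sub: "cball x s \<subseteq> cball c t" using x s by (simp add: cball_subset_cball_iff dist_commute)
    show ?thesis unfolding avg_def
      using f0 sub by (intro divide_nonneg_nonneg integral_nonneg_AE AE_I2) auto
  qed
  have am: "(\<lambda>x. avg (cball x s) f) \<in> borel_measurable (lebesgue_on (cball c t'))"
  proof -
    have "(\<lambda>x. enn2real (H x / ennreal V)) \<in> borel_measurable (lebesgue_on (cball c t'))"
      using Hm by (intro measurable_restrict_space1 measurable_completion) simp
    also have "?this \<longleftrightarrow> ?thesis"
      by (intro measurable_cong) (use avgH avg0 in \<open>auto simp flip: avgH\<close>)
    finally show ?thesis .
  qed
  have "(\<integral>\<^sup>+x\<in>cball c t'. ennreal (avg (cball x s) f) \<partial>lebesgue) = (\<integral>\<^sup>+x. H x / ennreal V * indicator (cball c t') x \<partial>lebesgue)"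
    by (intro nn_integral_cong) (auto simp: avgH indicator_def)
  also have "\<dots> = (\<integral>\<^sup>+x. H x / ennreal V * indicator (cball c t') x \<partial>lborel)"
    using Hm by (simp add: nn_integral_completion)
  also have "\<dots> \<le> (\<integral>\<^sup>+x. H x / ennreal V \<partial>lborel)"
    by (intro nn_integral_mono) (auto simp: indicator_def)
  also have "\<dots> = (\<integral>\<^sup>+x. H x \<partial>lborel) / ennreal V"
    using Hm by (intro nn_integral_divide) simp
  also have "(\<integral>\<^sup>+x. H x \<partial>lborel) = (\<integral>\<^sup>+y. (\<integral>\<^sup>+x. ennreal (h y) * indicator (cball x s) y \<partial>lborel) \<partial>lborel)"
    unfolding H_def ind by (rule lborel_pair.Fubini'[symmetric]) measurable
  also have "\<dots> = (\<integral>\<^sup>+y. ennreal (h y) * ennreal V \<partial>lborel)"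
  proof (intro nn_integral_cong)
    fix y :: "real ^ 'n"
    have "(\<integral>\<^sup>+x. ennreal (h y) * indicator (cball x s) y \<partial>lborel) = (\<integral>\<^sup>+x. ennreal (h y) * indicator (cball y s) x \<partial>lborel)"
      by (intro nn_integral_cong) (simp add: indicator_def dist_commute)
    also have "\<dots> = ennreal (h y) * ennreal V" by (simp add: nn_integral_cmult_indicator mV)
    finally show "(\<integral>\<^sup>+x. ennreal (h y) * indicator (cball x s) y \<partial>lborel) = ennreal (h y) * ennreal V" .
  qed
  also have "\<dots> = ennreal (lint (cball c t) f) * ennreal V"
    by (simp add: nn_integral_multc hI)
  also have "\<dots> / ennreal V = ennreal (lint (cball c t) f)"
    using V by (simp add: ennreal_mult_divide_eq)
  finally have main: "(\<integral>\<^sup>+x\<in>cball c t'. ennreal (avg (cball x s) f) \<partial>lebesgue) \<le> ennreal (lint (cball c t) f)" .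
  show I: "integrable (lebesgue_on (cball c t')) (\<lambda>x. avg (cball x s) f)"
    by (rule integrable_on_if_nn_set_integral[OF am _ avg0]) (use main in \<open>auto simp: top.not_eq_extremum[symmetric] top_unique\<close>)
  have "0 \<le> lint (cball c t) f"
    using f0 by (intro integral_nonneg_AE AE_I2) auto
  then show "lint (cball c t') (\<lambda>x. avg (cball x s) f) \<le> lint (cball c t) f"
    using main nn_set_integral_eq_integral_on[OF I _ avg0] by simp
qed

lemma integrable_const_lmeasurable:
  "S \<in> lmeasurable \<Longrightarrow> integrable (lebesgue_on S) (\<lambda>x. k :: real)"
  by (intro finite_measure.integrable_const finite_measure_lebesgue_on)

lemma integral_const_on:
  "S \<in> sets lebesgue \<Longrightarrow> lint S (\<lambda>x. k :: real) = measure lebesgue S * k"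
  by (simp add: measure_restrict_space)

lemma avg_mono:
  fixes S :: "(real ^ 'n) set"
  assumes "integrable (lebesgue_on S) f" "integrable (lebesgue_on S) h" "\<And>x. x \<in> S \<Longrightarrow> f x \<le> h x"
  shows "avg S f \<le> avg S h"
  unfolding avg_def by (intro divide_right_mono integral_mono) (use assms in auto)

lemma avg_nonneg:
  fixes S :: "(real ^ 'n) set"
  assumes "\<And>x. x \<in> S \<Longrightarrow> 0 \<le> f x"
  shows "0 \<le> avg S f"
  unfolding avg_def by (intro divide_nonneg_nonneg integral_nonneg_AE AE_I2) (use assms in auto)

lemma avg_affine:
  fixes S :: "(real ^ 'n) set"
  assumes S: "S \<in> lmeasurable" "0 < measure lebesgue S" and f: "integrable (lebesgue_on S) f"
  shows "avg S (\<lambda>x. a * f x - b) = a * avg S f - b"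
  using S f integrable_const_lmeasurable[OF S(1), of b] integral_const_on[of S b]
  by (simp add: avg_def diff_divide_distrib fmeasurableD measure_restrict_space)

lemma (in growth) avg_supporting_line:
  fixes S :: "(real ^ 'n) set"
  assumes S: "S \<in> lmeasurable" "0 < measure lebesgue S" and f: "integrable (lebesgue_on S) f" "\<And>x. x \<in> S \<Longrightarrow> 0 \<le> f x"
    and \<psi>f: "integrable (lebesgue_on S) (\<lambda>x. \<psi> (f x))" and m: "0 < m"
  shows "\<psi> (m / 2) * (2 * avg S f / m - 1) \<le> L * avg S (\<lambda>x. \<psi> (f x))"
proof -
  have "avg S (\<lambda>x. (\<psi> (m / 2) * 2 / m) * f x - \<psi> (m / 2)) \<le> avg S (\<lambda>x. L * \<psi> (f x) - 0)"
    using f \<psi>f integrable_const_lmeasurable[OF S(1)] supporting_line[OF f(2) m]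
    by (intro avg_mono) (auto simp: algebra_simps)
  then show ?thesis unfolding avg_affine[OF S f(1)] avg_affine[OF S \<psi>f] by (simp add: algebra_simps)
qed

text \<open>With \<open>m\<close> the mean of \<open>f\<close>, the average of
  \<open>2 * f x / m - 1\<close> is 1, so integrating \<open>root_supporting_line\<close> bounds
  \<psi> at \<open>m / 2\<close>, and (aDec) doubles the argument. The exponent \<open>1 / p\<close>
  on the right is what later makes the energy estimate a reverse Hoelder inequality.\<close>

lemma (in growth) root_jensen:
  fixes S :: "(real ^ 'n) set"
  assumes S: "S \<in> lmeasurable" "0 < measure lebesgue S" and f: "integrable (lebesgue_on S) f" "\<And>x. x \<in> S \<Longrightarrow> 0 \<le> f x"
    and \<psi>f: "integrable (lebesgue_on S) (\<lambda>x. \<psi> (f x) powr (1 / p))"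
  shows "\<psi> (avg S f) \<le> L * 2 powr q * L powr p * avg S (\<lambda>x. \<psi> (f x) powr (1 / p)) powr p"
proof (cases "avg S f = 0")
  case True then show ?thesis using L1 by (simp add: at_0)
next
  case False
  define m where "m = avg S f"
  have m: "0 < m" using avg_nonneg[of S f] f(2) False by (simp add: m_def less_le)
  have "avg S (\<lambda>x. (\<psi> (m / 2) powr (1 / p) * 2 / m) * f x - \<psi> (m / 2) powr (1 / p)) \<le> avg S (\<lambda>x. L * \<psi> (f x) powr (1 / p) - 0)"
    using f \<psi>f integrable_const_lmeasurable[OF S(1)] root_supporting_line[OF f(2) m]
    by (intro avg_mono) (auto simp: algebra_simps)
  then have "\<psi> (m / 2) powr (1 / p) * 2 / m * m - \<psi> (m / 2) powr (1 / p) \<le> L * avg S (\<lambda>x. \<psi> (f x) powr (1 / p)) - 0"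
    by (simp only: avg_affine[OF S f(1)] avg_affine[OF S \<psi>f] m_def)
  then have "\<psi> (m / 2) powr (1 / p) \<le> L * avg S (\<lambda>x. \<psi> (f x) powr (1 / p))"
    using m by simp
  then have "(\<psi> (m / 2) powr (1 / p)) powr p \<le> (L * avg S (\<lambda>x. \<psi> (f x) powr (1 / p))) powr p"
    using p1 by (intro powr_mono2) auto
  also have "(\<psi> (m / 2) powr (1 / p)) powr p = \<psi> (m / 2)"
    using p1 nonneg[of "m / 2"] m by (simp add: powr_powr)
  also have "(L * avg S (\<lambda>x. \<psi> (f x) powr (1 / p))) powr p = L powr p * avg S (\<lambda>x. \<psi> (f x) powr (1 / p)) powr p"
    by (rule powr_mult)
  finally have A: "\<psi> (m / 2) \<le> L powr p * avg S (\<lambda>x. \<psi> (f x) powr (1 / p)) powr p" .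
  have "\<psi> m \<le> L * 2 powr q * \<psi> (m / 2)" using scale_up[of 2 "m / 2"] m by simp
  also have "\<dots> \<le> L * 2 powr q * (L powr p * avg S (\<lambda>x. \<psi> (f x) powr (1 / p)) powr p)"
    using A L1 by (intro mult_left_mono) auto
  finally show ?thesis by (simp add: m_def mult_ac)
qed

text \<open>The volume of a ball of radius \<open>l\<close> over the normalisation of the kernel
  average at radius \<open>l / 2\<close>; it appears when the integral in \<open>kavg_dyadic\<close>
  is rewritten as an average.\<close>

definition poincare_const :: "'n::finite itself \<Rightarrow> real" where
  "poincare_const _ = 2 ^ CARD('n) * ubv TYPE('n) / kmass TYPE('n)"

lemma poincare_const_pos: "0 < poincare_const TYPE('n::finite)"
  using ubv_pos[where 'n = 'n] kmass_pos[where 'n = 'n] by (simp add: poincare_const_def)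

lemma kavg_dyadic_avg:
  fixes x :: "real ^ 'n"
  assumes "weak_gradient u Du \<Omega>" "\<Omega> \<in> sets lebesgue" "0 < l" "cball x l \<subseteq> \<Omega>" "continuous_on (cball x l) u"
  shows "\<bar>kavg u x l - kavg u x (l / 2)\<bar> \<le> poincare_const TYPE('n) * (l / 2) * avg (cball x l) (\<lambda>y. norm (Du y))"
proof -
  have mV: "measure lebesgue (cball x l) = ubv TYPE('n) * l ^ CARD('n)"
    using measure_lebesgue_cball[of l x] assms by simp
  have "l / 2 / (l / 2) ^ CARD('n) / kmass TYPE('n) * I = poincare_const TYPE('n) * (l / 2) * (I / (ubv TYPE('n) * l ^ CARD('n)))" for I
    using assms ubv_pos[where 'n = 'n, THEN less_imp_neq] by (simp add: poincare_const_def power_divide ac_simps)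
  from this[of "lint (cball x l) (\<lambda>y. norm (Du y))"] show ?thesis
    using kavg_dyadic[OF assms] unfolding avg_def mV by simp
qed

lemma kavg_telescope:
  fixes x :: "real ^ 'n"
  assumes "weak_gradient u Du \<Omega>" "\<Omega> \<in> sets lebesgue" "0 < l" "cball x l \<subseteq> \<Omega>" "continuous_on (cball x l) u"
  shows "\<bar>kavg u x l - kavg u x (l / 2 ^ J)\<bar> \<le> poincare_const TYPE('n) * l * (\<Sum>j<J. avg (cball x (l / 2 ^ j)) (\<lambda>y. norm (Du y)) / 2 ^ Suc j)"
proof (induction J)
  case (Suc J)
  have sub: "cball x (l / 2 ^ J) \<subseteq> cball x l"
    using assms(3) by (simp add: cball_subset_cball_iff pos_divide_le_eq)
  have "\<bar>kavg u x (l / 2 ^ J) - kavg u x (l / 2 ^ J / 2)\<bar> \<le> poincare_const TYPE('n) * (l / 2 ^ J / 2) * avg (cball x (l / 2 ^ J)) (\<lambda>y. norm (Du y))"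
    using assms sub by (intro kavg_dyadic_avg[of u Du \<Omega>]) (auto intro: continuous_on_subset)
  then have "\<bar>kavg u x (l / 2 ^ J) - kavg u x (l / 2 ^ Suc J)\<bar> \<le> poincare_const TYPE('n) * l * (avg (cball x (l / 2 ^ J)) (\<lambda>y. norm (Du y)) / 2 ^ Suc J)"
    by (simp add: field_simps)
  with Suc show ?case by (simp add: distrib_left)
qed simp

text \<open>The weights add up to less than 1 for every \<open>J\<close>, so sums over dyadic scales
  are bounded independently of the depth at which the telescoping stops.\<close>

lemma geometric_weights: "(\<Sum>j<J. 1 / 2 ^ Suc j :: real) = 1 - 1 / 2 ^ J"
  by (induction J) auto

text \<open>\<open>G x\<close> is the sum of the averages of \<open>\<psi> (norm (Du y))\<close>
  over the balls \<open>cball x (l / 2 ^ j)\<close> with weights \<open>1 / 2 ^ Suc j\<close>; its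
  integral is controlled scale by scale with \<open>avg_ball_Fubini\<close>. The number of scales
  depends on \<open>u\<close>, but no bound does. The summand 1 next to \<open>G x\<close> pays for
  the error at the finest scale.\<close>

lemma modular_poincare:
  fixes c :: "real ^ 'n"
  assumes gr: "growth p q L \<psi>"
    and wg: "weak_gradient u Du \<Omega>" and \<Omega>: "\<Omega> \<in> sets lebesgue" and sub: "cball c t \<subseteq> \<Omega>" and cu: "continuous_on (cball c t) u"
    and l: "0 < l" "t' + l \<le> t" and I: "integrable (lebesgue_on (cball c t)) (\<lambda>x. \<psi> (norm (Du x)))"
  obtains G where "integrable (lebesgue_on (cball c t')) G" 
    "lint (cball c t') G \<le> lint (cball c t) (\<lambda>x. \<psi> (norm (Du x)))"
    "\<And>x. x \<in> cball c t' \<Longrightarrow> 0 \<le> G x"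
    "\<And>x. x \<in> cball c t' \<Longrightarrow> \<psi> (\<bar>u x - kavg u x l\<bar> / l) \<le> L ^ 3 * 2 powr q * max 1 (2 * poincare_const TYPE('n)) powr q * (1 + G x)"
proof -
  interpret growth p q L \<psi> by (rule gr)
  define \<Lambda> where "\<Lambda> = poincare_const TYPE('n)"
  have \<Lambda>: "0 < \<Lambda>" unfolding \<Lambda>_def by (rule poincare_const_pos)
  \<comment> \<open>Uniform continuity supplies one finest scale at which the kernel average differs
    from \<open>u\<close> by at most \<open>l\<close> at every point, so finitely many scales are
    enough.\<close>
  have "uniformly_continuous_on (cball c t) u" by (intro compact_uniformly_continuous cu) simp
  then obtain \<delta> where \<delta>: "0 < \<delta>" "\<And>x y. x \<in> cball c t \<Longrightarrow> y \<in> cball c t \<Longrightarrow> dist y x < \<delta> \<Longrightarrow> dist (u y) (u x) < l"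
    unfolding uniformly_continuous_on_def using l by metis
  obtain J where J: "l / 2 ^ J < \<delta>"
  proof -
    obtain J where "(1/2 :: real) ^ J < \<delta> / l" using real_arch_pow_inv[of "\<delta> / l" "1/2"] \<delta> l by auto
    then show thesis using l by (intro that[of J]) (simp add: power_divide field_simps)
  qed
  define f where "f = (\<lambda>x. \<psi> (norm (Du x)))"
  define A where "A = (\<lambda>j x. avg (cball x (l / 2 ^ j)) (\<lambda>y. norm (Du y)))"
  define P where "P = (\<lambda>j x. avg (cball x (l / 2 ^ j)) f)"
  define G where "G = (\<lambda>x. \<Sum>j<J. P j x / 2 ^ Suc j)"
  have lj: "0 < l / 2 ^ j" "l / 2 ^ j \<le> l" for j using l by (auto simp: pos_divide_le_eq)
  have f0: "0 \<le> f x" for x by (simp add: f_def nonneg)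
  have A0: "0 \<le> A j x" for j x by (simp add: A_def avg_nonneg)
  have P0: "0 \<le> P j x" for j x by (simp add: P_def avg_nonneg f0)
  have If: "integrable (lebesgue_on (cball c t)) f" using I by (simp add: f_def)
  have lt: "t' + l / 2 ^ j \<le> t" for j using lj[of j] l by linarith
  note F = avg_ball_Fubini[OF If f0 lj(1) lt]
  have IG: "integrable (lebesgue_on (cball c t')) G" 
    unfolding G_def P_def by (intro Bochner_Integration.integrable_sum integrable_divide_zero F)
  have "lint (cball c t') G = (\<Sum>j<J. lint (cball c t') (P j) / 2 ^ Suc j)"
    unfolding G_def P_def using F by (subst Bochner_Integration.integral_sum) auto
  also have "\<dots> \<le> (\<Sum>j<J. lint (cball c t) f / 2 ^ Suc j)"
    unfolding P_def using F by (intro sum_mono divide_right_mono) auto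
  also have "\<dots> = lint (cball c t) f * (\<Sum>j<J. 1 / 2 ^ Suc j)"
    by (simp add: sum_distrib_left)
  also have "\<dots> \<le> lint (cball c t) f"
    unfolding geometric_weights using f0 by (intro mult_right_le_one_le integral_nonneg_AE AE_I2) auto
  finally have G_le: "lint (cball c t') G \<le> lint (cball c t) f" .
  have G0: "0 \<le> G x" for x unfolding G_def by (intro sum_nonneg) (simp add: P0)
  have main: "\<psi> (\<bar>u x - kavg u x l\<bar> / l) \<le> L ^ 3 * 2 powr q * max 1 (2 * \<Lambda>) powr q * (1 + G x)" if x: "x \<in> cball c t'" for x
  proof -
    define m where "m = (\<Sum>j<J. A j x / 2 ^ Suc j)"
    have m0: "0 \<le> m" unfolding m_def by (intro sum_nonneg) (simp add: A0)
    have sb: "cball x (l / 2 ^ j) \<subseteq> cball c t" for j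
      using x lt[of j] by (simp add: cball_subset_cball_iff dist_commute)
    from sb[of 0] have sb0: "cball x l \<subseteq> cball c t" by simp
    have x_in: "x \<in> cball c t" using x l by auto
    have 1: "\<bar>kavg u x l - kavg u x (l / 2 ^ J)\<bar> \<le> \<Lambda> * l * m"
      unfolding m_def A_def \<Lambda>_def using sb0 sub
      by (intro kavg_telescope[OF wg \<Omega> l(1)] continuous_on_subset[OF cu sb0]) auto
    have 2: "\<bar>kavg u x (l / 2 ^ J) - u x\<bar> \<le> l"
    proof (rule kavg_close[OF lj(1) continuous_on_subset[OF cu sb]])
      fix y assume y: "y \<in> cball x (l / 2 ^ J)"
      then have "y \<in> cball c t" "dist y x < \<delta>" using sb[of J] J by (auto simp: dist_commute)
      then show "\<bar>u y - u x\<bar> \<le> l" using \<delta>(2)[OF x_in] by (auto simp: dist_real_def dest: less_imp_le)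
    qed
    have "\<bar>u x - kavg u x l\<bar> \<le> l * (1 + \<Lambda> * m)" using 1 2 by (simp add: algebra_simps)
    then have "\<bar>u x - kavg u x l\<bar> / l \<le> 1 + \<Lambda> * m" using l by (simp add: pos_divide_le_eq mult.commute)
    then have "\<psi> (\<bar>u x - kavg u x l\<bar> / l) \<le> \<psi> (1 + \<Lambda> * m)" using l by (intro mono) auto
    also have "\<dots> \<le> L * 2 powr q * (\<psi> 1 + \<psi> (\<Lambda> * m))" using m0 \<Lambda> by (intro subadditive) auto
    also have "\<dots> \<le> L * 2 powr q * (L * L * max 1 (2 * \<Lambda>) powr q * 1 + L * max 1 (2 * \<Lambda>) powr q * (L * G x))"
    proof (intro mult_left_mono add_mono)
      have "1 * 1 \<le> L * max 1 (2 * \<Lambda>) powr q" using L1 p1 pq by (intro mult_mono ge_one_powr_ge_zero) auto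
      then have "L * 1 \<le> L * (L * max 1 (2 * \<Lambda>) powr q)" using L1 by (intro mult_left_mono) auto
      then show "\<psi> 1 \<le> L * L * max 1 (2 * \<Lambda>) powr q * 1" using at_1 by (simp add: mult_ac)
      \<comment> \<open>The argument is read as \<open>2 * \<Lambda>\<close> times
        \<open>m / 2\<close> because the supporting line controls \<psi> at half the mean.\<close>
      have "\<psi> (\<Lambda> * m) \<le> L * max 1 (2 * \<Lambda>) powr q * \<psi> (m / 2)"
        using scale_max[of "2 * \<Lambda>" "m / 2"] m0 \<Lambda> by simp
      also have "\<dots> \<le> L * max 1 (2 * \<Lambda>) powr q * (L * G x)"
      proof (intro mult_left_mono)
        show "\<psi> (m / 2) \<le> L * G x"
        proof (cases "m = 0")
          case True then show ?thesis using L1 G0 by (simp add: at_0)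
        next
          case False
          with m0 have m: "0 < m" by simp
          have "\<psi> (m / 2) * (2 * A j x / m - 1) \<le> L * P j x" for j
            unfolding A_def P_def f_def
          proof (rule avg_supporting_line)
            show "0 < measure lebesgue (cball x (l / 2 ^ j))" using lj(1)[of j] by (simp add: content_cball_pos)
            have "integrable (lebesgue_on (cball c t)) Du" using wg sub unfolding weak_gradient_def by auto
            then show "integrable (lebesgue_on (cball x (l / 2 ^ j))) (\<lambda>x. norm (Du x))"
              using integrable_on_subset_lebesgue[OF _ sb] by auto
            show "integrable (lebesgue_on (cball x (l / 2 ^ j))) (\<lambda>x. \<psi> (norm (Du x)))"
              using integrable_on_subset_lebesgue[OF I sb] by auto
          qed (use m in auto)
          \<comment> \<open>The weighted sum of the \<open>A j x\<close> is \<open>m\<close>, so the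
            left side is \<open>\<psi> (m / 2) * (2 - (1 - 1 / 2 ^ J))\<close>. The amount by which
            the weights fall short of 1 has the favourable sign.\<close>
          then have "(\<Sum>j<J. \<psi> (m / 2) * (2 * A j x / m - 1) / 2 ^ Suc j) \<le> (\<Sum>j<J. L * P j x / 2 ^ Suc j)"
            by (intro sum_mono divide_right_mono) auto
          also have "\<dots> = L * G x" by (simp add: G_def sum_distrib_left)
          also have "(\<Sum>j<J. \<psi> (m / 2) * (2 * A j x / m - 1) / 2 ^ Suc j) 
            = (\<Sum>j<J. \<psi> (m / 2) * 2 / m * (A j x / 2 ^ Suc j) - \<psi> (m / 2) * (1 / 2 ^ Suc j))"
            by (intro sum.cong) (auto simp: diff_divide_distrib right_diff_distrib)
          also have "\<dots> = \<psi> (m / 2) * 2 / m * m - \<psi> (m / 2) * (1 - 1 / 2 ^ J)"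
            unfolding sum_subtractf sum_distrib_left[symmetric] m_def[symmetric] geometric_weights ..
          also have "\<dots> = \<psi> (m / 2) + \<psi> (m / 2) / 2 ^ J" using m by (simp add: algebra_simps)
          finally show ?thesis using nonneg[of "m / 2"] m by (smt (verit) divide_nonneg_nonneg zero_le_power)
        qed
      qed (use L1 in auto)
      finally show "\<psi> (\<Lambda> * m) \<le> L * max 1 (2 * \<Lambda>) powr q * (L * G x)" .
    qed (use L1 in auto)
    also have "\<dots> = L ^ 3 * 2 powr q * max 1 (2 * \<Lambda>) powr q * (1 + G x)"
      by (simp add: algebra_simps power3_eq_cube)
    finally show ?thesis .
  qed
  show thesis
    by (rule that[OF IG]) (use G_le G0 main in \<open>auto simp: f_def \<Lambda>_def\<close>)
qed

subsection \<open>Generalized Phi-functions\<close>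

lemma growth_phi:
  assumes "Phi_w \<Omega> \<phi>" "A0 \<Omega> \<phi> L" "aInc \<Omega> \<phi> p L" "aDec \<Omega> \<phi> q L" "1 \<le> p" "p \<le> q" "1 \<le> L" "x \<in> \<Omega>"
  shows "growth p q L (\<phi> x)"
  using assms unfolding growth_def Phi_w_def A0_def aInc_def aDec_def mono_on_def by auto

lemma phi_minus_le:
  assumes "Phi_w \<Omega> \<phi>" "x \<in> B" "x \<in> \<Omega>" "0 \<le> t"
  shows "phi_minus \<Omega> \<phi> B t \<le> \<phi> x t"
  unfolding phi_minus_def
  by (rule cInf_lower) (use assms in \<open>auto simp: Phi_w_def intro!: bdd_belowI2[of _ 0]\<close>)

lemma phi_minus_greatest:
  assumes "B \<inter> \<Omega> \<noteq> {}" "\<And>x. x \<in> B \<Longrightarrow> x \<in> \<Omega> \<Longrightarrow> k \<le> \<phi> x t"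
  shows "k \<le> phi_minus \<Omega> \<phi> B t"
  unfolding phi_minus_def by (rule cInf_greatest) (use assms in auto)

text \<open>The constants survive the infimum: the side to be bounded is first estimated by its
  value at a point \<open>x\<close>, where the condition for \<open>\<phi> x\<close> applies, and
  only then the infimum over \<open>x\<close> is taken on the other side.\<close>

lemma growth_phi_minus:
  assumes a: "Phi_w \<Omega> \<phi>" "A0 \<Omega> \<phi> L" "aInc \<Omega> \<phi> p L" "aDec \<Omega> \<phi> q L" "1 \<le> p" "p \<le> q" "1 \<le> L" 
    and ne: "B \<inter> \<Omega> \<noteq> {}"
  shows "growth p q L (phi_minus \<Omega> \<phi> B)"
proof
  obtain z where z: "z \<in> B" "z \<in> \<Omega>" using ne by auto
  interpret z: growth p q L "\<phi> z" by (rule growth_phi[OF a z(2)])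
  note g = growth_phi[OF a]
  have nn: "0 \<le> phi_minus \<Omega> \<phi> B t" if "0 \<le> t" for t
    by (rule phi_minus_greatest[OF ne]) (use growth.nonneg[OF g] that in auto)
  show "phi_minus \<Omega> \<phi> B 0 = 0"
    using phi_minus_le[OF a(1) z, of 0] nn[of 0] z.at_0 by simp
  show "phi_minus \<Omega> \<phi> B s \<le> phi_minus \<Omega> \<phi> B t" if "0 \<le> s" "s \<le> t" for s t
    using that by (intro phi_minus_greatest[OF ne] order_trans[OF phi_minus_le[OF a(1)] growth.mono[OF g]]) auto
  show "phi_minus \<Omega> \<phi> B 1 \<le> L" using phi_minus_le[OF a(1) z, of 1] z.at_1 by simp
  show "phi_minus \<Omega> \<phi> B s / s powr p \<le> L * (phi_minus \<Omega> \<phi> B t / t powr p)" if st: "0 < s" "s \<le> t" for s t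
  proof -
    have "phi_minus \<Omega> \<phi> B s / s powr p / L * t powr p \<le> phi_minus \<Omega> \<phi> B t"
    proof (rule phi_minus_greatest[OF ne])
      fix x assume x: "x \<in> B" "x \<in> \<Omega>"
      have "phi_minus \<Omega> \<phi> B s / s powr p \<le> \<phi> x s / s powr p"
        using phi_minus_le[OF a(1) x, of s] st by (intro divide_right_mono) auto
      also have "\<dots> \<le> L * (\<phi> x t / t powr p)" by (rule growth.inc[OF g[OF x(2)] st])
      finally show "phi_minus \<Omega> \<phi> B s / s powr p / L * t powr p \<le> \<phi> x t"
        using st \<open>1 \<le> L\<close> by (simp add: field_simps)
    qed
    then show ?thesis using st \<open>1 \<le> L\<close> by (simp add: field_simps)
  qed
  show "phi_minus \<Omega> \<phi> B t / t powr q \<le> L * (phi_minus \<Omega> \<phi> B s / s powr q)" if st: "0 < s" "s \<le> t" for s t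
  proof -
    have "phi_minus \<Omega> \<phi> B t / t powr q / L * s powr q \<le> phi_minus \<Omega> \<phi> B s"
    proof (rule phi_minus_greatest[OF ne])
      fix x assume x: "x \<in> B" "x \<in> \<Omega>"
      have "phi_minus \<Omega> \<phi> B t / t powr q \<le> \<phi> x t / t powr q"
        using phi_minus_le[OF a(1) x, of t] st by (intro divide_right_mono) auto
      also have "\<dots> \<le> L * (\<phi> x s / s powr q)" by (rule growth.dec[OF g[OF x(2)] st])
      finally show "phi_minus \<Omega> \<phi> B t / t powr q / L * s powr q \<le> \<phi> x s"
        using st \<open>1 \<le> L\<close> by (simp add: field_simps)
    qed
    then show ?thesis using st \<open>1 \<le> L\<close> by (simp add: field_simps)
  qed
qed (use a in auto)

section \<open>Comparing \<phi> at a point with its infimum over a ball\<close>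

definition A1_const :: "real \<Rightarrow> real \<Rightarrow> real \<Rightarrow> real \<Rightarrow> 'n::finite itself \<Rightarrow> real" where
  "A1_const q L Lw M T = L\<^sup>2 * max 1 (M / min 1 (1 / ubv TYPE('n))) powr q * (1 + Lw)"

lemma A1_const_ge_0: "0 < Lw \<Longrightarrow> 0 \<le> A1_const q L Lw M TYPE('n::finite)"
  by (simp add: A1_const_def)

text \<open>The argument \<open>w\<close> has the right power of \<open>R\<close> but an arbitrary
  factor \<open>M\<close>. For small balls, division by \<open>N\<close> brings it below the
  threshold of (A1), and (aDec) restores it at the cost of \<open>N powr q\<close>. Since (A1) holds
  against every \<open>z\<close> in the ball, the infimum over \<open>z\<close> can be taken
  afterwards.\<close>

lemma A1_comparison:
  fixes \<phi> :: "'n::finite phi_fun" and y :: "real ^ 'n"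
  assumes a: "Phi_w \<Omega> \<phi>" "A0 \<Omega> \<phi> L" "aInc \<Omega> \<phi> p L" "aDec \<Omega> \<phi> q L" "1 \<le> p" "p \<le> q" "1 \<le> L"
    and \<gamma>: "0 < \<gamma>" "\<gamma> < 1" and A1: "A1 \<Omega> \<phi> (real CARD('n) / (1 - \<gamma>)) Lw" and Lw: "0 < Lw"
    and R: "0 < R" "ball y R \<subseteq> \<Omega>" and x: "x \<in> ball y R" and w: "0 \<le> w" "w \<le> M * R powr (\<gamma> - 1)" and M: "0 \<le> M"
  shows "\<phi> x w \<le> A1_const q L Lw M TYPE('n) * (phi_minus \<Omega> \<phi> (ball y R) w + 1)"
proof -
  define V where "V = ubv TYPE('n)"
  have V: "0 < V" unfolding V_def by (rule ubv_pos)
  define v where "v = min 1 (1 / V)"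
  have v: "0 < v" "v \<le> 1" using V by (auto simp: v_def)
  define N where "N = max 1 (M / v)"
  have N: "1 \<le> N" "M \<le> N * v" using v by (auto simp: N_def max_def field_simps)
  have MN: "M \<le> N" using N v mult_left_le[of v N] by linarith
  have xO: "x \<in> \<Omega>" using x R by auto
  interpret x: growth p q L "\<phi> x" by (rule growth_phi[OF a xO])
  have ne: "ball y R \<inter> \<Omega> \<noteq> {}" using x xO by auto
  interpret m: growth p q L "phi_minus \<Omega> \<phi> (ball y R)" by (rule growth_phi_minus[OF a ne])
  have "\<phi> x w \<le> L\<^sup>2 * N powr q * (1 + Lw) * (phi_minus \<Omega> \<phi> (ball y R) w + 1)"
  proof (cases "R \<le> 1")
    case True
    define t where "t = w / N"
    define e where "e = real CARD('n) / (1 - \<gamma>)"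
    have e: "0 < e" using \<gamma> by (simp add: e_def)
    have t0: "0 \<le> t" using w N by (simp add: t_def)
    have "t \<le> v * R powr (\<gamma> - 1)"
    proof -
      have "w \<le> N * v * R powr (\<gamma> - 1)" using w(2) N(2) by (meson mult_right_mono order_trans powr_ge_zero)
      then show ?thesis using N by (simp add: t_def field_simps)
    qed
    then have "t powr e \<le> (v * R powr (\<gamma> - 1)) powr e" using e t0 by (intro powr_mono2) auto
    also have "\<dots> = v powr e * (1 / R ^ CARD('n))"
    proof -
      have "(\<gamma> - 1) * e = - real CARD('n)" using \<gamma> by (simp add: e_def field_simps)
      then have "(R powr (\<gamma> - 1)) powr e = 1 / R ^ CARD('n)"
        using R by (simp add: powr_powr powr_minus powr_realpow inverse_eq_divide)
      then show ?thesis by (simp add: powr_mult)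
    qed
    \<comment> \<open>As \<open>e\<close> is at least 1 and \<open>v\<close> at most 1,
      \<open>v powr e \<le> v\<close>. This removes \<gamma> from the constant.\<close>
    also have "v powr e \<le> 1 / V"
    proof -
      have n1: "1 \<le> real CARD('n)" using one_le_card_finite[where 'a = 'n] by simp
      have "1 - \<gamma> \<le> 1" using \<gamma> by simp
      then have "1 - \<gamma> \<le> real CARD('n)" using n1 by (rule order_trans)
      then have "1 \<le> e" using \<gamma> by (simp add: e_def)
      then have "v powr e \<le> v powr 1" using v by (intro powr_mono') auto
      then show ?thesis using v by (simp add: v_def)
    qed
    finally have "t powr e \<le> 1 / V * (1 / R ^ CARD('n))" using R by (simp add: divide_right_mono)
    then have te: "t powr (real CARD('n) / (1 - \<gamma>)) \<le> 1 / measure lebesgue (ball y R)"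
      using measure_lebesgue_ball[of R y] R by (simp add: e_def V_def)
    have cmp: "\<phi> x t \<le> (1 + Lw) * \<phi> z t + Lw" if z: "z \<in> ball y R" for z
    proof -
      have "\<bar>\<phi> x t - \<phi> z t\<bar> \<le> Lw * (\<phi> z t + 1)"
        using A1 True R x z xO t0 te unfolding A1_def by auto
      then have "\<phi> x t - \<phi> z t \<le> Lw * (\<phi> z t + 1)" by linarith
      then show ?thesis by (simp add: algebra_simps)
    qed
    have "(\<phi> x t - Lw) / (1 + Lw) \<le> phi_minus \<Omega> \<phi> (ball y R) t"
      by (rule phi_minus_greatest[OF ne]) (use cmp Lw in \<open>auto simp: pos_divide_le_eq algebra_simps\<close>)
    then have "\<phi> x t \<le> (1 + Lw) * phi_minus \<Omega> \<phi> (ball y R) t + Lw"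
      using Lw by (simp add: pos_divide_le_eq algebra_simps)
    also have "\<dots> \<le> (1 + Lw) * phi_minus \<Omega> \<phi> (ball y R) w + (1 + Lw)"
    proof -
      have "t \<le> w" using N w mult_right_mono[of 1 N w] by (simp add: t_def divide_le_eq mult.commute)
      then have "phi_minus \<Omega> \<phi> (ball y R) t \<le> phi_minus \<Omega> \<phi> (ball y R) w" using t0 by (intro m.mono)
      then show ?thesis using Lw by (intro add_mono mult_left_mono) auto
    qed
    finally have 1: "\<phi> x t \<le> (1 + Lw) * (phi_minus \<Omega> \<phi> (ball y R) w + 1)" by (simp add: algebra_simps)
    have "\<phi> x w \<le> L * N powr q * \<phi> x t" using x.scale_up[OF N(1) t0] N by (simp add: t_def)
    also have "\<dots> \<le> L\<^sup>2 * N powr q * ((1 + Lw) * (phi_minus \<Omega> \<phi> (ball y R) w + 1))"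
    proof (rule mult_mono[OF _ 1])
      have "L * 1 \<le> L * L" using x.L1 by (intro mult_left_mono) auto
      then show "L * N powr q \<le> L\<^sup>2 * N powr q" by (intro mult_right_mono) (auto simp: power2_eq_square)
    qed (use x.nonneg[OF t0] in auto)
    finally show ?thesis by (simp add: mult_ac)
  next
    case False
    have "R powr (\<gamma> - 1) \<le> 1" using False \<gamma> powr_mono[of "\<gamma> - 1" 0 R] by simp
    then have "M * R powr (\<gamma> - 1) \<le> M * 1" using M by (intro mult_left_mono) auto
    then have wN: "w \<le> N" using w MN by linarith
    have "\<phi> x w \<le> L\<^sup>2 * max 1 w powr q" by (rule x.upper[OF w(1)])
    also have "\<dots> \<le> L\<^sup>2 * N powr q" using wN N x.p1 x.pq by (intro mult_left_mono powr_mono2) auto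
    also have "\<dots> = L\<^sup>2 * N powr q * (1 * 1)" by simp
    also have "\<dots> \<le> L\<^sup>2 * N powr q * ((1 + Lw) * (phi_minus \<Omega> \<phi> (ball y R) w + 1))"
      using Lw m.nonneg[OF w(1)] by (intro mult_left_mono mult_mono) auto
    finally show ?thesis by (simp add: mult_ac)
  qed
  then show ?thesis by (simp add: A1_const_def N_def v_def V_def)
qed

section \<open>Measurability and modulars\<close>

lemma phi_measurable:
  assumes "Phi_w \<Omega> \<phi>" "f \<in> borel_measurable (lebesgue_on S)" "S \<subseteq> \<Omega>" "S \<in> sets lebesgue" "\<Omega> \<in> sets lebesgue"
  shows "(\<lambda>x. \<phi> x \<bar>f x\<bar>) \<in> borel_measurable (lebesgue_on S)"
proof -
  have "(\<lambda>x. if x \<in> S then f x else 0) \<in> borel_measurable (lebesgue_on \<Omega>)"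
    using assms borel_measurable_if_lebesgue_on[of S \<Omega> f] by auto
  then have "(\<lambda>x. \<phi> x \<bar>if x \<in> S then f x else 0\<bar>) \<in> borel_measurable (lebesgue_on \<Omega>)"
    using assms(1) unfolding Phi_w_def by blast
  then have "(\<lambda>x. \<phi> x \<bar>if x \<in> S then f x else 0\<bar>) \<in> borel_measurable (lebesgue_on S)"
    using assms(3) by (rule measurable_restrict_mono)
  then show ?thesis by (rule measurable_cong[THEN iffD1, rotated]) simp
qed

lemma in_Lphi_if_modular_finite:
  assumes a: "Phi_w \<Omega> \<phi>" "A0 \<Omega> \<phi> L" "aInc \<Omega> \<phi> p L" "aDec \<Omega> \<phi> q L" "1 \<le> p" "p \<le> q" "1 \<le> L"
    and f: "f \<in> borel_measurable (lebesgue_on S)" and S: "S \<subseteq> \<Omega>" "S \<in> sets lebesgue"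
    and fin: "integrable (lebesgue_on S) (\<lambda>x. \<phi> x \<bar>f x\<bar>)"
  shows "in_Lphi \<phi> S f"
proof -
  define I where "I = lint S (\<lambda>x. \<phi> x \<bar>f x\<bar>)"
  have nn: "0 \<le> \<phi> x \<bar>f x\<bar>" if "x \<in> S" for x using growth.nonneg[OF growth_phi[OF a]] that S by auto
  have I0: "0 \<le> I" unfolding I_def using nn by (intro integral_nonneg_AE AE_I2) auto
  \<comment> \<open>By \<open>scale_down1\<close> the modular of \<open>f / lam\<close> is at most
    \<open>L * I / lam\<close>, which this choice keeps below 1.\<close>
  define lam where "lam = L * I + 1"
  have lam: "1 \<le> lam" using I0 a by (simp add: lam_def)
  have "(\<integral>\<^sup>+x\<in>S. ennreal (\<phi> x (\<bar>f x\<bar> / lam)) \<partial>lebesgue) \<le> (\<integral>\<^sup>+x\<in>S. ennreal (L / lam * \<phi> x \<bar>f x\<bar>) \<partial>lebesgue)"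
  proof (intro nn_integral_mono)
    fix x
    show "ennreal (\<phi> x (\<bar>f x\<bar> / lam)) * indicator S x \<le> ennreal (L / lam * \<phi> x \<bar>f x\<bar>) * indicator S x"
    proof (cases "x \<in> S")
      case True
      then have "\<phi> x (1 / lam * \<bar>f x\<bar>) \<le> L * (1 / lam) * \<phi> x \<bar>f x\<bar>"
        using lam S by (intro growth.scale_down1[OF growth_phi[OF a]]) auto
      then show ?thesis by (intro mult_right_mono ennreal_leI) auto
    qed simp
  qed
  also have "\<dots> = ennreal (lint S (\<lambda>x. L / lam * \<phi> x \<bar>f x\<bar>))"
    using fin nn S lam a by (intro nn_set_integral_eq_integral_on) auto
  also have "\<dots> = ennreal (L / lam * I)" by (simp add: I_def)
  also have "\<dots> \<le> 1" using lam I0 by (simp add: lam_def)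
  finally show ?thesis unfolding in_Lphi_def using f lam by (intro conjI exI[of _ lam]) auto
qed

text \<open>The passage from a finite Luxemburg norm to a finite modular of \<open>f\<close> itself:
  (aDec) undoes the division by \<open>lam\<close>.\<close>

lemma integrable_modular:
  assumes a: "Phi_w \<Omega> \<phi>" "A0 \<Omega> \<phi> L" "aInc \<Omega> \<phi> p L" "aDec \<Omega> \<phi> q L" "1 \<le> p" "p \<le> q" "1 \<le> L"
    and S: "S \<subseteq> \<Omega>" "S \<in> sets lebesgue" and \<Omega>: "\<Omega> \<in> sets lebesgue" and f: "in_Lphi \<phi> S f"
  shows "integrable (lebesgue_on S) (\<lambda>x. \<phi> x \<bar>f x\<bar>)"
proof -
  obtain lam where lam: "0 < lam" "(\<integral>\<^sup>+x\<in>S. ennreal (\<phi> x (\<bar>f x\<bar> / lam)) \<partial>lebesgue) \<le> 1" and fm: "f \<in> borel_measurable (lebesgue_on S)"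
    using f unfolding in_Lphi_def by auto
  have gm: "(\<lambda>x. \<phi> x \<bar>f x\<bar>) \<in> borel_measurable (lebesgue_on S)"
    if "f \<in> borel_measurable (lebesgue_on S)" for f by (rule phi_measurable[OF a(1) that S \<Omega>])
  have nn: "0 \<le> \<phi> x \<bar>h\<bar>" if "x \<in> S" for x h using growth.nonneg[OF growth_phi[OF a]] that S by auto
  have "integrable (lebesgue_on S) (\<lambda>x. \<phi> x \<bar>f x / lam\<bar>)"
  proof (rule integrable_on_if_nn_set_integral[OF gm])
    show "0 \<le> \<phi> x \<bar>f x / lam\<bar>" if "x \<in> S" for x using nn[OF that] .
    show "(\<integral>\<^sup>+x\<in>S. ennreal (\<phi> x \<bar>f x / lam\<bar>) \<partial>lebesgue) < \<infinity>"
      using lam by (simp add: abs_divide) (meson ennreal_one_less_top order_le_less_trans)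
  qed (use fm nn S in auto)
  then have I: "integrable (lebesgue_on S) (\<lambda>x. L * max 1 lam powr q * \<phi> x \<bar>f x / lam\<bar>)" by simp
  show ?thesis
  proof (rule Bochner_Integration.integrable_bound[OF I gm[OF fm]], rule AE_I2)
    fix x assume "x \<in> space (lebesgue_on S)"
    then have x: "x \<in> S" by simp
    have "\<phi> x (lam * (\<bar>f x\<bar> / lam)) \<le> L * max 1 lam powr q * \<phi> x (\<bar>f x\<bar> / lam)"
      using lam x S by (intro growth.scale_max[OF growth_phi[OF a]]) auto
    then show "norm (\<phi> x \<bar>f x\<bar>) \<le> norm (L * max 1 lam powr q * \<phi> x \<bar>f x / lam\<bar>)"
      using lam nn[OF x, of "f x"] by (simp add: abs_divide)
  qed
qed

subsection \<open>Cutting off weakly differentiable functions\<close>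

lemma C1_zero_outside:
  fixes \<psi> :: "real ^ 'n \<Rightarrow> real"
  assumes d: "\<And>x. (\<psi> has_derivative (\<lambda>h. D x \<bullet> h)) (at x)" and S: "closed S" "\<And>x. x \<notin> S \<Longrightarrow> \<psi> x = 0" and x: "x \<notin> S"
  shows "D x = 0"
proof -
  have "((\<lambda>x. 0 :: real) has_derivative (\<lambda>h. D x \<bullet> h)) (at x)"
    by (rule has_derivative_transform_within_open[OF d, of "- S"]) (use S x in auto)
  from has_derivative_unique[OF this has_derivative_const] have "D x \<bullet> D x = 0" by metis
  then show ?thesis by simp
qed

text \<open>By translation invariance the integral of \<open>\<psi> (x + h *\<^sub>R e)\<close> does
  not depend on \<open>h\<close>; differentiating under the integral at \<open>h = 0\<close> gives
  the claim.\<close>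

lemma integral_partial_derivative_zero:
  fixes \<psi> :: "real ^ 'n \<Rightarrow> real"
  assumes d: "\<And>x. (\<psi> has_derivative (\<lambda>h. D x \<bullet> h)) (at x)" and cD: "continuous_on UNIV D"
    and S: "compact S" "\<And>x. x \<notin> S \<Longrightarrow> \<psi> x = 0"
  shows "lint S (\<lambda>x. D x $ i) = 0"
proof -
  define e where "e = (axis i 1 :: real ^ 'n)"
  have ne: "norm e = 1" by (simp add: e_def)
  have D0: "D x = 0" if "x \<notin> S" for x
    using C1_zero_outside[OF d compact_imp_closed[OF S(1)] S(2) that] .
  obtain b where b: "\<And>x. x \<in> S \<Longrightarrow> norm x \<le> b" using compact_imp_bounded[OF S(1)] by (auto simp: bounded_iff)
  \<comment> \<open>One unit of room around the ball containing \<open>S\<close>, so that the box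
    contains the support of every translate with \<open>\<bar>h\<bar> < 1\<close>.\<close>
  have "bounded (cball (0 :: real ^ 'n) (b + 1))" by simp
  from bounded_subset_cbox_symmetric[OF this]
  obtain lo where box: "cball 0 (b + 1) \<subseteq> cbox (- lo) (lo :: real ^ 'n)" by blast
  have SB: "S \<subseteq> cbox (- lo) lo" using b box by (force simp: subset_iff)
  have c\<psi>: "continuous_on UNIV \<psi>"
    using d by (meson differentiable_imp_continuous_on differentiable_on_def differentiable_at_withinI differentiableI)
  have Ss: "S \<in> sets lebesgue" using S(1) by (simp add: lmeasurable_compact fmeasurableD)
  define F where "F = (\<lambda>h. integral (cbox (- lo) lo) (\<lambda>x. \<psi> (x + h *\<^sub>R e)))"
  have Fc: "F h = integral\<^sup>L lborel \<psi>" if h: "h \<in> {-1<..<1}" for h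
  proof -
    have cs: "continuous_on UNIV (\<lambda>x. \<psi> (x + h *\<^sub>R e))"
      by (intro continuous_intros continuous_on_compose2[OF c\<psi>]) auto
    have "F h = lint (cbox (- lo) lo) (\<lambda>x. \<psi> (x + h *\<^sub>R e))"
      unfolding F_def using continuous_on_subset[OF cs]
      by (intro lebesgue_integral_eq_integral[symmetric] continuous_imp_integrable) auto
    also have "\<dots> = lint UNIV (\<lambda>x. \<psi> (x + h *\<^sub>R e))"
    proof (rule integral_on_zero_outside[symmetric])
      fix x assume x: "x \<notin> cbox (- lo) lo"
      show "\<psi> (x + h *\<^sub>R e) = 0"
      proof (rule S(2), rule notI)
        assume "x + h *\<^sub>R e \<in> S"
        then have "norm (x + h *\<^sub>R e) \<le> b" by (rule b)
        moreover have "norm x \<le> norm (x + h *\<^sub>R e) + norm (h *\<^sub>R e)"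
          using norm_triangle_ineq4[of "x + h *\<^sub>R e" "h *\<^sub>R e"] by simp
        moreover have "norm (h *\<^sub>R e) \<le> 1" using h ne by auto
        ultimately have "x \<in> cball 0 (b + 1)" by simp
        then show False using box x by auto
      qed
    qed auto
    also have "\<dots> = integral\<^sup>L lborel (\<lambda>x. \<psi> (x + h *\<^sub>R e))"
      using cs by (simp add: lebesgue_on_UNIV_eq integral_completion borel_measurable_continuous_onI)
    also have "\<dots> = integral\<^sup>L (distr lborel borel ((+) (h *\<^sub>R e))) \<psi>"
      using c\<psi> by (subst integral_distr) (auto simp: borel_measurable_continuous_onI add.commute)
    also have "\<dots> = integral\<^sup>L lborel \<psi>" by (simp add: lborel_distr_plus)
    finally show ?thesis .
  qed
  have "(F has_field_derivative integral (cbox (- lo) lo) (\<lambda>x. D (x + 0 *\<^sub>R e) \<bullet> e)) (at 0 within {-1<..<1})"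
    unfolding F_def
  proof (rule leibniz_rule_field_derivative)
    fix h :: real and x :: "real ^ 'n"
    have "((\<lambda>h. x + h *\<^sub>R e) has_derivative (\<lambda>k. k *\<^sub>R e)) (at h)"
      by (auto intro!: derivative_eq_intros)
    from has_derivative_compose[OF this d]
    have "((\<lambda>h. \<psi> (x + h *\<^sub>R e)) has_derivative (\<lambda>k. D (x + h *\<^sub>R e) \<bullet> (k *\<^sub>R e))) (at h)" .
    also have "(\<lambda>k. D (x + h *\<^sub>R e) \<bullet> (k *\<^sub>R e)) = (*) (D (x + h *\<^sub>R e) \<bullet> e)"
      by (auto simp: fun_eq_iff)
    finally have "((\<lambda>h. \<psi> (x + h *\<^sub>R e)) has_real_derivative D (x + h *\<^sub>R e) \<bullet> e) (at h)"
      unfolding has_field_derivative_def .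
    then show "((\<lambda>h. \<psi> (x + h *\<^sub>R e)) has_real_derivative D (x + h *\<^sub>R e) \<bullet> e) (at h within {-1<..<1})"
      by (rule has_field_derivative_at_within)
  next
    fix h :: real
    show "(\<lambda>x. \<psi> (x + h *\<^sub>R e)) integrable_on cbox (- lo) lo"
      by (intro integrable_continuous continuous_intros continuous_on_compose2[OF c\<psi>]) auto
  next
    show "continuous_on ({-1<..<1} \<times> cbox (- lo) lo) (\<lambda>(h, x). D (x + h *\<^sub>R e) \<bullet> e)"
      unfolding split_beta' by (intro continuous_intros continuous_on_compose2[OF cD]) auto
  qed auto
  then have "(F has_field_derivative integral (cbox (- lo) lo) (\<lambda>x. D x \<bullet> e)) (at 0)"
    by (simp add: at_within_open[of 0 "{-1<..<1}"])
  moreover have "(F has_field_derivative 0) (at 0)"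
    by (rule has_field_derivative_transform_within_open[of "\<lambda>_. integral\<^sup>L lborel \<psi>" 0 0 "{-1<..<1}"]) (auto simp: Fc)
  ultimately have "integral (cbox (- lo) lo) (\<lambda>x. D x \<bullet> e) = 0" by (rule DERIV_unique)
  moreover have "integral (cbox (- lo) lo) (\<lambda>x. D x \<bullet> e) = lint (cbox (- lo) lo) (\<lambda>x. D x \<bullet> e)"
    by (intro lebesgue_integral_eq_integral[symmetric] continuous_imp_integrable continuous_intros continuous_on_subset[OF cD]) auto
  moreover have "\<dots> = lint S (\<lambda>x. D x \<bullet> e)"
    using SB Ss D0 by (intro integral_on_zero_outside) auto
  ultimately show ?thesis by (simp add: e_def inner_axis)
qed

lemma weak_gradient_test:
  fixes \<psi> :: "real ^ 'n \<Rightarrow> real"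
  assumes wg: "weak_gradient u Du \<Omega>" and \<Omega>: "\<Omega> \<in> sets lebesgue"
    and d: "\<And>x. (\<psi> has_derivative (\<lambda>h. D x \<bullet> h)) (at x)" and cD: "continuous_on UNIV D"
    and S: "compact S" "\<And>x. x \<notin> S \<Longrightarrow> \<psi> x = 0" "S \<subseteq> \<Omega>"
  shows "lint S (\<lambda>x. u x * (D x $ i)) = - lint S (\<lambda>x. (Du x $ i) * \<psi> x)"
proof -
  have Ss: "S \<in> sets lebesgue" using S(1) by (simp add: lmeasurable_compact fmeasurableD)
  have D0: "D x = 0" if "x \<notin> S" for x
    using C1_zero_outside[OF d compact_imp_closed[OF S(1)] S(2) that] .
  have "{x. \<psi> x \<noteq> 0} \<subseteq> S" using S(2) by auto
  then have cl: "closure {x. \<psi> x \<noteq> 0} \<subseteq> S" using S(1) by (simp add: closure_minimal compact_imp_closed)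
  then have cp: "compact (closure {x. \<psi> x \<noteq> 0})"
    using bounded_subset[OF compact_imp_bounded[OF S(1)]] by (simp add: compact_eq_bounded_closed)
  have "integral\<^sup>L (lebesgue_on \<Omega>) (\<lambda>x. u x * (D x $ i)) = - integral\<^sup>L (lebesgue_on \<Omega>) (\<lambda>x. (Du x $ i) * \<psi> x)"
    using wg[unfolded weak_gradient_def, THEN conjunct2, rule_format, of \<psi> D] d cD cp cl S(3) by auto
  moreover have "integral\<^sup>L (lebesgue_on \<Omega>) (\<lambda>x. u x * (D x $ i)) = lint S (\<lambda>x. u x * (D x $ i))"
    by (rule integral_on_zero_outside) (use S Ss \<Omega> D0 in auto)
  moreover have "integral\<^sup>L (lebesgue_on \<Omega>) (\<lambda>x. (Du x $ i) * \<psi> x) = lint S (\<lambda>x. (Du x $ i) * \<psi> x)"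
    by (rule integral_on_zero_outside) (use S Ss \<Omega> in auto)
  ultimately show ?thesis by simp
qed

lemma integrable_vec_component_iff:
  fixes f :: "real ^ 'm \<Rightarrow> real ^ 'n"
  shows "integrable M f \<longleftrightarrow> (\<forall>i. integrable M (\<lambda>x. f x $ i))"
proof
  assume "integrable M f"
  then show "\<forall>i. integrable M (\<lambda>x. f x $ i)"
    by (auto intro: integrable_bounded_linear[OF bounded_linear_vec_nth])
next
  assume "\<forall>i. integrable M (\<lambda>x. f x $ i)"
  then have "integrable M (\<lambda>x. \<Sum>i\<in>UNIV. (f x $ i) *\<^sub>R axis i 1)"
    by (intro Bochner_Integration.integrable_sum integrable_scaleR_left) auto
  also have "(\<lambda>x. \<Sum>i\<in>UNIV. (f x $ i) *\<^sub>R axis i 1) = f"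
    by (simp add: basis_expansion fun_eq_iff flip: scalar_mult_eq_scaleR)
  finally show "integrable M f" .
qed

text \<open>The derivative is moved onto the test function: \<open>(1 - \<eta> x) * \<psi> x\<close>
  is itself admissible for \<open>u\<close>, and the constant \<open>k\<close> is handled by the
  vanishing integral of the partial derivatives of \<open>\<eta> x * \<psi> x\<close>. Thus no
  product of two weakly differentiable functions occurs.\<close>

lemma weak_gradient_cutoff:
  fixes \<eta> :: "real ^ 'n \<Rightarrow> real"
  assumes wg: "weak_gradient u Du \<Omega>" and \<Omega>: "\<Omega> \<in> sets lebesgue" and U: "open U" "U \<subseteq> \<Omega>" and cu: "continuous_on U u"
    and d: "\<And>x. (\<eta> has_derivative (\<lambda>h. D\<eta> x \<bullet> h)) (at x)" and cD: "continuous_on UNIV D\<eta>"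
  shows "weak_gradient (\<lambda>x. u x - \<eta> x * (u x - k)) (\<lambda>x. (1 - \<eta> x) *\<^sub>R Du x - (u x - k) *\<^sub>R D\<eta> x) U"
proof -
  have c\<eta>: "continuous_on UNIV \<eta>"
    using d by (meson differentiable_imp_continuous_on differentiable_on_def differentiable_at_withinI differentiableI)
  note c\<eta>' = continuous_on_subset[OF c\<eta> subset_UNIV] and cD' = continuous_on_subset[OF cD subset_UNIV]
  have Us: "U \<in> sets lebesgue" using U by (simp add: borel_open)
  show ?thesis
    unfolding weak_gradient_def
  proof (intro conjI allI impI)
    fix S :: "(real ^ 'n) set" assume S: "compact S" "S \<subseteq> U"
    note cuS = continuous_on_subset[OF cu S(2)]
    show "integrable (lebesgue_on S) (\<lambda>x. u x - \<eta> x * (u x - k))"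
      by (intro continuous_imp_integrable_on_compact continuous_intros cuS c\<eta>' S)
    have "integrable (lebesgue_on S) Du" using wg S U unfolding weak_gradient_def by blast
    then have Dui: "integrable (lebesgue_on S) (\<lambda>x. Du x $ i)" for i by (simp add: integrable_vec_component_iff)
    have "integrable (lebesgue_on S) (\<lambda>x. Du x $ i * (1 - \<eta> x) - (u x - k) * (D\<eta> x $ i))" for i
      by (intro Bochner_Integration.integrable_diff integrable_on_mult_continuous continuous_imp_integrable_on_compact
          continuous_intros cuS c\<eta>' cD' S Dui)
    then show "integrable (lebesgue_on S) (\<lambda>x. (1 - \<eta> x) *\<^sub>R Du x - (u x - k) *\<^sub>R D\<eta> x)"
      unfolding integrable_vec_component_iff by (simp add: mult.commute)
  next
    fix \<psi> :: "real ^ 'n \<Rightarrow> real" and D i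
    assume \<psi>: "(\<forall>x. (\<psi> has_derivative (\<lambda>h. D x \<bullet> h)) (at x)) \<and> continuous_on UNIV D \<and>
        compact (closure {x. \<psi> x \<noteq> 0}) \<and> closure {x. \<psi> x \<noteq> 0} \<subseteq> U"
    define S where "S = closure {x. \<psi> x \<noteq> 0}"
    have S: "compact S" "S \<subseteq> U" using \<psi> by (auto simp: S_def)
    have Ss: "S \<in> sets lebesgue" using S(1) by (simp add: lmeasurable_compact fmeasurableD)
    have S\<Omega>: "S \<subseteq> \<Omega>" using S U by auto
    have out: "\<psi> x = 0" if "x \<notin> S" for x using that closure_subset[of "{x. \<psi> x \<noteq> 0}"] by (auto simp: S_def)
    have d\<psi>: "\<And>x. (\<psi> has_derivative (\<lambda>h. D x \<bullet> h)) (at x)" and c: "continuous_on UNIV D" using \<psi> by auto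
    have D0: "D x = 0" if "x \<notin> S" for x
      using C1_zero_outside[OF d\<psi> compact_imp_closed[OF S(1)] out that] .
    have c\<psi>: "continuous_on UNIV \<psi>"
      using d\<psi> by (meson differentiable_imp_continuous_on differentiable_on_def differentiable_at_withinI differentiableI)
    note c\<psi>' = continuous_on_subset[OF c\<psi> subset_UNIV] and c' = continuous_on_subset[OF c subset_UNIV]
    note cuS = continuous_on_subset[OF cu S(2)]
    have A: "lint S (\<lambda>x. u x * (((1 - \<eta> x) *\<^sub>R D x - \<psi> x *\<^sub>R D\<eta> x) $ i)) 
        = - lint S (\<lambda>x. (Du x $ i) * ((1 - \<eta> x) * \<psi> x))"
    proof (rule weak_gradient_test[OF wg \<Omega> _ _ S(1) _ S\<Omega>])
      fix x
      have "((\<lambda>x. (1 - \<eta> x) * \<psi> x) has_derivative (\<lambda>h. (1 - \<eta> x) * (D x \<bullet> h) + (0 - D\<eta> x \<bullet> h) * \<psi> x)) (at x)"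
        by (intro has_derivative_mult has_derivative_diff has_derivative_const d d\<psi>)
      also have "(\<lambda>h. (1 - \<eta> x) * (D x \<bullet> h) + (0 - D\<eta> x \<bullet> h) * \<psi> x) = (\<lambda>h. ((1 - \<eta> x) *\<^sub>R D x - \<psi> x *\<^sub>R D\<eta> x) \<bullet> h)"
        by (simp add: fun_eq_iff inner_diff_left)
      finally show "((\<lambda>x. (1 - \<eta> x) * \<psi> x) has_derivative (\<lambda>h. ((1 - \<eta> x) *\<^sub>R D x - \<psi> x *\<^sub>R D\<eta> x) \<bullet> h)) (at x)" .
      show "x \<notin> S \<Longrightarrow> (1 - \<eta> x) * \<psi> x = 0" using out by simp
    qed (intro continuous_intros c\<eta> c cD c\<psi>)
    have B: "lint S (\<lambda>x. (\<eta> x *\<^sub>R D x + \<psi> x *\<^sub>R D\<eta> x) $ i) = 0"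
    proof (rule integral_partial_derivative_zero[OF _ _ S(1)])
      fix x
      have "((\<lambda>x. \<eta> x * \<psi> x) has_derivative (\<lambda>h. \<eta> x * (D x \<bullet> h) + (D\<eta> x \<bullet> h) * \<psi> x)) (at x)"
        by (intro has_derivative_mult d d\<psi>)
      also have "(\<lambda>h. \<eta> x * (D x \<bullet> h) + (D\<eta> x \<bullet> h) * \<psi> x) = (\<lambda>h. (\<eta> x *\<^sub>R D x + \<psi> x *\<^sub>R D\<eta> x) \<bullet> h)"
        by (simp add: fun_eq_iff inner_add_left)
      finally show "((\<lambda>x. \<eta> x * \<psi> x) has_derivative (\<lambda>h. (\<eta> x *\<^sub>R D x + \<psi> x *\<^sub>R D\<eta> x) \<bullet> h)) (at x)" .
      show "x \<notin> S \<Longrightarrow> \<eta> x * \<psi> x = 0" using out by simp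
    qed (intro continuous_intros c\<eta> c cD c\<psi>)
    have uI: "integrable (lebesgue_on S) u" by (intro continuous_imp_integrable_on_compact cuS S)
    have "integrable (lebesgue_on S) Du" using wg S U unfolding weak_gradient_def by blast
    then have Dui: "integrable (lebesgue_on S) (\<lambda>x. Du x $ i)" for i by (simp add: integrable_vec_component_iff)
    have I1: "integrable (lebesgue_on S) (\<lambda>x. u x * (((1 - \<eta> x) *\<^sub>R D x - \<psi> x *\<^sub>R D\<eta> x) $ i))"
      by (intro continuous_imp_integrable_on_compact continuous_intros cuS S c\<eta>' c' cD' c\<psi>')
    have I2: "integrable (lebesgue_on S) (\<lambda>x. k * ((\<eta> x *\<^sub>R D x + \<psi> x *\<^sub>R D\<eta> x) $ i))"
      by (intro continuous_imp_integrable_on_compact continuous_intros cuS S c\<eta>' c' cD' c\<psi>')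
    have I3: "integrable (lebesgue_on S) (\<lambda>x. (u x - k) * (\<psi> x * (D\<eta> x $ i)))"
      by (intro continuous_imp_integrable_on_compact continuous_intros cuS S c\<eta>' c' cD' c\<psi>')
    have I4: "integrable (lebesgue_on S) (\<lambda>x. (Du x $ i) * ((1 - \<eta> x) * \<psi> x))"
      by (intro integrable_on_mult_continuous Dui continuous_intros cuS S c\<eta>' c' cD' c\<psi>')
    have "lint U (\<lambda>x. (u x - \<eta> x * (u x - k)) * (D x $ i)) 
        = lint S (\<lambda>x. (u x - \<eta> x * (u x - k)) * (D x $ i))"
      by (rule integral_on_zero_outside) (use S Ss Us D0 in auto)
    \<comment> \<open>The integrand splits into \<open>u\<close> times the derivative of
      \<open>(1 - \<eta> x) * \<psi> x\<close>, \<open>k\<close> times that of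
      \<open>\<eta> x * \<psi> x\<close>, and a remainder free of derivatives of \<psi>. The first
      part is \<open>A\<close>, the second integrates to 0 by \<open>B\<close>.\<close>
    also have "\<dots> = lint S (\<lambda>x. u x * (((1 - \<eta> x) *\<^sub>R D x - \<psi> x *\<^sub>R D\<eta> x) $ i)
        + k * ((\<eta> x *\<^sub>R D x + \<psi> x *\<^sub>R D\<eta> x) $ i) + (u x - k) * (\<psi> x * (D\<eta> x $ i)))"
      by (intro Bochner_Integration.integral_cong) (auto simp: algebra_simps)
    also have "\<dots> = lint S (\<lambda>x. u x * (((1 - \<eta> x) *\<^sub>R D x - \<psi> x *\<^sub>R D\<eta> x) $ i))
        + lint S (\<lambda>x. k * ((\<eta> x *\<^sub>R D x + \<psi> x *\<^sub>R D\<eta> x) $ i))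
        + lint S (\<lambda>x. (u x - k) * (\<psi> x * (D\<eta> x $ i)))"
      using I1 I2 I3 by (simp only: Bochner_Integration.integral_add Bochner_Integration.integrable_add)
    also have "lint S (\<lambda>x. k * ((\<eta> x *\<^sub>R D x + \<psi> x *\<^sub>R D\<eta> x) $ i)) = 0"
      unfolding integral_mult_right_zero B by simp
    finally have "lint U (\<lambda>x. (u x - \<eta> x * (u x - k)) * (D x $ i))
       = - (lint S (\<lambda>x. (Du x $ i) * ((1 - \<eta> x) * \<psi> x)) - lint S (\<lambda>x. (u x - k) * (\<psi> x * (D\<eta> x $ i))))"
      unfolding A by simp
    also have "\<dots> = - lint S (\<lambda>x. (Du x $ i) * ((1 - \<eta> x) * \<psi> x) - (u x - k) * (\<psi> x * (D\<eta> x $ i)))"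
      using I3 I4 by simp
    also have "\<dots> = - lint S (\<lambda>x. (((1 - \<eta> x) *\<^sub>R Du x - (u x - k) *\<^sub>R D\<eta> x) $ i) * \<psi> x)"
      by (simp add: algebra_simps)
    also have "\<dots> = - lint U (\<lambda>x. (((1 - \<eta> x) *\<^sub>R Du x - (u x - k) *\<^sub>R D\<eta> x) $ i) * \<psi> x)"
      by (rule arg_cong[where f = uminus], rule integral_on_zero_outside[symmetric]) (use S Ss Us out in auto)
    finally show "lint U (\<lambda>x. (u x - \<eta> x * (u x - k)) * (D x $ i)) 
       = - lint U (\<lambda>x. (((1 - \<eta> x) *\<^sub>R Du x - (u x - k) *\<^sub>R D\<eta> x) $ i) * \<psi> x)" .
  qed
qed

text \<open>Countable sets are Lebesgue null. This permits enlarging the set where a comparison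
  function differs from \<open>u\<close> without touching its gradient.\<close>

lemma weak_gradient_modify_countable:
  fixes u :: "real ^ 'n \<Rightarrow> real"
  assumes wg: "weak_gradient u Du U" and N: "countable N" "\<And>x. x \<notin> N \<Longrightarrow> v x = u x" and U: "open U"
  shows "weak_gradient v Du U"
proof -
  have nul: "emeasure (lebesgue_on S) {x} = 0" "{x} \<in> sets (lebesgue_on S)" if "x \<in> N \<inter> S" "S \<in> sets lebesgue" for x and S :: "(real ^ 'n) set"
    using that by (auto simp: sets_restrict_space_iff emeasure_restrict_space)
  have cN: "countable (N \<inter> S)" for S using N(1) by (rule countable_subset[rotated]) auto
  show ?thesis
    unfolding weak_gradient_def
  proof (intro conjI allI impI)
    fix S :: "(real ^ 'n) set" assume S: "compact S" "S \<subseteq> U"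
    then have Ss: "S \<in> sets lebesgue" by (simp add: lmeasurable_compact fmeasurableD)
    have "integrable (lebesgue_on S) v \<longleftrightarrow> integrable (lebesgue_on S) u"
      by (rule integrable_discrete_difference[OF cN[of S] nul[OF _ Ss]]) (use N in auto)
    then show "integrable (lebesgue_on S) v" "integrable (lebesgue_on S) Du" using wg S unfolding weak_gradient_def by auto
  next
    fix \<psi> :: "real ^ 'n \<Rightarrow> real" and D i
    assume \<psi>: "(\<forall>x. (\<psi> has_derivative (\<lambda>h. D x \<bullet> h)) (at x)) \<and> continuous_on UNIV D \<and>
        compact (closure {x. \<psi> x \<noteq> 0}) \<and> closure {x. \<psi> x \<noteq> 0} \<subseteq> U"
    have Us: "U \<in> sets lebesgue" using U by (simp add: borel_open)
    have "lint U (\<lambda>x. v x * (D x $ i)) = lint U (\<lambda>x. u x * (D x $ i))"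
      by (rule integral_discrete_difference[OF cN[of U] nul[OF _ Us]]) (use N in auto)
    then show "lint U (\<lambda>x. v x * (D x $ i)) = - lint U (\<lambda>x. (Du x $ i) * \<psi> x)"
      using wg \<psi> unfolding weak_gradient_def by auto
  qed
qed

subsection \<open>The Caccioppoli inequality\<close>

text \<open>Two parabolas glued at \<open>1 / 2\<close>: \<open>2 * z\<^sup>2\<close> on the left
  and \<open>1 - 2 * (1 - z)\<^sup>2\<close> on the right, constant outside the unit interval.
  Squared positive parts allow differentiation without case distinctions.\<close>

definition smooth_step :: "real \<Rightarrow> real" where
  "smooth_step z = 2 * (max 0 z)\<^sup>2 - 4 * (max 0 (z - 1/2))\<^sup>2 + 2 * (max 0 (z - 1))\<^sup>2"

definition smooth_step' :: "real \<Rightarrow> real" where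
  "smooth_step' z = 4 * max 0 z - 8 * max 0 (z - 1/2) + 4 * max 0 (z - 1)"

lemma smooth_step_deriv: "(smooth_step has_real_derivative smooth_step' z) (at z)"
  unfolding smooth_step_def[abs_def] smooth_step'_def by (auto intro!: derivative_eq_intros)

lemma smooth_step_low: "z \<le> 0 \<Longrightarrow> smooth_step z = 0" "z \<le> 0 \<Longrightarrow> smooth_step' z = 0"
  by (simp_all add: smooth_step_def smooth_step'_def max_def)

lemma smooth_step_high: "1 \<le> z \<Longrightarrow> smooth_step z = 1" "1 \<le> z \<Longrightarrow> smooth_step' z = 0"
  by (simp_all add: smooth_step_def smooth_step'_def max_def power2_eq_square algebra_simps)

lemma smooth_step_bounds: "0 \<le> smooth_step z" "smooth_step z \<le> 1" "\<bar>smooth_step' z\<bar> \<le> 2"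
proof -
  consider "z \<le> 0" | "0 < z" "z < 1/2" | "1/2 \<le> z" "z < 1" | "1 \<le> z" by linarith
  then have "0 \<le> smooth_step z \<and> smooth_step z \<le> 1 \<and> \<bar>smooth_step' z\<bar> \<le> 2"
  proof cases
    case 1 then show ?thesis by (simp add: smooth_step_low)
  next
    case 2
    then have "z\<^sup>2 \<le> (1/2)\<^sup>2" by (intro power_mono) auto
    with 2 show ?thesis by (simp add: smooth_step_def smooth_step'_def max_def power2_eq_square)
  next
    case 3
    have eq: "smooth_step z = 1 - 2 * (1 - z)\<^sup>2" using 3 by (simp add: smooth_step_def max_def power2_eq_square algebra_simps)
    have "(1 - z)\<^sup>2 \<le> (1/2)\<^sup>2" using 3 by (intro power_mono) auto
    moreover have "\<bar>smooth_step' z\<bar> \<le> 2" using 3 by (simp add: smooth_step'_def max_def)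
    ultimately show ?thesis unfolding eq by (simp add: power2_eq_square)
  next
    case 4 then show ?thesis by (simp add: smooth_step_high)
  qed
  then show "0 \<le> smooth_step z" "smooth_step z \<le> 1" "\<bar>smooth_step' z\<bar> \<le> 2" by auto
qed

text \<open>The step is applied to the squared distance, which is smooth at the centre
  \<open>y\<close>. Its denominator factors as \<open>(t - s) * (t + s)\<close>, and the second
  factor cancels the length of \<open>x - y\<close>, leaving a gradient of order
  \<open>1 / (t - s)\<close>.\<close>

lemma cutoff_exists:
  fixes y :: "real ^ 'n"
  assumes st: "0 \<le> s" "s < t"
  obtains \<eta> D\<eta> where "\<And>x. (\<eta> has_derivative (\<lambda>h. D\<eta> x \<bullet> h)) (at x)" "continuous_on UNIV D\<eta>"
    "\<And>x. 0 \<le> \<eta> x" "\<And>x. \<eta> x \<le> (1 :: real)" "\<And>x. x \<in> cball y s \<Longrightarrow> \<eta> x = 1 \<and> D\<eta> x = 0"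
    "\<And>x. x \<notin> ball y t \<Longrightarrow> \<eta> x = 0 \<and> D\<eta> x = 0" "\<And>x. norm (D\<eta> x) \<le> 4 / (t - s)"
proof -
  define d where "d = t\<^sup>2 - s\<^sup>2"
  have dts: "d = (t - s) * (t + s)" by (simp add: d_def power2_eq_square algebra_simps)
  have d: "0 < d" using st unfolding dts by (intro mult_pos_pos) auto
  define z where "z = (\<lambda>x. (t\<^sup>2 - (x - y) \<bullet> (x - y)) / d)"
  define \<eta> where "\<eta> = (\<lambda>x. smooth_step (z x))"
  define D\<eta> where "D\<eta> = (\<lambda>x. (smooth_step' (z x) * (- (2 / d))) *\<^sub>R (x - y))"
  have zlow: "z x \<le> 0" if "x \<notin> ball y t" for x
  proof -
    have "t\<^sup>2 \<le> (norm (x - y))\<^sup>2" using that st by (intro power_mono) (auto simp: dist_norm norm_minus_commute)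
    then show ?thesis using d by (simp add: z_def dot_square_norm divide_le_0_iff)
  qed
  have zhigh: "1 \<le> z x" if "x \<in> cball y s" for x
  proof -
    have "(norm (x - y))\<^sup>2 \<le> s\<^sup>2" using that by (intro power_mono) (auto simp: dist_norm norm_minus_commute)
    then have "d \<le> t\<^sup>2 - (x - y) \<bullet> (x - y)" by (simp add: d_def dot_square_norm)
    then show ?thesis using d by (simp add: z_def)
  qed
  have dz: "(z has_derivative (\<lambda>h. - (2 / d) * ((x - y) \<bullet> h))) (at x)" for x
  proof -
    have "((\<lambda>x. t\<^sup>2 * k - k * ((x - y) \<bullet> (x - y))) has_derivative (\<lambda>h. - (k * (2 * ((x - y) \<bullet> h))))) (at x)" for k
      by (auto intro!: derivative_eq_intros simp: inner_commute algebra_simps)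
    from this[of "1 / d"] show ?thesis by (simp add: z_def diff_divide_distrib)
  qed
  show thesis
  proof
    fix x
    from has_derivative_compose[OF dz smooth_step_deriv[unfolded has_field_derivative_def]]
    have "(\<eta> has_derivative (\<lambda>h. smooth_step' (z x) * (- (2 / d) * ((x - y) \<bullet> h)))) (at x)" unfolding \<eta>_def .
    also have "(\<lambda>h. smooth_step' (z x) * (- (2 / d) * ((x - y) \<bullet> h))) = (\<lambda>h. D\<eta> x \<bullet> h)"
      by (simp add: D\<eta>_def fun_eq_iff)
    finally show "(\<eta> has_derivative (\<lambda>h. D\<eta> x \<bullet> h)) (at x)" .
    show "0 \<le> \<eta> x" "\<eta> x \<le> 1" by (simp_all add: \<eta>_def smooth_step_bounds)
    show "\<eta> x = 1 \<and> D\<eta> x = 0" if "x \<in> cball y s" using smooth_step_high[OF zhigh[OF that]] by (simp add: \<eta>_def D\<eta>_def)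
    show out: "\<eta> x = 0 \<and> D\<eta> x = 0" if "x \<notin> ball y t" using smooth_step_low[OF zlow[OF that]] by (simp add: \<eta>_def D\<eta>_def)
    show "norm (D\<eta> x) \<le> 4 / (t - s)"
    proof (cases "x \<in> ball y t")
      case True
      then have "norm (x - y) \<le> t + s" using st by (simp add: dist_norm norm_minus_commute)
      then have "\<bar>smooth_step' (z x)\<bar> * (2 / d) * norm (x - y) \<le> 2 * (2 / d) * (t + s)"
        using smooth_step_bounds(3) d st by (intro mult_mono) auto
      also have "\<dots> = 4 / (t - s)"
      proof -
        have "2 * (2 / (a * b)) * b = 4 / a" if "b \<noteq> 0" for a b :: real using that by simp
        from this[of "t + s" "t - s"] show ?thesis using st unfolding dts by simp
      qed
      finally show ?thesis using d by (simp add: D\<eta>_def abs_mult)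
    next
      case False then show ?thesis using out st by simp
    qed
  next
    show "continuous_on UNIV D\<eta>" unfolding D\<eta>_def z_def smooth_step'_def by (intro continuous_intros) (use d in auto)
  qed
qed

locale quasimin =
  fixes p q L Lw Q K \<gamma> r :: real and \<Omega> :: "(real ^ 'n::finite) set" and \<phi> u Du x0
  assumes p_gt_1: "1 < p" and p_le_q: "p \<le> q" and L_ge_1: "1 \<le> L" and Lw_pos: "0 < Lw" and Q_ge_1: "1 \<le> Q"
    and open_\<Omega>: "open \<Omega>" and Phi: "Phi_w \<Omega> \<phi>" and A0: "A0 \<Omega> \<phi> L" and aInc: "aInc \<Omega> \<phi> p L" and aDec: "aDec \<Omega> \<phi> q L"
    and \<gamma>: "0 < \<gamma>" "\<gamma> < 1" and A1: "A1 \<Omega> \<phi> (real CARD('n) / (1 - \<gamma>)) Lw"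
    and r_pos: "0 < r" and ball_sub: "cball x0 (4 * r) \<subseteq> \<Omega>"
    and W1: "W1phi_loc \<phi> \<Omega> u Du" and holder: "holder_on \<gamma> u (ball x0 (4 * r))"
    and quasi: "quasiminimizer \<phi> (ball x0 (4 * r)) u Du Q"
    and seminorm: "holder_seminorm \<gamma> u (ball x0 (2 * r)) = K"
begin

lemma p_ge_1: "1 \<le> p" using p_gt_1 by simp

lemmas structure_conds = Phi A0 aInc aDec p_ge_1 p_le_q L_ge_1

lemma \<Omega>_sets: "\<Omega> \<in> sets lebesgue" using open_\<Omega> by (simp add: borel_open)

lemma growth_at: "x \<in> \<Omega> \<Longrightarrow> growth p q L (\<phi> x)" by (rule growth_phi[OF structure_conds])

lemma wg: "weak_gradient u Du \<Omega>" using W1 by (simp add: W1phi_loc_def)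

lemma u_cont: "continuous_on (ball x0 (4 * r)) u" using holder by (simp add: holder_on_def)

definition g where "g x = \<phi> x (norm (Du x))"

lemma g_nonneg: "x \<in> \<Omega> \<Longrightarrow> 0 \<le> g x" using growth.nonneg[OF growth_at] by (simp add: g_def)

lemma g_integrable_compact: "compact S \<Longrightarrow> S \<subseteq> \<Omega> \<Longrightarrow> integrable (lebesgue_on S) g"
  using integrable_modular[OF structure_conds, of S "\<lambda>x. norm (Du x)"] W1 \<Omega>_sets
  unfolding W1phi_loc_def g_def[abs_def] by (simp add: lmeasurable_compact fmeasurableD)

lemma g_integrable: "S \<subseteq> cball x0 (4 * r) \<Longrightarrow> S \<in> sets lebesgue \<Longrightarrow> integrable (lebesgue_on S) g"
  using integrable_on_subset_lebesgue[OF g_integrable_compact[OF compact_cball ball_sub]] by auto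

lemma Du_integrable: "S \<subseteq> cball x0 (4 * r) \<Longrightarrow> S \<in> sets lebesgue \<Longrightarrow> integrable (lebesgue_on S) Du"
  using integrable_on_subset_lebesgue[of "cball x0 (4 * r)" Du S] wg ball_sub unfolding weak_gradient_def by auto

lemma modular_integrable_bounded:
  assumes S: "compact S" "S \<subseteq> \<Omega>" and f: "f \<in> borel_measurable (lebesgue_on S)" and B: "\<And>x. x \<in> S \<Longrightarrow> \<bar>f x\<bar> \<le> B"
  shows "integrable (lebesgue_on S) (\<lambda>x. \<phi> x \<bar>f x\<bar>)"
proof (rule Bochner_Integration.integrable_bound)
  show "integrable (lebesgue_on S) (\<lambda>x. L\<^sup>2 * max 1 B powr q)"
    using S by (intro integrable_const_lmeasurable lmeasurable_compact)
  show "(\<lambda>x. \<phi> x \<bar>f x\<bar>) \<in> borel_measurable (lebesgue_on S)"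
    using S f by (intro phi_measurable[OF Phi]) (auto simp: lmeasurable_compact fmeasurableD \<Omega>_sets)
  show "AE x in lebesgue_on S. norm (\<phi> x \<bar>f x\<bar>) \<le> norm (L\<^sup>2 * max 1 B powr q)"
  proof (rule AE_I2)
    fix x assume "x \<in> space (lebesgue_on S)"
    then have x: "x \<in> S" "x \<in> \<Omega>" using S by auto
    interpret growth p q L "\<phi> x" by (rule growth_at[OF x(2)])
    have "\<phi> x \<bar>f x\<bar> \<le> L\<^sup>2 * max 1 \<bar>f x\<bar> powr q" by (rule upper) simp
    also have "\<dots> \<le> L\<^sup>2 * max 1 B powr q"
      using B[OF x(1)] p1 pq by (intro mult_left_mono powr_mono2) auto
    finally show "norm (\<phi> x \<bar>f x\<bar>) \<le> norm (L\<^sup>2 * max 1 B powr q)" using nonneg[of "\<bar>f x\<bar>"] by simp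
  qed
qed

text \<open>The energy of the inner ball stays on the right with a negative sign, to be moved to the
  left later: this is the hole to be filled. \<open>8 powr q\<close> combines
  \<open>2 powr q\<close> from splitting a sum with \<open>4 powr q\<close> from the gradient of the
  cutoff.\<close>

lemma caccioppoli:
  fixes k :: real
  assumes st: "0 \<le> s" "s < t" and ball: "cball y t \<subseteq> ball x0 (4 * r)"
  defines "h \<equiv> \<lambda>x. \<phi> x (\<bar>u x - k\<bar> / (t - s))"
  shows "integrable (lebesgue_on (cball y t)) h"
    and "lint (cball y t) g \<le> Q * L\<^sup>2 * 8 powr q *
      (lint (cball y t) g - lint (cball y s) g + lint (cball y t) h)"
proof -
  let ?U = "ball x0 (4 * r)"
  have tO: "cball y t \<subseteq> \<Omega>" using ball ball_sub ball_subset_cball[of x0 "4*r"] by blast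
  have UO: "?U \<subseteq> \<Omega>" using ball_sub ball_subset_cball[of x0 "4*r"] by blast
  have cut: "continuous_on (cball y t) u" using u_cont ball by (rule continuous_on_subset)
  have bounded_cont: "integrable (lebesgue_on S) (\<lambda>x. \<phi> x \<bar>f x\<bar>)" if Sf: "compact S" "S \<subseteq> \<Omega>" "continuous_on S f" for S f
  proof -
    have Ss: "S \<in> sets lebesgue" using Sf by (simp add: lmeasurable_compact fmeasurableD)
    obtain B where "\<And>x. x \<in> S \<Longrightarrow> norm (f x) \<le> B"
      using compact_imp_bounded[OF compact_continuous_image[OF Sf(3,1)]] by (auto simp: bounded_iff)
    then show ?thesis
      using Sf continuous_imp_measurable_on_sets_lebesgue[OF Sf(3) Ss] by (intro modular_integrable_bounded) auto
  qed
  have "integrable (lebesgue_on (cball y t)) (\<lambda>x. \<phi> x \<bar>(u x - k) / (t - s)\<bar>)"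
    using st by (intro bounded_cont tO continuous_intros cut) auto
  then show hI: "integrable (lebesgue_on (cball y t)) h" using st by (simp add: h_def abs_divide)
  obtain \<eta> D\<eta> where \<eta>: "\<And>x. (\<eta> has_derivative (\<lambda>h. D\<eta> x \<bullet> h)) (at x)" "continuous_on UNIV D\<eta>"
    "\<And>x. 0 \<le> \<eta> x" "\<And>x. \<eta> x \<le> (1 :: real)" "\<And>x. x \<in> cball y s \<Longrightarrow> \<eta> x = 1 \<and> D\<eta> x = 0"
    "\<And>x. x \<notin> ball y t \<Longrightarrow> \<eta> x = 0 \<and> D\<eta> x = 0" "\<And>x. norm (D\<eta> x) \<le> 4 / (t - s)"
    using cutoff_exists[OF st, of y] by metis
  have c\<eta>: "continuous_on S \<eta>" for S
    using \<eta>(1) by (meson differentiable_imp_continuous_on differentiable_on_def differentiable_at_withinI differentiableI)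
  have cD: "continuous_on S D\<eta>" for S using continuous_on_subset[OF \<eta>(2)] by auto
  obtain N :: "(real ^ 'n) set" where N: "countable N" "\<And>X. open X \<Longrightarrow> X \<noteq> {} \<Longrightarrow> \<exists>d\<in>N. d \<in> X"
    using countable_dense_exists by blast
  define w where "w = (\<lambda>x. u x - \<eta> x * (u x - k))"
  \<comment> \<open>Moving \<open>w\<close> away from \<open>u\<close> on a countable dense set makes the support of \<open>u - v\<close> the whole ball.\<close>
  define v where "v = (\<lambda>x. if x \<in> N \<inter> ball y t then u x + 1 else w x)"
  define Dv where "Dv = (\<lambda>x. (1 - \<eta> x) *\<^sub>R Du x - (u x - k) *\<^sub>R D\<eta> x)"
  have wgv: "weak_gradient v Dv ?U"
  proof (rule weak_gradient_modify_countable[of w])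
    show "weak_gradient w Dv ?U" unfolding w_def Dv_def
      by (rule weak_gradient_cutoff[OF wg \<Omega>_sets open_ball UO u_cont \<eta>(1,2)])
  qed (use N(1) in \<open>auto simp: v_def\<close>)
  have Dv_le: "norm (Dv x) \<le> norm (Du x) + 4 * (\<bar>u x - k\<bar> / (t - s))" for x
  proof -
    have "norm (Dv x) \<le> norm ((1 - \<eta> x) *\<^sub>R Du x) + norm ((u x - k) *\<^sub>R D\<eta> x)"
      unfolding Dv_def by (rule norm_triangle_ineq4)
    also have "norm ((1 - \<eta> x) *\<^sub>R Du x) \<le> norm (Du x)"
      using \<eta>(3)[of x] \<eta>(4)[of x] by (simp add: mult_left_le_one_le)
    also have "norm ((u x - k) *\<^sub>R D\<eta> x) \<le> \<bar>u x - k\<bar> * (4 / (t - s))"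
      unfolding norm_scaleR real_norm_def by (rule mult_left_mono[OF \<eta>(7)]) simp
    finally show ?thesis by (simp add: mult.commute)
  qed
  have phiDv: "\<phi> x (norm (Dv x)) \<le> L * 2 powr q * (g x + L * 4 powr q * \<phi> x (\<bar>u x - k\<bar> / (t - s)))"
    if x: "x \<in> \<Omega>" for x
  proof -
    interpret growth p q L "\<phi> x" by (rule growth_at[OF x])
    have "\<phi> x (norm (Dv x)) \<le> \<phi> x (norm (Du x) + 4 * (\<bar>u x - k\<bar> / (t - s)))"
      using Dv_le by (intro mono) auto
    also have "\<dots> \<le> L * 2 powr q * (\<phi> x (norm (Du x)) + \<phi> x (4 * (\<bar>u x - k\<bar> / (t - s))))"
      using st by (intro subadditive) auto
    also have "\<dots> \<le> L * 2 powr q * (g x + L * 4 powr q * \<phi> x (\<bar>u x - k\<bar> / (t - s)))"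
      using L1 scale_up[of 4 "\<bar>u x - k\<bar> / (t - s)"] st by (intro mult_left_mono add_mono) (auto simp: g_def)
    finally show ?thesis .
  qed
  have W1v: "W1phi_loc \<phi> ?U v Dv"
    unfolding W1phi_loc_def
  proof (intro conjI allI impI wgv)
    fix S :: "(real ^ 'n) set" assume S: "compact S" "S \<subseteq> ?U"
    have Ss: "S \<in> sets lebesgue" using S by (simp add: lmeasurable_compact fmeasurableD)
    have SO: "S \<subseteq> \<Omega>" using S UO by auto
    have cuS: "continuous_on S u" using u_cont S(2) by (rule continuous_on_subset)
    have cw: "continuous_on S w" unfolding w_def by (intro continuous_intros cuS c\<eta>)
    have vI: "integrable (lebesgue_on S) v" and DvI: "integrable (lebesgue_on S) Dv"
      using wgv S unfolding weak_gradient_def by auto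
    obtain B where B: "\<And>x. x \<in> S \<Longrightarrow> norm (w x) \<le> B"
      using compact_imp_bounded[OF compact_continuous_image[OF cw S(1)]] by (auto simp: bounded_iff)
    obtain B' where B': "\<And>x. x \<in> S \<Longrightarrow> norm (u x) \<le> B'"
      using compact_imp_bounded[OF compact_continuous_image[OF cuS S(1)]] by (auto simp: bounded_iff)
    show "in_Lphi \<phi> S v"
    proof (rule in_Lphi_if_modular_finite[OF structure_conds _ SO Ss])
      show "integrable (lebesgue_on S) (\<lambda>x. \<phi> x \<bar>v x\<bar>)"
      proof (rule modular_integrable_bounded[OF S(1) SO])
        fix x assume "x \<in> S"
        then show "\<bar>v x\<bar> \<le> \<bar>B\<bar> + \<bar>B'\<bar> + 1" using B[of x] B'[of x] by (auto simp: v_def)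
      qed (use vI in auto)
    qed (use vI in auto)
    show "in_Lphi \<phi> S (\<lambda>x. norm (Dv x))"
    proof (rule in_Lphi_if_modular_finite[OF structure_conds _ SO Ss])
      have "integrable (lebesgue_on S) (\<lambda>x. \<phi> x \<bar>(u x - k) / (t - s)\<bar>)"
        using st by (intro bounded_cont S(1) SO continuous_intros cuS) auto
      then have "integrable (lebesgue_on S) (\<lambda>x. L * 2 powr q * (g x + L * 4 powr q * \<phi> x (\<bar>u x - k\<bar> / (t - s))))"
        using g_integrable_compact[OF S(1) SO] st by (simp add: abs_divide)
      then show "integrable (lebesgue_on S) (\<lambda>x. \<phi> x \<bar>norm (Dv x)\<bar>)"
      proof (rule Bochner_Integration.integrable_bound)
        show "(\<lambda>x. \<phi> x \<bar>norm (Dv x)\<bar>) \<in> borel_measurable (lebesgue_on S)"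
          using DvI by (intro phi_measurable[OF Phi _ SO Ss \<Omega>_sets] borel_measurable_norm) auto
        show "AE x in lebesgue_on S. norm (\<phi> x \<bar>norm (Dv x)\<bar>) \<le> norm (L * 2 powr q * (g x + L * 4 powr q * \<phi> x (\<bar>u x - k\<bar> / (t - s))))"
        proof (rule AE_I2)
          fix x assume "x \<in> space (lebesgue_on S)"
          then have x: "x \<in> \<Omega>" using SO by auto
          have "0 \<le> \<phi> x (norm (Dv x))" by (rule growth.nonneg[OF growth_at[OF x]]) simp
          then show "norm (\<phi> x \<bar>norm (Dv x)\<bar>) \<le> norm (L * 2 powr q * (g x + L * 4 powr q * \<phi> x (\<bar>u x - k\<bar> / (t - s))))"
            using phiDv[OF x] by simp
        qed
      qed
    qed (use DvI in auto)
  qed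
  \<comment> \<open>Quasiminimality compares energies over this set only. Knowing it exactly avoids
    relating \<open>Du\<close> and \<open>Dv\<close> on the part of the ball where \<open>u\<close>
    and \<open>w\<close> agree.\<close>
  have supp: "closure {x \<in> ?U. u x \<noteq> v x} = cball y t"
  proof
    have "x \<in> ball y t" if "u x \<noteq> v x" for x
      using that \<eta>(6)[of x] by (cases "x \<in> ball y t") (auto simp: v_def w_def)
    then have "{x \<in> ?U. u x \<noteq> v x} \<subseteq> cball y t" using ball_subset_cball by blast
    then show "closure {x \<in> ?U. u x \<noteq> v x} \<subseteq> cball y t" by (simp add: closure_minimal)
    have "ball y t \<subseteq> ?U" using ball ball_subset_cball by blast
    then have "N \<inter> ball y t \<subseteq> {x \<in> ?U. u x \<noteq> v x}" unfolding v_def by auto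
    then have 1: "closure (N \<inter> ball y t) \<subseteq> closure {x \<in> ?U. u x \<noteq> v x}" by (rule closure_mono)
    have "closure N = UNIV"
    proof -
      have "- closure N = {}"
      proof (rule ccontr)
        assume "- closure N \<noteq> {}"
        then obtain d where "d \<in> N" "d \<in> - closure N" using N(2)[of "- closure N"] by auto
        then show False using closure_subset[of N] by auto
      qed
      then show ?thesis by auto
    qed
    then have "ball y t \<subseteq> closure (N \<inter> ball y t)"
      using open_Int_closure_subset[of "ball y t" N] by (simp add: Int_commute)
    then have "closure (ball y t) \<subseteq> closure (N \<inter> ball y t)" by (simp add: closure_minimal)
    then show "cball y t \<subseteq> closure {x \<in> ?U. u x \<noteq> v x}" using 1 st by simp
  qed
  have gI: "integrable (lebesgue_on (cball y t)) g" by (rule g_integrable_compact[OF compact_cball tO])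
  \<comment> \<open>A pointwise majorant of the comparison energy. The indicator records that
    \<open>Dv\<close> vanishes on the inner ball, where \<eta> is 1.\<close>
  define b where "b = (\<lambda>x. L * 2 powr q * (indicator (cball y t - cball y s) x * g x + L * 4 powr q * h x))"
  have "(\<integral>\<^sup>+x\<in>cball y t. ennreal (g x) \<partial>lebesgue) \<le> ennreal Q * (\<integral>\<^sup>+x\<in>cball y t. ennreal (\<phi> x (norm (Dv x))) \<partial>lebesgue)"
    using quasi[unfolded quasiminimizer_def, rule_format, OF W1v] ball unfolding supp Let_def g_def by auto
  also have "\<dots> \<le> ennreal Q * (\<integral>\<^sup>+x\<in>cball y t. ennreal (b x) \<partial>lebesgue)"
  proof (intro mult_left_mono nn_integral_mono)
    fix x
    show "ennreal (\<phi> x (norm (Dv x))) * indicator (cball y t) x \<le> ennreal (b x) * indicator (cball y t) x"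
    proof (cases "x \<in> cball y t")
      case True
      then have x: "x \<in> \<Omega>" using tO by auto
      interpret growth p q L "\<phi> x" by (rule growth_at[OF x])
      have "\<phi> x (norm (Dv x)) \<le> b x"
      proof (cases "x \<in> cball y s")
        case True
        then have "Dv x = 0" using \<eta>(5)[OF True] by (simp add: Dv_def)
        then show ?thesis using True L1 st by (simp add: b_def at_0 h_def nonneg)
      next
        case False
        then show ?thesis using phiDv[OF x] True by (simp add: b_def h_def)
      qed
      then show ?thesis by (intro mult_right_mono ennreal_leI) auto
    qed simp
  qed simp
  finally have main: "(\<integral>\<^sup>+x\<in>cball y t. ennreal (g x) \<partial>lebesgue) \<le> ennreal Q * (\<integral>\<^sup>+x\<in>cball y t. ennreal (b x) \<partial>lebesgue)" .
  have gs: "integrable (lebesgue_on (cball y t - cball y s)) g"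
    by (rule integrable_on_subset_lebesgue[OF gI]) auto
  have iI: "integrable (lebesgue_on (cball y t)) (\<lambda>x. indicator (cball y t - cball y s) x * g x)"
  proof (rule integrable_on_zero_outside[of "cball y t - cball y s"])
    have "integrable (lebesgue_on (cball y t - cball y s)) (\<lambda>x. indicator (cball y t - cball y s) x * g x) \<longleftrightarrow> integrable (lebesgue_on (cball y t - cball y s)) g"
      by (intro Bochner_Integration.integrable_cong) auto
    then show "integrable (lebesgue_on (cball y t - cball y s)) (\<lambda>x. indicator (cball y t - cball y s) x * g x)" using gs by simp
  qed auto
  have iE: "lint (cball y t) (\<lambda>x. indicator (cball y t - cball y s) x * g x) 
     = lint (cball y t) g - lint (cball y s) g"
  proof -
    have "lint (cball y t) (\<lambda>x. indicator (cball y t - cball y s) x * g x) 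
       = lint (cball y t - cball y s) (\<lambda>x. indicator (cball y t - cball y s) x * g x)"
      by (rule integral_on_zero_outside) auto
    also have "\<dots> = lint (cball y t - cball y s) g"
      by (intro Bochner_Integration.integral_cong) auto
    also have "\<dots> = lint (cball y t) g - lint (cball y s) g"
      by (rule integral_on_Diff[OF gI]) (use st in auto)
    finally show ?thesis .
  qed
  have bI: "integrable (lebesgue_on (cball y t)) b" unfolding b_def using iI hI by simp
  have h0: "0 \<le> h x" if "x \<in> cball y t" for x
    using that tO growth.nonneg[OF growth_at] st by (auto simp: h_def)
  have b0: "0 \<le> b x" if "x \<in> cball y t" for x
    using h0[OF that] g_nonneg[of x] that tO L_ge_1 by (auto simp: b_def)
  have bE: "lint (cball y t) b = L * 2 powr q * (lint (cball y t) g - lint (cball y s) g + L * 4 powr q * lint (cball y t) h)"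
    unfolding b_def using iI hI by (simp add: iE)
  have "ennreal (lint (cball y t) g) \<le> ennreal Q * ennreal (lint (cball y t) b)"
    using main nn_set_integral_eq_integral_on[OF gI _ g_nonneg[OF subsetD[OF tO]]] nn_set_integral_eq_integral_on[OF bI _ b0] by simp
  also have "\<dots> = ennreal (Q * lint (cball y t) b)" using Q_ge_1 by (simp add: ennreal_mult')
  finally have "lint (cball y t) g \<le> Q * lint (cball y t) b"
    using Q_ge_1 b0 by (subst (asm) ennreal_le_iff) (auto intro!: mult_nonneg_nonneg integral_nonneg_AE AE_I2)
  also have "\<dots> \<le> Q * (L\<^sup>2 * 8 powr q * (lint (cball y t) g - lint (cball y s) g + lint (cball y t) h))"
  proof (rule mult_left_mono)
    define A where "A = lint (cball y t) g - lint (cball y s) g"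
    define H where "H = lint (cball y t) h"
    have A: "0 \<le> A" unfolding A_def using integral_on_mono_set[OF gI _ _ _ g_nonneg[OF subsetD[OF tO]], of "cball y s"] subset_cball[of s t y] st by simp
    have H: "0 \<le> H" unfolding H_def using h0 by (intro integral_nonneg_AE AE_I2) auto
    have e8: "8 powr q = 2 powr q * 4 powr q" by (simp flip: powr_mult)
    have "1 * 1 \<le> L * 4 powr q" using L_ge_1 p_ge_1 p_le_q by (intro mult_mono ge_one_powr_ge_zero) auto
    then have "A * 1 \<le> A * (L * 4 powr q)" using A by (intro mult_left_mono) auto
    then have "L * 2 powr q * (A + L * 4 powr q * H) \<le> L * 2 powr q * (A * (L * 4 powr q) + L * 4 powr q * H)"
      using L_ge_1 by (intro mult_left_mono add_mono) auto
    also have "\<dots> = L\<^sup>2 * 8 powr q * (A + H)" by (simp add: e8 power2_eq_square algebra_simps)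
    finally show "lint (cball y t) b \<le> L\<^sup>2 * 8 powr q * (lint (cball y t) g - lint (cball y s) g + lint (cball y t) h)"
      unfolding bE A_def H_def .
  qed (use Q_ge_1 in auto)
  finally show "lint (cball y t) g \<le> Q * L\<^sup>2 * 8 powr q *
      (lint (cball y t) g - lint (cball y s) g + lint (cball y t) h)"
    by (simp add: mult_ac)
qed

end

subsection \<open>Energy estimate on concentric balls\<close>

definition cac_const :: "real \<Rightarrow> real \<Rightarrow> real \<Rightarrow> real" where
  "cac_const q L Q = Q * L\<^sup>2 * 8 powr q"

text \<open>The coefficient of the absorbable term in \<open>oscillation_bound\<close>.
  \<open>2 * \<bar>K\<bar>\<close> bounds \<open>u - k\<close> across a ball; the absolute value
  provides the condition \<open>0 \<le> M\<close> of \<open>A1_comparison\<close> without knowing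
  the sign of \<open>K\<close>.\<close>

definition osc_const :: "real \<Rightarrow> real \<Rightarrow> real \<Rightarrow> real \<Rightarrow> 'n::finite itself \<Rightarrow> real" where
  "osc_const q L Lw K T = L ^ 3 * (2 powr q)\<^sup>2 * A1_const q L Lw (2 * \<bar>K\<bar>) T * (L ^ 3 * 2 powr q * max 1 (2 * poincare_const T) powr q)"

text \<open>The second summand comes from moving the kernel average from \<open>x\<close> to the
  common centre; the negative power of \<epsilon> is the price of averaging at a small
  scale.\<close>

definition osc_const' :: "real \<Rightarrow> real \<Rightarrow> real \<Rightarrow> real \<Rightarrow> 'n::finite itself \<Rightarrow> real \<Rightarrow> real" where
  "osc_const' q L Lw K T \<epsilon> = osc_const q L Lw K T
     + L ^ 3 * (2 powr q)\<^sup>2 * A1_const q L Lw (2 * \<bar>K\<bar>) T * (max 1 (ubv T / kmass T) powr q * \<epsilon> powr (- (real CARD('n) * q)))"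

text \<open>The summand \<open>q\<close> stems from dividing by \<open>t' - s\<close> instead of
  \<open>R\<close>, the other one from \<open>(1 / c) ^ CARD('n)\<close> with
  \<open>c = \<epsilon> * \<tau> powr q\<close>, raised to the power \<open>q\<close>.\<close>

definition osc_exp :: "real \<Rightarrow> 'n::finite itself \<Rightarrow> real" where
  "osc_exp q T = q + real CARD('n) * q\<^sup>2"

text \<open>The bound \<open>1 / 2\<close> lets the averaging balls fit between two radii; the other
  bound makes the term to be absorbed at most half of the outer energy. Adding 1 keeps the
  denominator positive even if \<open>osc_const\<close> vanishes.\<close>

definition small_eps :: "real \<Rightarrow> real \<Rightarrow> real \<Rightarrow> real \<Rightarrow> real \<Rightarrow> 'n::finite itself \<Rightarrow> real" where
  "small_eps q L Lw Q K T = min (1 / 2) (1 / (2 * cac_const q L Q * (osc_const q L Lw K T + 1)))"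

text \<open>The first argument of \<open>absorb_const\<close> is the contraction factor left by hole
  filling. The power of 4 comes from the gap \<open>R / 4\<close> between the radii
  \<open>3 * R / 4\<close> and \<open>R\<close> of the iteration.\<close>

definition rev_const :: "real \<Rightarrow> real \<Rightarrow> real \<Rightarrow> real \<Rightarrow> real \<Rightarrow> 'n::finite itself \<Rightarrow> real" where
  "rev_const q L Lw Q K T = absorb_const ((cac_const q L Q + 1 / 2) / (1 + cac_const q L Q)) (osc_exp q T)
     * osc_const' q L Lw K T (small_eps q L Lw Q K T) * 4 powr osc_exp q T"

context quasimin
begin

lemma holder_bound:
  assumes x: "x \<in> ball x0 (2 * r)" and z: "z \<in> ball x0 (2 * r)"
  shows "\<bar>u x - u z\<bar> \<le> \<bar>K\<bar> * dist x z powr \<gamma>"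
proof (cases "x = z")
  case False
  let ?f = "\<lambda>(x, y). \<bar>u x - u y\<bar> / dist x y powr \<gamma>"
  let ?S = "\<lambda>B. {(x, y). x \<in> B \<and> y \<in> B \<and> x \<noteq> y}"
  \<comment> \<open>The supremum defining the seminorm is an upper bound only for a bounded family;
    boundedness is inherited from the larger ball.\<close>
  have "ball x0 (2 * r) \<subseteq> ball x0 (4 * r)" using r_pos by (intro subset_ball) simp
  then have "?f ` ?S (ball x0 (2 * r)) \<subseteq> ?f ` ?S (ball x0 (4 * r))" by (intro image_mono) auto
  then have "bdd_above (?f ` ?S (ball x0 (2 * r)))"
    using holder unfolding holder_on_def by (meson bdd_above_mono)
  then have "?f (x, z) \<le> K"
    unfolding seminorm[symmetric] holder_seminorm_def using x z False by (intro cSUP_upper) auto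
  then have "\<bar>u x - u z\<bar> \<le> K * dist x z powr \<gamma>" using False by (simp add: pos_divide_le_eq)
  also have "\<dots> \<le> \<bar>K\<bar> * dist x z powr \<gamma>" by (intro mult_right_mono) auto
  finally show ?thesis .
qed simp

text \<open>The oscillation relative to the common average is split at \<open>kavg u x l\<close>.
  The small-scale part carries the factor \<open>c = l / R\<close>, which makes its \<psi> small by
  \<open>scale_down1\<close>; the translation part is at most a multiple of the mean gradient. Both
  are measured in units of \<open>R\<close>, and (aDec) passes to units of
  \<open>t' - s\<close>.\<close>

lemma oscillation_bound:
  fixes y R s t \<epsilon> G0
  defines "\<tau> \<equiv> (t - s) / R" and "l \<equiv> \<epsilon> * ((t - s) / R) powr q * R" and "t' \<equiv> (s + t) / 2"
    and "\<psi> \<equiv> phi_minus \<Omega> \<phi> (ball y R)" and "a0 \<equiv> avg (ball y R) (\<lambda>x. norm (Du x))"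
  assumes sub: "ball y R \<subseteq> ball x0 (2 * r)" and st: "0 < s" "s < t" "t < R" and \<epsilon>: "0 < \<epsilon>" "\<epsilon> \<le> 1 / 2"
    and x: "x \<in> cball y t'" and G0: "0 \<le> G0"
    and osc: "\<psi> (\<bar>u x - kavg u x l\<bar> / l) \<le> L ^ 3 * 2 powr q * max 1 (2 * poincare_const TYPE('n)) powr q * (1 + G0)"
  shows "\<phi> x (\<bar>u x - kavg u y l\<bar> / (t' - s)) \<le> osc_const q L Lw K TYPE('n) * \<epsilon> * G0
     + osc_const' q L Lw K TYPE('n) \<epsilon> * \<tau> powr (- osc_exp q TYPE('n)) * (\<psi> a0 + 1)"
proof -
  define n where "n = CARD('n)"
  define k where "k = kavg u y l"
  have R: "0 < R" using st by simp
  have q1: "1 \<le> q" using p_ge_1 p_le_q by simp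
  have \<tau>: "0 < \<tau>" "\<tau> \<le> 1" using st by (auto simp: \<tau>_def)
  \<comment> \<open>The factor \<open>\<tau> powr q\<close> in the scale \<open>l\<close> cancels the loss \<open>\<tau> powr (- q)\<close> from dividing by \<open>t' - s\<close>.\<close>
  define c where "c = \<epsilon> * \<tau> powr q"
  have \<tau>q: "0 < \<tau> powr q" "\<tau> powr q \<le> \<tau>" using \<tau> q1 powr_mono'[of 1 q \<tau>] by auto
  have c: "0 < c" "c \<le> 1" "c \<le> \<tau> / 2"
  proof -
    have "\<epsilon> * \<tau> powr q \<le> 1 / 2 * \<tau>" using \<epsilon> \<tau>q \<tau> by (intro mult_mono) auto
    then show "c \<le> \<tau> / 2" by (simp add: c_def)
    with \<tau> show "c \<le> 1" by simp
    show "0 < c" using \<epsilon> \<tau>q by (simp add: c_def)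
  qed
  have l: "l = c * R" by (simp add: l_def c_def \<tau>_def)
  have l0: "0 < l" using c R by (simp add: l)
  have lt: "t' + l \<le> t"
  proof -
    have "c * R \<le> \<tau> / 2 * R" using c R by (intro mult_right_mono) auto
    also have "\<tau> / 2 * R = (t - s) / 2" using R by (simp add: \<tau>_def)
    finally have "l \<le> (t - s) / 2" by (simp add: l)
    then have "2 * l \<le> t - s" by simp
    then show ?thesis by (simp add: t'_def field_simps)
  qed
  have t't: "t' < t" "s < t'" using st by (auto simp: t'_def)
  have "ball x0 (2 * r) \<subseteq> cball x0 (4 * r)" using r_pos by auto
  then have bO: "ball y R \<subseteq> cball x0 (4 * r)" using sub by blast
  then have RO: "ball y R \<subseteq> \<Omega>" using ball_sub by blast
  have tR: "cball y t \<subseteq> ball y R" using st by (simp add: cball_subset_ball_iff)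
  have tO: "cball y t \<subseteq> \<Omega>" using tR RO by blast
  have cut: "continuous_on (cball y t) u"
  proof (rule continuous_on_subset[OF u_cont])
    have "ball x0 (2 * r) \<subseteq> ball x0 (4 * r)" using r_pos by (intro subset_ball) simp
    then show "cball y t \<subseteq> ball x0 (4 * r)" using tR sub by blast
  qed
  have xt: "x \<in> cball y t" using x t't by auto
  have xR: "x \<in> ball y R" using xt tR by blast
  have xO: "x \<in> \<Omega>" using xR RO by blast
  have ne: "ball y R \<inter> \<Omega> \<noteq> {}" using xR xO by blast
  interpret x: growth p q L "\<phi> x" by (rule growth_at[OF xO])
  interpret m: growth p q L \<psi> unfolding \<psi>_def by (rule growth_phi_minus[OF structure_conds ne])
  have a0: "0 \<le> a0" unfolding a0_def by (rule avg_nonneg) simp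
  define C1 where "C1 = A1_const q L Lw (2 * \<bar>K\<bar>) TYPE('n)"
  define C2 where "C2 = L ^ 3 * 2 powr q * max 1 (2 * poincare_const TYPE('n)) powr q"
  \<comment> \<open>(A1) is applied to the quotient by \<open>R\<close>; the quotient by
    \<open>t' - s\<close> need not lie in its range uniformly in \<open>s\<close> and
    \<open>t\<close>.\<close>
  define w where "w = \<bar>u x - k\<bar> / R"
  have w0: "0 \<le> w" using R by (simp add: w_def)
  have uk: "\<bar>k - u x\<bar> \<le> 2 * \<bar>K\<bar> * R powr \<gamma>"
    unfolding k_def
  proof (rule kavg_close[OF l0])
    have lsub: "cball y l \<subseteq> cball y t"
    proof (rule subset_cball)
      have "0 \<le> t'" using st t't by simp
      then show "l \<le> t" using lt by linarith
    qed
    then show "continuous_on (cball y l) u" using cut by (rule continuous_on_subset[rotated])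
    fix z assume "z \<in> cball y l"
    then have z: "z \<in> ball y R" using lsub tR by blast
    have "dist z x \<le> 2 * R" using z xR dist_triangle[of z x y] by (simp add: dist_commute)
    have "\<bar>u z - u x\<bar> \<le> \<bar>K\<bar> * dist z x powr \<gamma>" using z xR sub by (intro holder_bound) auto
    also have "\<dots> \<le> \<bar>K\<bar> * (2 * R) powr \<gamma>" using \<open>dist z x \<le> 2 * R\<close> \<gamma> by (intro mult_left_mono powr_mono2) auto
    also have "\<dots> = \<bar>K\<bar> * (2 powr \<gamma> * R powr \<gamma>)" by (simp add: powr_mult)
    \<comment> \<open>Estimating \<open>2 powr \<gamma>\<close> by 2 keeps \<gamma> out of the
      constant.\<close>
    also have "\<dots> \<le> \<bar>K\<bar> * (2 * R powr \<gamma>)"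
      using powr_mono[of \<gamma> 1 2] \<gamma> by (intro mult_left_mono mult_right_mono) auto
    finally show "\<bar>u z - u x\<bar> \<le> 2 * \<bar>K\<bar> * R powr \<gamma>" by simp
  qed
  have wR: "w \<le> 2 * \<bar>K\<bar> * R powr (\<gamma> - 1)"
  proof -
    have "R powr (\<gamma> - 1) = R powr \<gamma> / R" using R by (simp add: powr_diff)
    then show ?thesis using uk R by (simp add: w_def divide_right_mono abs_minus_commute)
  qed
  have C1: "0 \<le> C1" unfolding C1_def by (rule A1_const_ge_0[OF Lw_pos])
  have 1: "\<phi> x w \<le> C1 * (\<psi> w + 1)"
    unfolding C1_def \<psi>_def
    by (rule A1_comparison[OF structure_conds \<gamma> A1 Lw_pos R RO xR w0 wR]) simp
  have 2: "\<phi> x (\<bar>u x - k\<bar> / (t' - s)) \<le> L * (2 powr q * \<tau> powr (- q)) * \<phi> x w"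
  proof -
    have "\<bar>u x - k\<bar> / (t' - s) = 2 / \<tau> * w" using st R by (simp add: w_def \<tau>_def t'_def field_simps)
    moreover have "\<phi> x (2 / \<tau> * w) \<le> L * (2 / \<tau>) powr q * \<phi> x w" using \<tau> w0 by (intro x.scale_up) (auto simp: le_divide_eq)
    moreover have "(2 / \<tau>) powr q = 2 powr q * \<tau> powr (- q)" using \<tau> by (simp add: divide_inverse powr_mult powr_minus inverse_powr)
    ultimately show ?thesis by simp
  qed
  define z where "z = \<bar>u x - kavg u x l\<bar> / l"
  define b where "b = \<bar>kavg u x l - k\<bar> / R"
  have z0: "0 \<le> z" and b0: "0 \<le> b" using l0 R by (auto simp: z_def b_def)
  have w_le: "w \<le> c * z + b"
  proof -
    have "\<bar>u x - k\<bar> \<le> \<bar>u x - kavg u x l\<bar> + \<bar>kavg u x l - k\<bar>" by simp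
    then have "w \<le> (\<bar>u x - kavg u x l\<bar> + \<bar>kavg u x l - k\<bar>) / R" unfolding w_def using R by (intro divide_right_mono) auto
    also have "\<dots> = c * z + b" using R c by (simp add: z_def b_def l add_divide_distrib)
    finally show ?thesis .
  qed
  define mk where "mk = max 1 (ubv TYPE('n) / kmass TYPE('n))"
  have mk: "1 \<le> mk" by (simp add: mk_def)
  have b_le: "b \<le> mk * (1 / c) ^ n * a0"
  proof -
    have I: "integrable (lebesgue_on (ball y R)) (\<lambda>x. norm (Du x))" using Du_integrable[OF bO] by simp
    have "\<bar>kavg u x l - kavg u y l\<bar> \<le> dist y x / l ^ n / kmass TYPE('n) * lint (cball y t) (\<lambda>x. norm (Du x))"
      unfolding n_def by (rule kavg_translate[OF wg \<Omega>_sets l0 tO cut]) (use x lt in auto)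
    also have "\<dots> \<le> R / l ^ n / kmass TYPE('n) * lint (ball y R) (\<lambda>x. norm (Du x))"
      using xR l0 kmass_pos[where 'n = 'n] R integral_on_mono_set[OF I tR]
      by (intro mult_mono divide_right_mono) (auto intro!: integral_nonneg_AE)
    also have "lint (ball y R) (\<lambda>x. norm (Du x)) = a0 * (ubv TYPE('n) * R ^ n)"
      using measure_lebesgue_ball[of R y] R ubv_pos[where 'n = 'n, THEN less_imp_neq] by (simp add: a0_def avg_def n_def)
    finally have "b \<le> (R / l ^ n / kmass TYPE('n) * (a0 * (ubv TYPE('n) * R ^ n))) / R"
      unfolding b_def k_def using R by (intro divide_right_mono) auto
    also have "\<dots> = ubv TYPE('n) / kmass TYPE('n) * ((1 / c) ^ n * a0)"
      using R c unfolding l by (simp add: power_mult_distrib power_divide mult.commute)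
    also have "\<dots> \<le> mk * ((1 / c) ^ n * a0)" using a0 c by (intro mult_right_mono) (auto simp: mk_def)
    finally show ?thesis by simp
  qed
  define B where "B = mk * (1 / c) ^ n"
  have B: "1 \<le> B"
  proof -
    have "1 * 1 \<le> mk * (1 / c) ^ n" using mk c by (intro mult_mono one_le_power) auto
    then show ?thesis by (simp add: B_def)
  qed
  have Bq: "B powr q = mk powr q * \<epsilon> powr (- (real n * q)) * \<tau> powr (- (real n * q\<^sup>2))"
  proof -
    have "(1 / c) ^ n = c powr (- real n)" using c by (simp add: powr_minus powr_realpow power_one_over inverse_eq_divide)
    then have "B powr q = mk powr q * c powr (- (real n * q))" unfolding B_def by (simp add: powr_mult powr_powr)
    also have "c powr (- (real n * q)) = \<epsilon> powr (- (real n * q)) * \<tau> powr (- (real n * q\<^sup>2))"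
      unfolding c_def by (simp add: powr_mult powr_powr power2_eq_square mult_ac)
    finally show ?thesis by simp
  qed
  have \<psi>a: "0 \<le> \<psi> a0" by (rule m.nonneg[OF a0])
  have \<psi>b: "\<psi> b \<le> L * B powr q * \<psi> a0"
  proof -
    have "\<psi> b \<le> \<psi> (B * a0)" using b_le b0 by (intro m.mono) (auto simp: B_def)
    also have "\<dots> \<le> L * B powr q * \<psi> a0" by (rule m.scale_up[OF B a0])
    finally show ?thesis .
  qed
  have \<psi>z: "\<psi> (c * z) \<le> L * c * (C2 * (1 + G0))"
  proof -
    have "\<psi> (c * z) \<le> L * c * \<psi> z" using c z0 by (intro m.scale_down1) auto
    also have "\<dots> \<le> L * c * (C2 * (1 + G0))" using osc c L_ge_1 by (intro mult_left_mono) (auto simp: z_def C2_def)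
    finally show ?thesis .
  qed
  have \<psi>w: "\<psi> w \<le> L * 2 powr q * (L * c * (C2 * (1 + G0)) + L * B powr q * \<psi> a0)"
  proof -
    have "\<psi> w \<le> \<psi> (c * z + b)" using w_le w0 by (intro m.mono) auto
    also have "\<dots> \<le> L * 2 powr q * (\<psi> (c * z) + \<psi> b)" using c z0 b0 by (intro m.subadditive) auto
    also have "\<dots> \<le> L * 2 powr q * (L * c * (C2 * (1 + G0)) + L * B powr q * \<psi> a0)"
      using \<psi>z \<psi>b L_ge_1 by (intro mult_left_mono add_mono) auto
    finally show ?thesis .
  qed
  define A where "A = L * 2 powr q"
  have A1': "1 \<le> A"
  proof -
    have "1 * 1 \<le> L * 2 powr q" using L_ge_1 q1 by (intro mult_mono ge_one_powr_ge_zero) auto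
    then show ?thesis by (simp add: A_def)
  qed
  define N where "N = L * 2 powr q * L * B powr q"
  have N1: "1 \<le> N"
  proof -
    have "1 * 1 \<le> (L * 2 powr q) * (L * B powr q)"
    proof (rule mult_mono)
      have "1 * 1 \<le> L * B powr q" using L_ge_1 B q1 by (intro mult_mono ge_one_powr_ge_zero) auto
      then show "1 \<le> L * B powr q" by simp
    qed (use A1' in \<open>auto simp: A_def\<close>)
    then show ?thesis by (simp add: N_def mult_ac)
  qed
  have T1: "1 \<le> \<tau> powr (- osc_exp q TYPE('n))"
  proof -
    have "0 \<le> osc_exp q TYPE('n)" using q1 by (simp add: osc_exp_def)
    then show ?thesis using powr_mono'[of "- osc_exp q TYPE('n)" 0 \<tau>] \<tau> by simp
  qed
  define C4 where "C4 = L ^ 3 * (2 powr q)\<^sup>2 * C1 * C2"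
  have C2: "0 \<le> C2" using L_ge_1 by (simp add: C2_def)
  have C4: "0 \<le> C4" using C1 C2 L_ge_1 by (simp add: C4_def)
  have T: "\<tau> powr (- q) * \<tau> powr (- (real n * q\<^sup>2)) = \<tau> powr (- osc_exp q TYPE('n))"
    by (simp add: osc_exp_def n_def powr_add[symmetric])
  have Tc: "\<tau> powr (- q) * c = \<epsilon>" using \<tau> by (simp add: c_def powr_minus)
  have "\<phi> x (\<bar>u x - k\<bar> / (t' - s)) \<le> L * (2 powr q * \<tau> powr (- q)) * (C1 * (\<psi> w + 1))"
    using 2 1 L_ge_1 by (meson order_trans mult_left_mono mult_nonneg_nonneg powr_ge_zero zero_le_one)
  also have "\<dots> \<le> L * (2 powr q * \<tau> powr (- q)) * (C1 * (L * 2 powr q * (L * c * (C2 * (1 + G0)) + L * B powr q * \<psi> a0) + 1))"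
    using \<psi>w C1 L_ge_1 by (intro mult_left_mono add_mono) auto
  also have "\<dots> = C4 * (\<tau> powr (- q) * c) * (1 + G0) + L * 2 powr q * C1 * \<tau> powr (- q) * (N * \<psi> a0 + 1)"
    unfolding C4_def N_def by (simp add: algebra_simps power3_eq_cube power2_eq_square)
  also have "\<dots> \<le> C4 * \<epsilon> * G0 + C4 * \<epsilon> + L * 2 powr q * C1 * \<tau> powr (- q) * (N * \<psi> a0 + N)"
    unfolding Tc using N1 C1 L_ge_1 by (intro add_mono mult_left_mono) (auto simp: algebra_simps)
  also have "L * 2 powr q * C1 * \<tau> powr (- q) * (N * \<psi> a0 + N)
     = L ^ 3 * (2 powr q)\<^sup>2 * C1 * (mk powr q * \<epsilon> powr (- (real n * q))) * (\<tau> powr (- q) * \<tau> powr (- (real n * q\<^sup>2))) * (\<psi> a0 + 1)"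
    unfolding N_def Bq by (simp add: algebra_simps power3_eq_cube power2_eq_square)
  \<comment> \<open>The leftover \<open>C4 * \<epsilon>\<close> is hidden in the second group, since
    \<epsilon> is below 1 while the negative power of \<tau> and \<open>\<psi> a0 + 1\<close> are at
    least 1.\<close>
  also have "C4 * \<epsilon> * G0 + C4 * \<epsilon> + \<dots> \<le> C4 * \<epsilon> * G0 + C4 * \<tau> powr (- osc_exp q TYPE('n)) * (\<psi> a0 + 1) + \<dots>"
  proof -
    have "1 * 1 \<le> \<tau> powr (- osc_exp q TYPE('n)) * (\<psi> a0 + 1)" using T1 \<psi>a by (intro mult_mono) auto
    then have "C4 * \<epsilon> \<le> C4 * (\<tau> powr (- osc_exp q TYPE('n)) * (\<psi> a0 + 1))"
      using \<epsilon> C4 by (intro mult_left_mono) auto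
    then show ?thesis by (simp add: mult_ac)
  qed
  also have "\<dots> = osc_const q L Lw K TYPE('n) * \<epsilon> * G0
     + osc_const' q L Lw K TYPE('n) \<epsilon> * \<tau> powr (- osc_exp q TYPE('n)) * (\<psi> a0 + 1)"
    unfolding T unfolding osc_const_def osc_const'_def C4_def C1_def C2_def mk_def n_def by (simp add: algebra_simps)
  finally show ?thesis unfolding k_def .
qed

lemma cac_const_ge_1: "1 \<le> cac_const q L Q"
proof -
  have "1 * 1 \<le> L\<^sup>2 * 8 powr q" using L_ge_1 p_ge_1 p_le_q by (intro mult_mono ge_one_powr_ge_zero) auto
  then have "1 * 1 \<le> Q * (L\<^sup>2 * 8 powr q)" using Q_ge_1 by (intro mult_mono) auto
  then show ?thesis by (simp add: cac_const_def mult_ac)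
qed

lemma osc_const_nonneg: "0 \<le> osc_const q L Lw K TYPE('n)"
  unfolding osc_const_def using L_ge_1 A1_const_ge_0[OF Lw_pos, of q L "2 * \<bar>K\<bar>"] by (intro mult_nonneg_nonneg) auto

lemma osc_const'_nonneg: "0 \<le> osc_const' q L Lw K TYPE('n) \<epsilon>"
  unfolding osc_const'_def using L_ge_1 A1_const_ge_0[OF Lw_pos, of q L "2 * \<bar>K\<bar>"] osc_const_nonneg
  by (intro add_nonneg_nonneg mult_nonneg_nonneg) auto

lemma rev_const_nonneg: "0 \<le> rev_const q L Lw Q K TYPE('n)"
proof -
  have "0 \<le> absorb_const ((cac_const q L Q + 1 / 2) / (1 + cac_const q L Q)) (osc_exp q TYPE('n))"
    using cac_const_ge_1 by (intro absorb_const_nonneg) auto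
  then show ?thesis unfolding rev_const_def using osc_const'_nonneg by simp
qed

text \<open>Comparing the energies \<open>Z s\<close> and \<open>Z t\<close> on two concentric balls
  gives a factor below 1 in front of the larger one, and \<open>absorb_iteration\<close> removes
  that term. The fraction \<open>3 / 4\<close> is what \<open>avg_G_bound\<close> needs to pass from
  \<open>2 * r\<close> to \<open>3 * r / 2\<close>.\<close>

lemma energy_bound:
  assumes sub: "ball y R \<subseteq> ball x0 (2 * r)" and R: "0 < R"
  shows "lint (cball y (3 * R / 4)) g \<le> rev_const q L Lw Q K TYPE('n) * (ubv TYPE('n) * R ^ CARD('n))
     * (phi_minus \<Omega> \<phi> (ball y R) (avg (ball y R) (\<lambda>x. norm (Du x))) + 1)"
proof -
  define \<psi> where "\<psi> = phi_minus \<Omega> \<phi> (ball y R)"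
  define a0 where "a0 = avg (ball y R) (\<lambda>x. norm (Du x))"
  define C0 where "C0 = cac_const q L Q"
  define C4 where "C4 = osc_const q L Lw K TYPE('n)"
  define \<epsilon> where "\<epsilon> = small_eps q L Lw Q K TYPE('n)"
  define C5 where "C5 = osc_const' q L Lw K TYPE('n) \<epsilon>"
  define e where "e = osc_exp q TYPE('n)"
  define \<theta> where "\<theta> = (C0 + 1 / 2) / (1 + C0)"
  define V where "V = ubv TYPE('n)"
  have V: "0 < V" unfolding V_def by (rule ubv_pos)
  have C0: "1 \<le> C0" unfolding C0_def by (rule cac_const_ge_1)
  have C4: "0 \<le> C4" unfolding C4_def by (rule osc_const_nonneg)
  have C5: "0 \<le> C5" unfolding C5_def by (rule osc_const'_nonneg)
  have q1: "1 \<le> q" using p_ge_1 p_le_q by simp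
  have e: "0 < e" using q1 by (simp add: e_def osc_exp_def add_pos_nonneg)
  have \<epsilon>: "0 < \<epsilon>" "\<epsilon> \<le> 1 / 2" "C0 * C4 * \<epsilon> \<le> 1 / 2"
  proof -
    have pos: "0 < 2 * C0 * (C4 + 1)" using C0 C4 by (intro mult_pos_pos) auto
    have eps: "\<epsilon> = min (1 / 2) (1 / (2 * C0 * (C4 + 1)))" by (simp add: \<epsilon>_def small_eps_def C0_def C4_def)
    show "0 < \<epsilon>" "\<epsilon> \<le> 1 / 2" using pos by (auto simp: eps)
    have "C0 * (C4 + 1) * \<epsilon> \<le> C0 * (C4 + 1) * (1 / (2 * C0 * (C4 + 1)))"
      using C0 C4 by (intro mult_left_mono) (auto simp: eps)
    also have "\<dots> = 1 / 2"
    proof -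
      have "a * b * (1 / (2 * a * b)) = 1 / 2" if "a \<noteq> 0" "b \<noteq> 0" for a b :: real using that by simp
      from this[of C0 "C4 + 1"] show ?thesis using C0 C4 by simp
    qed
    finally have "C0 * (C4 + 1) * \<epsilon> \<le> 1 / 2" .
    moreover have "C0 * C4 * \<epsilon> \<le> C0 * (C4 + 1) * \<epsilon>"
      using \<open>0 < \<epsilon>\<close> C0 by (intro mult_right_mono mult_left_mono) auto
    ultimately show "C0 * C4 * \<epsilon> \<le> 1 / 2" by linarith
  qed
  have \<theta>: "0 \<le> \<theta>" "\<theta> < 1" using C0 by (auto simp: \<theta>_def)
  have "ball x0 (2 * r) \<subseteq> cball x0 (4 * r)" using r_pos by auto
  then have bO: "ball y R \<subseteq> cball x0 (4 * r)" using sub by blast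
  then have RO: "ball y R \<subseteq> \<Omega>" using ball_sub by blast
  have b24: "ball x0 (2 * r) \<subseteq> ball x0 (4 * r)" using r_pos by (intro subset_ball) simp
  have y: "y \<in> ball y R \<inter> \<Omega>" using R RO by auto
  then have ne: "ball y R \<inter> \<Omega> \<noteq> {}" by blast
  interpret m: growth p q L \<psi> unfolding \<psi>_def by (rule growth_phi_minus[OF structure_conds ne])
  have a0: "0 \<le> a0" unfolding a0_def by (rule avg_nonneg) simp
  have \<psi>a: "0 \<le> \<psi> a0" by (rule m.nonneg[OF a0])
  define Z where "Z = (\<lambda>s. lint (cball y s) g)"
  have cR: "cball y s \<subseteq> ball y R" if "s < R" for s using that by auto
  have gI: "integrable (lebesgue_on (cball y s)) g" if "s < R" for s
    by (rule g_integrable) (use cR[OF that] bO in auto)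
  have g0: "0 \<le> g x" if "x \<in> ball y R" for x using that RO g_nonneg by auto
  have Zmono: "Z s \<le> Z t" if "s \<le> t" "t < R" for s t
    unfolding Z_def by (rule integral_on_mono_set[OF gI[OF that(2)] subset_cball[OF that(1)]]) (use g0 cR[OF that(2)] in auto)
  have "Z (3 * R / 4) \<le> absorb_const \<theta> e * (C5 * (V * R ^ CARD('n)) * (\<psi> a0 + 1) * R powr e) / (R - 3 * R / 4) powr e"
  proof (rule absorb_iteration[OF _ _ \<theta> e])
    show "3 * R / 4 < R" using R by simp
    fix s assume s: "3 * R / 4 \<le> s" "s < R"
    show "0 \<le> Z s" unfolding Z_def using g0 cR[OF s(2)] by (intro integral_nonneg_AE AE_I2) auto
    show "Z s \<le> lint (ball y R) g"
      unfolding Z_def by (rule integral_on_mono_set[OF g_integrable[OF bO] cR[OF s(2)]]) (use g0 in auto)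
  next
    fix s t assume st: "3 * R / 4 \<le> s" "s < t" "t < R"
    define \<tau> where "\<tau> = (t - s) / R"
    define l where "l = \<epsilon> * \<tau> powr q * R"
    \<comment> \<open>Half of the gap is spent on the cutoff between \<open>s\<close> and
      \<open>t'\<close>, the other half leaves room for averaging balls of radius
      \<open>l\<close>.\<close>
    define t' where "t' = (s + t) / 2"
    have s0: "0 < s" using st R by simp
    have \<tau>: "0 < \<tau>" "\<tau> \<le> 1" using st R s0 by (auto simp: \<tau>_def)
    have l0: "0 < l" using \<epsilon> \<tau> R by (simp add: l_def)
    have t't: "t' < t" "s < t'" "t' < R" using st by (auto simp: t'_def)
    have lt: "t' + l \<le> t"
    proof -
      have "\<tau> powr q \<le> \<tau>" using \<tau> q1 powr_mono'[of 1 q \<tau>] by auto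
      then have "\<epsilon> * \<tau> powr q * R \<le> 1 / 2 * \<tau> * R" using \<epsilon> \<tau> R by (intro mult_right_mono mult_mono) auto
      also have "1 / 2 * \<tau> * R = (t - s) / 2" using R by (simp add: \<tau>_def)
      finally have "2 * l \<le> t - s" by (simp add: l_def)
      then show ?thesis by (simp add: t'_def field_simps)
    qed
    have tO: "cball y t \<subseteq> \<Omega>" using cR[OF st(3)] RO by blast
    have tB: "cball y t \<subseteq> ball x0 (4 * r)" using cR[OF st(3)] sub b24 by blast
    have t'B: "cball y t' \<subseteq> ball x0 (4 * r)" using tB t't by (meson less_imp_le order_trans subset_cball)
    have cut: "continuous_on (cball y t) u" using u_cont tB by (rule continuous_on_subset)
    have \<psi>g: "0 \<le> \<psi> (norm (Du x))" "\<psi> (norm (Du x)) \<le> g x" if "x \<in> cball y t" for x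
    proof -
      show "0 \<le> \<psi> (norm (Du x))" by (rule m.nonneg) simp
      have "x \<in> ball y R" "x \<in> \<Omega>" using that cR[OF st(3)] tO by auto
      then show "\<psi> (norm (Du x)) \<le> g x" unfolding \<psi>_def g_def by (intro phi_minus_le[OF Phi]) auto
    qed
    have \<psi>I: "integrable (lebesgue_on (cball y t)) (\<lambda>x. \<psi> (norm (Du x)))"
    proof (rule Bochner_Integration.integrable_bound[OF gI[OF st(3)]])
      \<comment> \<open>\<psi> is known to be monotone only on the nonnegative reals; truncating its
        argument gives a monotone, hence Borel, function on the whole line.\<close>
      have "mono (\<lambda>t. \<psi> (max 0 t))" by (intro monoI m.mono) auto
      then have "(\<lambda>t. \<psi> (max 0 t)) \<in> borel_measurable borel" by (rule borel_measurable_mono)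
      moreover have "(\<lambda>x. norm (Du x)) \<in> borel_measurable (lebesgue_on (cball y t))"
        using Du_integrable[of "cball y t"] cR[OF st(3)] bO by (intro borel_measurable_norm borel_measurable_integrable) auto
      ultimately have "(\<lambda>x. \<psi> (max 0 (norm (Du x)))) \<in> borel_measurable (lebesgue_on (cball y t))"
        by (rule measurable_compose[rotated])
      then show "(\<lambda>x. \<psi> (norm (Du x))) \<in> borel_measurable (lebesgue_on (cball y t))" by simp
      show "AE x in lebesgue_on (cball y t). norm (\<psi> (norm (Du x))) \<le> norm (g x)"
        using \<psi>g by (intro AE_I2) force
    qed
    obtain G where G: "integrable (lebesgue_on (cball y t')) G" 
      "lint (cball y t') G \<le> lint (cball y t) (\<lambda>x. \<psi> (norm (Du x)))"
      "\<And>x. x \<in> cball y t' \<Longrightarrow> 0 \<le> G x"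
      "\<And>x. x \<in> cball y t' \<Longrightarrow> \<psi> (\<bar>u x - kavg u x l\<bar> / l) \<le> L ^ 3 * 2 powr q * max 1 (2 * poincare_const TYPE('n)) powr q * (1 + G x)"
      using modular_poincare[OF m.growth_axioms wg \<Omega>_sets tO cut l0 lt \<psi>I] by blast
    have GZ: "lint (cball y t') G \<le> Z t"
      using G(2) integral_mono[OF \<psi>I gI[OF st(3)]] \<psi>g(2) by (force simp: Z_def)
    define h where "h = (\<lambda>x. \<phi> x (\<bar>u x - kavg u y l\<bar> / (t' - s)))"
    note cac = caccioppoli[OF less_imp_le[OF s0] t't(2) t'B, of "kavg u y l", folded h_def]
    define D where "D = C5 * \<tau> powr (- e) * (\<psi> a0 + 1)"
    have D: "0 \<le> D" using C5 \<psi>a by (simp add: D_def)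
    have hle: "h x \<le> C4 * \<epsilon> * G x + D" if "x \<in> cball y t'" for x
      unfolding h_def C4_def D_def C5_def e_def \<tau>_def l_def \<psi>_def a0_def
      using oscillation_bound[OF sub s0 st(2,3) \<epsilon>(1,2), of x "G x"] that G(3,4)[OF that]
      unfolding \<psi>_def l_def \<tau>_def t'_def by simp
    have H: "lint (cball y t') h \<le> C4 * \<epsilon> * Z t + D * (V * R ^ CARD('n))"
    proof -
      have Ic: "integrable (lebesgue_on (cball y t')) (\<lambda>x. D)" by (intro integrable_const_lmeasurable) simp
      have "lint (cball y t') h \<le> lint (cball y t') (\<lambda>x. C4 * \<epsilon> * G x + D)"
        using cac(1) G(1) Ic hle by (intro integral_mono) auto
      also have "\<dots> = C4 * \<epsilon> * lint (cball y t') G + measure lebesgue (cball y t') * D"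
        using G(1) Ic integral_const_on[of "cball y t'" D] by simp
      also have "\<dots> \<le> C4 * \<epsilon> * Z t + (V * R ^ CARD('n)) * D"
      proof (intro add_mono mult_left_mono mult_right_mono GZ)
        have "t' ^ CARD('n) \<le> R ^ CARD('n)" using t't s0 by (intro power_mono) auto
        then show "measure lebesgue (cball y t') \<le> V * R ^ CARD('n)"
          using measure_lebesgue_cball[of t' y] t't s0 V by (simp add: V_def)
      qed (use C4 \<epsilon> D in auto)
      finally show ?thesis by (simp add: mult_ac)
    qed
    define W where "W = V * R ^ CARD('n)"
    have W: "0 \<le> W" using V R by (simp add: W_def)
    have Zt0: "0 \<le> Z t" unfolding Z_def using g0 cR[OF st(3)] by (intro integral_nonneg_AE AE_I2) auto
    have "Z s \<le> Z t'" using t't by (intro Zmono) auto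
    also have "Z t' \<le> C0 * (Z t' - Z s + lint (cball y t') h)"
      using cac(2) by (simp add: C0_def cac_const_def Z_def)
    also have "\<dots> \<le> C0 * (Z t - Z s + (C4 * \<epsilon> * Z t + D * W))"
      using H Zmono[of t' t] t't st C0 by (intro mult_left_mono) (auto simp: W_def)
    also have "\<dots> = C0 * Z t - C0 * Z s + C0 * C4 * \<epsilon> * Z t + C0 * (D * W)" by (simp add: algebra_simps)
    also have "\<dots> \<le> C0 * Z t - C0 * Z s + 1 / 2 * Z t + (1 + C0) * (D * W)"
      using \<epsilon>(3) Zt0 D W C0 by (intro add_mono mult_right_mono) auto
    \<comment> \<open>Hole filling: \<open>C0 * Z s\<close> has moved to the left. The ratio of the
      coefficients is \<theta>, below 1 because the choice of \<epsilon> adds only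
      \<open>1 / 2\<close> to \<open>C0\<close>.\<close>
    finally have "(1 + C0) * Z s \<le> (C0 + 1 / 2) * Z t + (1 + C0) * (D * W)" by (simp add: algebra_simps)
    then have "Z s \<le> ((C0 + 1 / 2) * Z t + (1 + C0) * (D * W)) / (1 + C0)" using C0 by (simp add: pos_le_divide_eq mult.commute)
    also have "\<dots> = \<theta> * Z t + D * W" 
    proof -
      have "(A * z + B * w) / B = A / B * z + w" if "B \<noteq> 0" for A B z w :: real
        using that by (simp add: add_divide_distrib)
      from this[of "1 + C0"] show ?thesis using C0 unfolding \<theta>_def by simp
    qed
    also have "D * W = C5 * (V * R ^ CARD('n)) * (\<psi> a0 + 1) * R powr e / (t - s) powr e"
    proof -
      have "\<tau> powr (- e) = R powr e / (t - s) powr e"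
        using st R by (simp add: \<tau>_def powr_minus powr_divide)
      then show ?thesis by (simp add: D_def W_def)
    qed
    finally show "Z s \<le> \<theta> * Z t + C5 * (V * R ^ CARD('n)) * (\<psi> a0 + 1) * R powr e / (t - s) powr e" .
  qed
  also have "\<dots> = absorb_const \<theta> e * C5 * 4 powr e * (V * R ^ CARD('n)) * (\<psi> a0 + 1)"
  proof -
    have "(R - 3 * R / 4) powr e = (R / 4) powr e" by simp
    also have "\<dots> = R powr e / 4 powr e" by (rule powr_divide)
    finally show ?thesis using R by simp
  qed
  finally show ?thesis
    by (simp add: Z_def rev_const_def \<theta>_def C0_def e_def C5_def \<epsilon>_def V_def \<psi>_def a0_def)
qed

end

subsection \<open>Gehring's lemma\<close>

lemma emeasure_UN_countable_le:
  assumes X: "\<And>i. i \<in> I \<Longrightarrow> X i \<in> sets M" and I: "countable I"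
  shows "emeasure M (\<Union>i\<in>I. X i) \<le> (\<integral>\<^sup>+i. emeasure M (X i) \<partial>count_space I)"
proof -
  have U: "(\<Union>i\<in>I. X i) \<in> sets M" using X I by (intro sets.countable_UN') auto
  have "emeasure M (\<Union>i\<in>I. X i) = (\<integral>\<^sup>+x. indicator (\<Union>i\<in>I. X i) x \<partial>M)" using U by simp
  also have "\<dots> \<le> (\<integral>\<^sup>+x. (\<integral>\<^sup>+i. indicator (X i) x \<partial>count_space I) \<partial>M)"
  proof (rule nn_integral_mono)
    fix x
    show "(indicator (\<Union>i\<in>I. X i) x :: ennreal) \<le> (\<integral>\<^sup>+i. indicator (X i) x \<partial>count_space I)"
    proof (cases "x \<in> (\<Union>i\<in>I. X i)")
      case True
      then obtain j where j: "j \<in> I" "x \<in> X j" by auto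
      have "(1 :: ennreal) = (\<integral>\<^sup>+i. indicator {j} i \<partial>count_space I)" using j by simp
      also have "\<dots> \<le> (\<integral>\<^sup>+i. indicator (X i) x \<partial>count_space I)"
        using j by (intro nn_integral_mono) (auto simp: indicator_def)
      finally show ?thesis using True by simp
    qed simp
  qed
  also have "\<dots> = (\<integral>\<^sup>+i. (\<integral>\<^sup>+x. indicator (X i) x \<partial>M) \<partial>count_space I)"
    using I X by (intro nn_integral_count_space_nn_integral) auto
  also have "\<dots> = (\<integral>\<^sup>+i. emeasure M (X i) \<partial>count_space I)"
    using X by (intro nn_integral_cong) auto
  finally show ?thesis .
qed

lemma emeasure_lebesgue_cball:
  "0 \<le> r \<Longrightarrow> emeasure lebesgue (cball (c :: real ^ 'n) r) = ennreal (ubv TYPE('n) * r ^ CARD('n))"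
  by (simp add: emeasure_cball)

lemma emeasure_density_integral_on:
  fixes f :: "real ^ 'n \<Rightarrow> real"
  assumes "f \<in> borel_measurable lebesgue" "integrable (lebesgue_on S) f" "S \<in> sets lebesgue" "\<And>x. x \<in> S \<Longrightarrow> 0 \<le> f x"
  shows "emeasure (density lebesgue f) S = ennreal (lint S f)"
  using assms nn_set_integral_eq_integral_on[of S f] by (subst emeasure_density) auto

text \<open>The superlevel set at height \<open>k\<close> of the maximal function over centred balls
  of radius below \<delta>.\<close>

definition heavy :: "(real ^ 'n \<Rightarrow> real) \<Rightarrow> real \<Rightarrow> real \<Rightarrow> (real ^ 'n) set" where
  "heavy f k \<delta> = {x. \<exists>\<rho>. 0 < \<rho> \<and> \<rho> < \<delta> \<and> k * (ubv TYPE('n) * \<rho> ^ CARD('n)) < lint (cball x \<rho>) f}"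

lemma integrable_on_if_integrable:
  fixes f :: "real ^ 'n \<Rightarrow> real"
  shows "integrable lebesgue f \<Longrightarrow> S \<in> sets lebesgue \<Longrightarrow> integrable (lebesgue_on S) f"
  using integrable_on_subset_lebesgue[of UNIV f S] by (simp add: lebesgue_on_UNIV_eq)

text \<open>The inequality is strict, so it survives a slight increase of the radius on its left
  side, and the larger ball around a nearby point still contains the original one.\<close>

lemma open_heavy:
  fixes f :: "real ^ 'n \<Rightarrow> real"
  assumes f: "integrable lebesgue f" "\<And>x. 0 \<le> f x"
  shows "open (heavy f k \<delta>)"
  unfolding open_dist
proof
  fix x assume "x \<in> heavy f k \<delta>"
  then obtain \<rho> where \<rho>: "0 < \<rho>" "\<rho> < \<delta>" "k * (ubv TYPE('n) * \<rho> ^ CARD('n)) < lint (cball x \<rho>) f"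
    by (auto simp: heavy_def)
  have "((\<lambda>r. k * (ubv TYPE('n) * r ^ CARD('n))) \<longlongrightarrow> k * (ubv TYPE('n) * \<rho> ^ CARD('n))) (at_right \<rho>)"
    by (intro tendsto_intros)
  then have "eventually (\<lambda>r. k * (ubv TYPE('n) * r ^ CARD('n)) < lint (cball x \<rho>) f) (at_right \<rho>)"
    using \<rho>(3) by (rule order_tendstoD)
  moreover have "eventually (\<lambda>r. \<rho> < r \<and> r < \<delta>) (at_right \<rho>)"
    using \<rho>(2) unfolding eventually_at_right_field by auto
  ultimately have "eventually (\<lambda>r. k * (ubv TYPE('n) * r ^ CARD('n)) < lint (cball x \<rho>) f \<and> \<rho> < r \<and> r < \<delta>) (at_right \<rho>)"
    by (rule eventually_conj)
  then obtain r where r: "k * (ubv TYPE('n) * r ^ CARD('n)) < lint (cball x \<rho>) f" "\<rho> < r" "r < \<delta>"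
    using eventually_happens[of _ "at_right \<rho>"] by auto
  show "\<exists>e>0. \<forall>z. dist z x < e \<longrightarrow> z \<in> heavy f k \<delta>"
  proof (intro exI[of _ "r - \<rho>"] conjI allI impI)
    fix z assume z: "dist z x < r - \<rho>"
    have "cball x \<rho> \<subseteq> cball z r" using z by (simp add: cball_subset_cball_iff dist_commute)
    then have "lint (cball x \<rho>) f \<le> lint (cball z r) f"
      using f by (intro integral_on_mono_set integrable_on_if_integrable) auto
    then have "k * (ubv TYPE('n) * r ^ CARD('n)) < lint (cball z r) f" using r by simp
    then show "z \<in> heavy f k \<delta>" using r \<rho> by (auto simp: heavy_def intro!: exI[of _ r])
  qed (use r in auto)
qed

lemma superlevel_lmeasurable:
  fixes f :: "real ^ 'n \<Rightarrow> real"
  assumes f: "integrable lebesgue f" "\<And>x. 0 \<le> f x" and k: "0 < k"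
  shows "{x. k \<le> f x} \<in> lmeasurable"
proof (rule fmeasurableI)
  have [measurable]: "f \<in> borel_measurable lebesgue" using f by auto
  have "{x \<in> space lebesgue. k \<le> f x} \<in> sets lebesgue" by measurable
  then show m: "{x. k \<le> f x} \<in> sets lebesgue" by simp
  have "ennreal k * emeasure lebesgue {x. k \<le> f x} = (\<integral>\<^sup>+x. ennreal k * indicator {x. k \<le> f x} x \<partial>lebesgue)"
    using m by (simp add: nn_integral_cmult_indicator)
  also have "\<dots> \<le> (\<integral>\<^sup>+x. ennreal (f x) \<partial>lebesgue)"
    by (intro nn_integral_mono) (auto simp: indicator_def intro!: ennreal_leI)
  also have "\<dots> < \<infinity>" using f by (simp add: nn_integral_eq_integral)
  finally show "emeasure lebesgue {x. k \<le> f x} < \<infinity>" using k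
    by (auto simp: ennreal_mult_less_top)
qed

text \<open>This replaces Lebesgue's differentiation theorem and follows directly from Vitali's covering theorem.\<close>

lemma negligible_superlevel_minus_heavy:
  fixes f :: "real ^ 'n \<Rightarrow> real"
  assumes f: "integrable lebesgue f" "\<And>x. 0 \<le> f x" and k: "0 < k" and \<delta>: "0 < \<delta>"
  shows "negligible ({x. k < f x} - heavy f k \<delta>)"
proof -
  have neg: "negligible ({x. k' \<le> f x} - heavy f k \<delta>)" if k': "k < k'" for k'
  proof -
    define E where "E = {x. k' \<le> f x} - heavy f k \<delta>"
    have E: "E \<in> lmeasurable" unfolding E_def
      using superlevel_lmeasurable[OF f, of k'] open_heavy[OF f, of k \<delta>] k k'
      by (intro fmeasurable_Diff) (auto simp: borel_open)
    then have Es: "E \<in> sets lebesgue" by (rule fmeasurableD)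
    define m where "m = measure lebesgue E"
    have emE: "emeasure lebesgue E = ennreal m" using E by (simp add: m_def emeasure_eq_measure2)
    have m0: "0 \<le> m" by (simp add: m_def)
    have [measurable]: "f \<in> borel_measurable lebesgue" using f by auto
    let ?N = "density lebesgue (\<lambda>x. ennreal (f x))"
    \<comment> \<open>\<open>E\<close> lies in an open \<open>T\<close> of slightly larger measure.
      Small balls centred at points that are not heavy carry at most \<open>k\<close> times their
      volume, and disjoint ones inside \<open>T\<close> cover \<open>E\<close> up to a null set;
      hence \<open>k' * m \<le> k * (m + e)\<close>.\<close>
    have "(k' - k) * m \<le> k * e" if e: "0 < e" for e
    proof -
      obtain T where T: "open T" "E \<subseteq> T" "T - E \<in> lmeasurable" "emeasure lebesgue (T - E) < ennreal e"
        by (rule sets_lebesgue_outer_open[OF Es e])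
      have Ts: "T \<in> sets lebesgue" using T(1) by (simp add: borel_open)
      define I where "I = {(x, \<rho>). x \<in> E \<and> 0 < \<rho> \<and> \<rho> < \<delta> \<and> cball x \<rho> \<subseteq> T}"
      obtain C where C: "countable C" "C \<subseteq> I" "pairwise (\<lambda>i j. disjnt (cball (fst i) (snd i)) (cball (fst j) (snd j))) C"
         "negligible (E - (\<Union>i\<in>C. cball (fst i) (snd i)))"
      proof (rule Vitali_covering_theorem_cballs[of I snd E fst])
        fix x d assume x: "x \<in> E" and d: "0 < (d :: real)"
        obtain e where e: "0 < e" "cball x e \<subseteq> T" using T(1,2) x by (meson open_contains_cball subsetD)
        define \<rho> where "\<rho> = min e (min (\<delta> / 2) (d / 2))"
        have "0 < \<rho>" "\<rho> \<le> e" "\<rho> < \<delta>" "\<rho> < d" using e d \<delta> by (auto simp: \<rho>_def)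
        then have "(x, \<rho>) \<in> I" using e(2) x subset_cball[of \<rho> e x] by (auto simp: I_def)
        then show "\<exists>i. i \<in> I \<and> x \<in> cball (fst i) (snd i) \<and> snd i < d" using \<open>0 < \<rho>\<close> \<open>\<rho> < d\<close>
          by (intro exI[of _ "(x, \<rho>)"]) auto
      next
        show "\<And>i. i \<in> I \<Longrightarrow> 0 < snd i" by (auto simp: I_def)
      qed (rule that)
      define U where "U = (\<Union>i\<in>C. cball (fst i) (snd i))"
      have Us: "U \<in> sets lebesgue" unfolding U_def using C(1) by (intro sets.countable_UN') auto
      have disj: "disjoint_family_on (\<lambda>i. cball (fst i) (snd i)) C"
        using C(3) by (auto simp: disjoint_family_on_def pairwise_def disjnt_def)
      have UT: "U \<subseteq> T" unfolding U_def
      proof (rule UN_least)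
        fix i assume "i \<in> C"
        then have "i \<in> I" using C(2) by blast
        then show "cball (fst i) (snd i) \<subseteq> T" by (auto simp: I_def)
      qed
      have "ennreal (k' * m) = ennreal k' * emeasure lebesgue E" using k k' emE by (simp add: ennreal_mult')
      also have "\<dots> = (\<integral>\<^sup>+x. ennreal k' * indicator E x \<partial>lebesgue)" using Es by (simp add: nn_integral_cmult_indicator)
      also have "\<dots> \<le> (\<integral>\<^sup>+x. ennreal (f x) * indicator U x \<partial>lebesgue)"
      proof (rule nn_integral_mono_AE)
        have "AE x in lebesgue. x \<notin> E - U"
          using C(4) unfolding U_def[symmetric] negligible_iff_null_sets by (rule AE_not_in)
        then show "AE x in lebesgue. ennreal k' * indicator E x \<le> ennreal (f x) * indicator U x"
          by (rule eventually_mono) (auto simp: indicator_def E_def intro!: ennreal_leI)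
      qed
      also have "\<dots> = emeasure ?N U" using Us by (simp add: emeasure_density)
      also have "\<dots> = (\<integral>\<^sup>+i. emeasure ?N (cball (fst i) (snd i)) \<partial>count_space C)"
        unfolding U_def by (rule emeasure_UN_countable[OF _ C(1) disj]) simp
      also have "\<dots> \<le> (\<integral>\<^sup>+i. ennreal k * emeasure lebesgue (cball (fst i) (snd i)) \<partial>count_space C)"
      proof (rule nn_integral_mono)
        fix i assume "i \<in> space (count_space C)"
        then have i: "fst i \<notin> heavy f k \<delta>" "0 < snd i" "snd i < \<delta>" using C(2) by (auto simp: I_def E_def)
        then have "lint (cball (fst i) (snd i)) f \<le> k * (ubv TYPE('n) * snd i ^ CARD('n))"
          unfolding heavy_def by force
        then show "emeasure ?N (cball (fst i) (snd i)) \<le> ennreal k * emeasure lebesgue (cball (fst i) (snd i))"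
          using f i k integrable_on_if_integrable[OF f(1)] emeasure_lebesgue_cball[of "snd i" "fst i"] ubv_pos[where 'n = 'n]
          by (subst emeasure_density_integral_on) (auto simp: ennreal_mult'[symmetric] intro!: ennreal_leI)
      qed
      also have "\<dots> = ennreal k * (\<integral>\<^sup>+i. emeasure lebesgue (cball (fst i) (snd i)) \<partial>count_space C)"
        by (rule nn_integral_cmult) simp
      also have "(\<integral>\<^sup>+i. emeasure lebesgue (cball (fst i) (snd i)) \<partial>count_space C) = emeasure lebesgue U"
        unfolding U_def by (rule emeasure_UN_countable[OF _ C(1) disj, symmetric]) simp
      also have "emeasure lebesgue U \<le> emeasure lebesgue T" by (rule emeasure_mono[OF UT Ts])
      also have "emeasure lebesgue T = emeasure lebesgue (E \<union> (T - E))" using T(2) by (simp add: Un_absorb1)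
      also have "\<dots> \<le> emeasure lebesgue E + emeasure lebesgue (T - E)"
        by (rule emeasure_subadditive) (use Es Ts in auto)
      also have "\<dots> \<le> ennreal m + ennreal e" using emE T(4) by (intro add_mono) auto
      finally have "ennreal (k' * m) \<le> ennreal (k * (m + e))"
        using k m0 e by (simp add: ennreal_mult' ennreal_plus mult_left_mono)
      then have "k' * m \<le> k * (m + e)" using k m0 e by (subst (asm) ennreal_le_iff) auto
      then show ?thesis by (simp add: algebra_simps)
    qed
    then have "\<And>e. 0 < e \<Longrightarrow> (k' - k) * m / k \<le> 0 + e" using k by (simp add: pos_divide_le_eq mult.commute)
    then have "(k' - k) * m / k \<le> 0" by (rule field_le_epsilon)
    then have "m = 0" using k k' m0 by (simp add: divide_le_0_iff mult_le_0_iff)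
    then show ?thesis using emE Es unfolding E_def[symmetric] by (simp add: negligible_iff_null_sets null_sets_def)
  qed
  have "negligible (\<Union>j::nat. {x. k + 1 / Suc j \<le> f x} - heavy f k \<delta>)"
    by (rule negligible_countable_Union) (auto intro!: neg)
  moreover have "{x. k < f x} - heavy f k \<delta> \<subseteq> (\<Union>j::nat. {x. k + 1 / Suc j \<le> f x} - heavy f k \<delta>)"
  proof
    fix x assume x: "x \<in> {x. k < f x} - heavy f k \<delta>"
    then obtain j where "inverse (real (Suc j)) < f x - k" using reals_Archimedean[of "f x - k"] by auto
    then have "k + 1 / Suc j \<le> f x" by (simp add: inverse_eq_divide)
    then show "x \<in> (\<Union>j::nat. {x. k + 1 / Suc j \<le> f x} - heavy f k \<delta>)" using x by blast
  qed
  ultimately show ?thesis by (rule negligible_subset)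
qed

text \<open>A stopping argument: at radius \<open>rad x\<close> the average of \<open>f\<close>
  exceeds \<open>k\<close>, at \<open>10 * rad x\<close> it does not. The reverse Hoelder inequality
  carries the lower bound over to \<open>f powr (1 / p)\<close> at radius \<open>2 * rad x\<close>,
  and points with \<open>f x \<le> \<kappa> * k\<close> account for at most half of it. So the mass
  on a large ball is paid for by the high values on the small one, and the small ones are
  disjoint.\<close>

lemma superlevel_estimate:
  fixes f :: "real ^ 'n \<Rightarrow> real"
  assumes p: "1 < p" and A: "1 \<le> A" and f: "integrable lebesgue f" "\<And>x. 0 \<le> f x"
    and h: "integrable (lebesgue_on (ball x0 R0)) (\<lambda>x. f x powr (1 / p))"
    and rh: "\<And>y R. 0 < R \<Longrightarrow> cball y R \<subseteq> ball x0 R0 \<Longrightarrow> avg (cball y (R / 2)) f \<le> A * avg (cball y R) (\<lambda>x. f x powr (1 / p)) powr p"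
    and st: "0 < s" "s < t" "t < R0" and k: "0 < k" "(20 * R0 / (t - s)) ^ CARD('n) * avg (ball x0 R0) f \<le> k"
  defines "\<kappa> \<equiv> 2 powr (- p) / A"
  shows "lint (ball x0 s) (\<lambda>x. if k < f x then f x else 0)
    \<le> 2 * 5 ^ CARD('n) * A powr (1 / p) * k powr (1 - 1 / p) * lint (ball x0 t) (\<lambda>x. if \<kappa> * k < f x then f x powr (1 / p) else 0)"
proof -
  define V where "V = ubv TYPE('n)"
  have V: "0 < V" unfolding V_def by (rule ubv_pos)
  have R0: "0 < R0" using st by simp
  \<comment> \<open>Balls of radius up to \<open>10 * \<delta>\<close> around points of
    \<open>ball x0 s\<close> stay in \<open>ball x0 t\<close>, and by the lower bound on
    \<open>k\<close> no ball of radius at least \<delta> inside \<open>ball x0 R0\<close> has an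
    average above \<open>k\<close>.\<close>
  define \<delta> where "\<delta> = (t - s) / 20"
  have \<delta>: "0 < \<delta>" using st by (simp add: \<delta>_def)
  have fm[measurable]: "f \<in> borel_measurable lebesgue" using f by auto
  have \<kappa>: "0 < \<kappa>" using A by (simp add: \<kappa>_def)
  define b where "b = (\<lambda>x. if \<kappa> * k < f x then f x powr (1 / p) else 0)"
  have bm[measurable]: "b \<in> borel_measurable lebesgue" unfolding b_def by measurable
  have b0: "0 \<le> b x" for x by (simp add: b_def)
  have bI: "integrable (lebesgue_on S) b" if "S \<subseteq> ball x0 R0" "S \<in> sets lebesgue" for S
  proof (rule Bochner_Integration.integrable_bound)
    show "integrable (lebesgue_on S) (\<lambda>x. f x powr (1 / p))" using integrable_on_subset_lebesgue[OF h that(1,2)] by simp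
    show "b \<in> borel_measurable (lebesgue_on S)" using bm by (rule measurable_restrict_space1)
  qed (auto simp: b_def)
  define D where "D = 2 * 5 ^ CARD('n) * A powr (1 / p) * k powr (1 - 1 / p)"
  have D: "0 \<le> D" using A by (simp add: D_def)
  define T where "T = ball x0 s \<inter> {x. k < f x}"
  have "{x \<in> space lebesgue. k < f x} \<in> sets lebesgue" by measurable
  then have Ts: "T \<in> sets lebesgue" by (auto simp: T_def)
  define P where "P = (\<lambda>x. {\<rho>. 0 < \<rho> \<and> \<rho> < \<delta> \<and> k * (V * \<rho> ^ CARD('n)) < lint (cball x \<rho>) f})"
  \<comment> \<open>A stopping radius up to a factor 2, which avoids the continuity of averages in the radius.\<close>
  have "\<exists>\<rho>. \<rho> \<in> P x \<and> (\<forall>\<rho>'. 2 * \<rho> \<le> \<rho>' \<longrightarrow> \<rho>' \<notin> P x)" if x: "x \<in> heavy f k \<delta>" for x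
  proof -
    have ne: "P x \<noteq> {}" using x by (auto simp: heavy_def P_def V_def)
    have bdd: "bdd_above (P x)" by (rule bdd_aboveI[of _ \<delta>]) (auto simp: P_def)
    obtain \<rho>0 where "\<rho>0 \<in> P x" using ne by blast
    then have "0 < \<rho>0" "\<rho>0 \<le> Sup (P x)" using bdd by (auto simp: P_def intro: cSup_upper)
    then have "Sup (P x) / 2 < Sup (P x)" by simp
    then obtain \<rho> where \<rho>: "\<rho> \<in> P x" "Sup (P x) / 2 < \<rho>" using less_cSupE[OF _ ne] by blast
    have "\<rho>' \<notin> P x" if "2 * \<rho> \<le> \<rho>'" for \<rho>'
    proof
      assume "\<rho>' \<in> P x"
      then have "\<rho>' \<le> Sup (P x)" using bdd by (rule cSup_upper)
      then show False using that \<rho>(2) by simp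
    qed
    then show ?thesis using \<rho>(1) by blast
  qed
  then obtain rad where rad: "\<And>x. x \<in> heavy f k \<delta> \<Longrightarrow> rad x \<in> P x" "\<And>x \<rho>'. x \<in> heavy f k \<delta> \<Longrightarrow> 2 * rad x \<le> \<rho>' \<Longrightarrow> \<rho>' \<notin> P x"
    by metis
  define G where "G = T \<inter> heavy f k \<delta>"
  have radG: "0 < rad x" "rad x < \<delta>" "k * (V * rad x ^ CARD('n)) < lint (cball x (rad x)) f" if "x \<in> G" for x
    using rad(1)[of x] that by (auto simp: G_def P_def)
  \<comment> \<open>The radii are doubled beforehand because the reverse Hoelder inequality yields
    its lower bound on balls of radius \<open>2 * rad i\<close>, and these must be disjoint; the
    fivefold enlargements then have radius \<open>10 * rad i\<close>.\<close>
  obtain C where C: "countable C" "C \<subseteq> G" "pairwise (\<lambda>i j. disjnt (cball i (2 * rad i)) (cball j (2 * rad j))) C"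
    "G \<subseteq> (\<Union>i\<in>C. cball i (5 * (2 * rad i)))"
  proof (rule Vitali_covering_lemma_cballs[where S = G and K = G and a = "\<lambda>x. x" and r = "\<lambda>x. 2 * rad x" and B = "2 * \<delta>"])
    show "G \<subseteq> (\<Union>i\<in>G. cball i (2 * rad i))" using radG(1) by (force intro: less_imp_le)
    show "0 < 2 * rad i \<and> 2 * rad i \<le> 2 * \<delta>" if "i \<in> G" for i using radG(1,2)[OF that] by simp
  qed (rule that)
  have sub: "cball x \<rho> \<subseteq> ball x0 t" if "x \<in> G" "\<rho> \<le> 10 * \<delta>" for x \<rho>
  proof -
    have "dist x x0 < s" using that by (simp add: G_def T_def dist_commute)
    moreover have "\<rho> \<le> (t - s) / 2" using that by (simp add: \<delta>_def)
    moreover have "s + (t - s) / 2 < t" using st by (simp add: field_simps)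
    ultimately have "dist x x0 + \<rho> < t" using add_less_le_mono less_trans by blast
    then show ?thesis by (simp add: cball_subset_ball_iff)
  qed
  have tR: "ball x0 t \<subseteq> ball x0 R0" using st by (intro subset_ball) simp
  have local: "lint (cball x (10 * rad x)) f \<le> D * lint (cball x (2 * rad x)) b" if x: "x \<in> G" for x
  proof -
    note \<rho> = radG[OF x]
    define B where "B = cball x (2 * rad x)"
    have BR: "B \<subseteq> ball x0 R0" using sub[OF x, of "2 * rad x"] \<rho> tR by (auto simp: B_def)
    define vol where "vol = V * (2 * rad x) ^ CARD('n)"
    have vol: "0 < vol" using V \<rho> by (simp add: vol_def)
    have mB: "measure lebesgue B = vol" using measure_lebesgue_cball[of "2 * rad x" x] \<rho> by (simp add: B_def vol_def V_def)
    have 1: "lint (cball x (10 * rad x)) f \<le> k * (V * (10 * rad x) ^ CARD('n))"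
    proof (cases "10 * rad x < \<delta>")
      case True
      have "10 * rad x \<notin> P x" using rad(2)[of x "10 * rad x"] x \<rho> by (simp add: G_def)
      then show ?thesis using True \<rho> by (simp add: P_def not_less)
    next
      case False
      have "lint (cball x (10 * rad x)) f \<le> lint (ball x0 R0) f"
        using sub[OF x, of "10 * rad x"] \<rho> tR f by (intro integral_on_mono_set integrable_on_if_integrable) auto
      also have "\<dots> = avg (ball x0 R0) f * (V * R0 ^ CARD('n))"
        using measure_lebesgue_ball[of R0 x0] R0 ubv_pos[where 'n = 'n, THEN less_imp_neq] by (simp add: avg_def V_def)
      also have "\<dots> = (20 * R0 / (t - s)) ^ CARD('n) * avg (ball x0 R0) f * (V * \<delta> ^ CARD('n))"
      proof -
        have "(20 * R0 / (t - s)) ^ CARD('n) * \<delta> ^ CARD('n) = R0 ^ CARD('n)"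
          using st by (simp add: \<delta>_def flip: power_mult_distrib)
        then show ?thesis by (metis mult.assoc mult.commute)
      qed
      also have "\<dots> \<le> k * (V * (10 * rad x) ^ CARD('n))"
        using k False V \<delta> by (intro mult_mono power_mono) auto
      finally show ?thesis .
    qed
    have 2: "k \<le> A * avg B (\<lambda>x. f x powr (1 / p)) powr p"
    proof -
      have "k \<le> avg (cball x (rad x)) f"
        using \<rho> measure_lebesgue_cball[of "rad x" x] ubv_pos[where 'n = 'n] by (simp add: avg_def V_def pos_le_divide_eq)
      also have "\<dots> = avg (cball x (2 * rad x / 2)) f" by simp
      also have "\<dots> \<le> A * avg B (\<lambda>x. f x powr (1 / p)) powr p"
        unfolding B_def by (rule rh) (use \<rho> BR in \<open>auto simp: B_def\<close>)
      finally show ?thesis .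
    qed
    define \<mu> where "\<mu> = (k / A) powr (1 / p)"
    have \<mu>: "0 < \<mu>" using k A by (simp add: \<mu>_def)
    have a0: "0 \<le> avg B (\<lambda>x. f x powr (1 / p))" by (rule avg_nonneg) simp
    have 3: "\<mu> \<le> avg B (\<lambda>x. f x powr (1 / p))"
    proof -
      have "k / A \<le> avg B (\<lambda>x. f x powr (1 / p)) powr p" using 2 A by (simp add: pos_divide_le_eq mult.commute)
      then have "\<mu> \<le> (avg B (\<lambda>x. f x powr (1 / p)) powr p) powr (1 / p)"
        unfolding \<mu>_def using k A p by (intro powr_mono2) auto
      then show ?thesis using a0 p by (simp add: powr_powr)
    qed
    \<comment> \<open>\<kappa> is chosen such that \<open>(\<kappa> * k) powr (1 / p)\<close> is
      exactly \<open>\<mu> / 2\<close>, half of the lower bound for the average.\<close>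
    have hb: "f x powr (1 / p) \<le> b x + \<mu> / 2" for x
    proof (cases "\<kappa> * k < f x")
      case True then show ?thesis using \<mu> by (simp add: b_def)
    next
      case False
      have "f x powr (1 / p) \<le> (\<kappa> * k) powr (1 / p)" using False f p by (intro powr_mono2) auto
      also have "\<kappa> * k = 2 powr (- p) * (k / A)" by (simp add: \<kappa>_def)
      also have "(2 powr (- p) * (k / A)) powr (1 / p) = (2 powr (- p)) powr (1 / p) * \<mu>"
        unfolding \<mu>_def by (rule powr_mult)
      also have "(2 powr (- p)) powr (1 / p) = (1 / 2 :: real)" unfolding powr_powr using p by (simp add: powr_minus_divide)
      finally show ?thesis using b0[of x] by simp
    qed
    have Bs: "B \<in> sets lebesgue" "B \<in> lmeasurable" by (auto simp: B_def)
    have bB: "integrable (lebesgue_on B) b" by (rule bI[OF BR Bs(1)])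
    have "\<mu> * vol \<le> lint B (\<lambda>x. f x powr (1 / p))"
      using 3 vol by (simp add: avg_def mB pos_le_divide_eq)
    also have "\<dots> \<le> lint B (\<lambda>x. b x + \<mu> / 2)"
      using integrable_on_subset_lebesgue[OF h BR Bs(1)] bB integrable_const_lmeasurable[OF Bs(2)] hb
      by (intro integral_mono) auto
    also have "\<dots> = lint B b + vol * (\<mu> / 2)"
      using bB integrable_const_lmeasurable[OF Bs(2), of "\<mu> / 2"] integral_const_on[OF Bs(1), of "\<mu> / 2"] mB by simp
    finally have 4: "\<mu> * vol \<le> 2 * lint B b" by (simp add: mult.commute)
    have "k * (V * (10 * rad x) ^ CARD('n)) = k / \<mu> * 5 ^ CARD('n) * (\<mu> * vol)"
    proof -
      have "(5 * (2 * rad x)) ^ CARD('n) = 5 ^ CARD('n) * (2 * rad x) ^ CARD('n)" by (rule power_mult_distrib)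
      moreover have "5 * (2 * rad x) = 10 * rad x" by simp
      ultimately have e: "(10 * rad x) ^ CARD('n) = 5 ^ CARD('n) * (2 * rad x) ^ CARD('n)" by metis
      have "k * (V * (a * b)) = k / \<mu> * a * (\<mu> * (V * b))" for a b using \<mu> by simp
      then show ?thesis unfolding e vol_def .
    qed
    also have "\<dots> \<le> k / \<mu> * 5 ^ CARD('n) * (2 * lint B b)"
      using 4 k \<mu> by (intro mult_left_mono) auto
    also have "k / \<mu> = A powr (1 / p) * k powr (1 - 1 / p)"
      using k A by (simp add: \<mu>_def powr_divide powr_diff)
    also have "A powr (1 / p) * k powr (1 - 1 / p) * 5 ^ CARD('n) * (2 * lint B b) = D * lint B b"
      by (simp add: D_def)
    finally show ?thesis using 1 by (simp add: B_def)
  qed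
  have "T - G \<subseteq> {x. k < f x} - heavy f k \<delta>" by (auto simp: T_def G_def)
  then have null: "negligible (T - G)"
    using negligible_superlevel_minus_heavy[OF f k(1) \<delta>] negligible_subset by blast
  \<comment> \<open>Extended by zero, \<open>b\<close> is the density of a measure on the whole
    space, so the contributions of the disjoint balls add up to at most its total mass.\<close>
  define b' where "b' = (\<lambda>x. indicator (ball x0 t) x * b x)"
  have b'm[measurable]: "b' \<in> borel_measurable lebesgue"
    unfolding b'_def using bm by (intro borel_measurable_times borel_measurable_indicator) auto
  let ?N = "density lebesgue (\<lambda>x. ennreal (f x))" and ?M = "density lebesgue (\<lambda>x. ennreal (b' x))"
  have disj: "disjoint_family_on (\<lambda>i. cball i (2 * rad i)) C"
    using C(3) by (auto simp: disjoint_family_on_def pairwise_def disjnt_def)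
  have Us: "(\<Union>i\<in>C. cball i (2 * rad i)) \<in> sets lebesgue" "(\<Union>i\<in>C. cball i (10 * rad i)) \<in> sets lebesgue"
    using C(1) by (auto intro!: sets.countable_UN')
  have tIs: "integrable (lebesgue_on (ball x0 s)) (\<lambda>x. if k < f x then f x else 0)"
  proof (rule Bochner_Integration.integrable_bound[OF integrable_on_if_integrable[OF f(1), of "ball x0 s"]])
    show "(\<lambda>x. if k < f x then f x else 0) \<in> borel_measurable (lebesgue_on (ball x0 s))"
      by (rule measurable_restrict_space1) measurable
  qed auto
  have "ennreal (lint (ball x0 s) (\<lambda>x. if k < f x then f x else 0))
     = (\<integral>\<^sup>+x\<in>ball x0 s. ennreal (if k < f x then f x else 0) \<partial>lebesgue)"
    by (rule nn_set_integral_eq_integral_on[OF tIs, symmetric]) (use f in auto)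
  also have "\<dots> \<le> (\<integral>\<^sup>+x\<in>(\<Union>i\<in>C. cball i (10 * rad i)). ennreal (f x) \<partial>lebesgue)"
  proof (rule nn_integral_mono_AE)
    have "AE x in lebesgue. x \<notin> T - G" using null unfolding negligible_iff_null_sets by (rule AE_not_in)
    then show "AE x in lebesgue. ennreal (if k < f x then f x else 0) * indicator (ball x0 s) x
        \<le> ennreal (f x) * indicator (\<Union>i\<in>C. cball i (10 * rad i)) x"
    proof (rule eventually_mono)
      fix x assume x: "x \<notin> T - G"
      show "ennreal (if k < f x then f x else 0) * indicator (ball x0 s) x
        \<le> ennreal (f x) * indicator (\<Union>i\<in>C. cball i (10 * rad i)) x"
      proof (cases "x \<in> T")
        case True
        then have "x \<in> G" using x by blast
        then have "x \<in> (\<Union>i\<in>C. cball i (5 * (2 * rad i)))" using C(4) by blast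
        then have "x \<in> (\<Union>i\<in>C. cball i (10 * rad i))" by simp
        then show ?thesis by (auto simp: indicator_def)
      next
        case False
        then show ?thesis by (auto simp: T_def indicator_def)
      qed
    qed
  qed
  also have "\<dots> = emeasure ?N (\<Union>i\<in>C. cball i (10 * rad i))" using Us by (simp add: emeasure_density)
  also have "\<dots> \<le> (\<integral>\<^sup>+i. emeasure ?N (cball i (10 * rad i)) \<partial>count_space C)"
    by (rule emeasure_UN_countable_le[OF _ C(1)]) simp
  also have "\<dots> \<le> (\<integral>\<^sup>+i. ennreal D * emeasure ?M (cball i (2 * rad i)) \<partial>count_space C)"
  proof (rule nn_integral_mono)
    fix i assume "i \<in> space (count_space C)"
    then have i: "i \<in> G" using C(2) by auto
    have Bt: "cball i (2 * rad i) \<subseteq> ball x0 t" using sub[OF i, of "2 * rad i"] radG[OF i] by simp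
    have bB: "integrable (lebesgue_on (cball i (2 * rad i))) b" using Bt tR by (intro bI) auto
    have "emeasure ?N (cball i (10 * rad i)) = ennreal (lint (cball i (10 * rad i)) f)"
      using f by (intro emeasure_density_integral_on integrable_on_if_integrable) auto
    also have "\<dots> \<le> ennreal (D * lint (cball i (2 * rad i)) b)"
      by (rule ennreal_leI[OF local[OF i]])
    also have "\<dots> = ennreal D * (\<integral>\<^sup>+x\<in>cball i (2 * rad i). ennreal (b x) \<partial>lebesgue)"
      using D nn_set_integral_eq_integral_on[OF bB] b0 by (simp add: ennreal_mult')
    also have "(\<integral>\<^sup>+x\<in>cball i (2 * rad i). ennreal (b x) \<partial>lebesgue) = (\<integral>\<^sup>+x\<in>cball i (2 * rad i). ennreal (b' x) \<partial>lebesgue)"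
      using Bt by (intro nn_integral_cong) (auto simp: b'_def indicator_def)
    also have "\<dots> = emeasure ?M (cball i (2 * rad i))" by (simp add: emeasure_density)
    finally show "emeasure ?N (cball i (10 * rad i)) \<le> ennreal D * emeasure ?M (cball i (2 * rad i))" .
  qed
  also have "\<dots> = ennreal D * (\<integral>\<^sup>+i. emeasure ?M (cball i (2 * rad i)) \<partial>count_space C)"
    by (rule nn_integral_cmult) simp
  also have "(\<integral>\<^sup>+i. emeasure ?M (cball i (2 * rad i)) \<partial>count_space C) = emeasure ?M (\<Union>i\<in>C. cball i (2 * rad i))"
    by (rule emeasure_UN_countable[OF _ C(1) disj, symmetric]) simp
  also have "\<dots> \<le> emeasure ?M UNIV" using Us by (intro emeasure_mono) auto
  also have "\<dots> = (\<integral>\<^sup>+x\<in>ball x0 t. ennreal (b x) \<partial>lebesgue)"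
    by (simp add: emeasure_density) (auto intro!: nn_integral_cong simp: b'_def indicator_def)
  also have "\<dots> = ennreal (lint (ball x0 t) b)"
    using b0 by (intro nn_set_integral_eq_integral_on bI tR) auto
  also have "ennreal D * \<dots> = ennreal (D * lint (ball x0 t) b)"
    using D by (simp add: ennreal_mult')
  finally have "ennreal (lint (ball x0 s) (\<lambda>x. if k < f x then f x else 0)) \<le> ennreal (D * lint (ball x0 t) b)"
    by (simp add: mult_left_mono)
  then show ?thesis unfolding D_def b_def
    using D b0 by (subst (asm) ennreal_le_iff) (auto simp: D_def b_def intro!: mult_nonneg_nonneg integral_nonneg_AE AE_I2)
qed

section \<open>Sums over dyadic levels\<close>

lemma two_powr_minus_1_le:
  assumes "0 \<le> \<sigma>" "\<sigma> \<le> (1 :: real)"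
  shows "2 powr \<sigma> - 1 \<le> 2 * \<sigma>"
proof -
  have "ln (2 powr (- \<sigma>)) \<le> 2 powr (- \<sigma>) - 1" by (rule ln_le_minus_one) simp
  then have "- (\<sigma> * ln 2) \<le> 2 powr (- \<sigma>) - 1" by (simp add: ln_powr)
  then have "2 powr \<sigma> * (1 - 2 powr (- \<sigma>)) \<le> 2 powr \<sigma> * (\<sigma> * ln 2)" by (intro mult_left_mono) auto
  also have "2 powr \<sigma> * (1 - 2 powr (- \<sigma>)) = 2 powr \<sigma> - 1" by (simp add: right_diff_distrib powr_add[symmetric])
  also have "2 powr \<sigma> * (\<sigma> * ln 2) \<le> 2 * (\<sigma> * 1)"
    using assms powr_mono[of \<sigma> 1 2] ln_2_less_1 by (intro mult_mono) auto
  finally show ?thesis by simp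
qed

text \<open>A discrete layer-cake formula: the increments telescope up to the first level that is
  not below \<open>v\<close>, or to level \<open>N\<close>, and in both cases that level dominates
  the minimum.\<close>

lemma sum_levels_lower:
  fixes l v \<sigma> :: real
  assumes l: "0 < l" and v: "0 \<le> v" and \<sigma>: "0 \<le> \<sigma>"
  shows "min v (l * 2 ^ N) powr \<sigma> - l powr \<sigma> \<le> (\<Sum>k<N. if l * 2 ^ k < v then (l * 2 ^ Suc k) powr \<sigma> - (l * 2 ^ k) powr \<sigma> else 0)"
proof (induction N)
  case 0
  have "min v l powr \<sigma> \<le> l powr \<sigma>" using assms by (intro powr_mono2) auto
  then show ?case by simp
next
  case (Suc N)
  show ?case
  proof (cases "l * 2 ^ N < v")
    case True
    have "min v (l * 2 ^ Suc N) powr \<sigma> \<le> (l * 2 ^ Suc N) powr \<sigma>" using assms by (intro powr_mono2) auto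
    moreover have "min v (l * 2 ^ N) = l * 2 ^ N" using True by simp
    ultimately show ?thesis using Suc True by simp
  next
    case False
    have "l * 2 ^ N \<le> l * 2 ^ Suc N" using l by simp
    then have "min v (l * 2 ^ Suc N) = min v (l * 2 ^ N)" using False by linarith
    then show ?thesis using Suc False by simp
  qed
qed

text \<open>A geometric sum is controlled by its last term. The last level that occurs lies below
  \<open>m\<close>, so the next one is below \<open>2 * m\<close>.\<close>

lemma sum_levels_upper:
  fixes l m b :: real
  assumes l: "0 < l" and m: "0 \<le> m" and b: "0 < b"
  shows "(2 powr b - 1) * (\<Sum>k<N. if l * 2 ^ k < m then (l * 2 ^ k) powr b else 0) \<le> 2 powr b * m powr b"
proof -
  have step: "(l * 2 ^ Suc k) powr b = 2 powr b * (l * 2 ^ k) powr b" for k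
  proof -
    have "l * 2 ^ Suc k = 2 * (l * 2 ^ k)" by simp
    then show ?thesis by (simp only: powr_mult)
  qed
  have full: "(2 powr b - 1) * (\<Sum>k<N. (l * 2 ^ k) powr b) \<le> (l * 2 ^ N) powr b" for N
  proof (induction N)
    case (Suc N)
    then show ?case unfolding step by (simp add: algebra_simps)
  qed simp
  have b1: "0 \<le> 2 powr b - 1" using b by (simp add: ge_one_powr_ge_zero)
  show ?thesis
  proof (induction N)
    case (Suc N)
    show ?case
    proof (cases "l * 2 ^ N < m")
      case True
      have "(\<Sum>k<Suc N. if l * 2 ^ k < m then (l * 2 ^ k) powr b else 0) \<le> (\<Sum>k<Suc N. (l * 2 ^ k) powr b)"
        by (intro sum_mono) auto
      then have "(2 powr b - 1) * (\<Sum>k<Suc N. if l * 2 ^ k < m then (l * 2 ^ k) powr b else 0) \<le> (2 powr b - 1) * (\<Sum>k<Suc N. (l * 2 ^ k) powr b)"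
        by (intro mult_left_mono b1)
      also have "\<dots> \<le> (l * 2 ^ Suc N) powr b" by (rule full)
      also have "\<dots> = 2 powr b * (l * 2 ^ N) powr b" by (rule step)
      also have "\<dots> \<le> 2 powr b * m powr b" using True l b by (intro mult_left_mono powr_mono2) auto
      finally show ?thesis .
    next
      case False
      then show ?thesis using Suc by simp
    qed
  qed (simp)
qed

text \<open>This puts the truncation height exactly on a dyadic level while the lowest level stays
  comparable to \<open>k0\<close>.\<close>

lemma dyadic_descent:
  fixes k0 K :: real
  assumes "0 < k0" "k0 \<le> K"
  obtains l N where "k0 \<le> l" "l \<le> 2 * k0" "K = l * 2 ^ N"
proof -
  have ex: "\<exists>N. K / 2 ^ N \<le> 2 * k0"
  proof -
    obtain N where "K / k0 < 2 ^ N" using real_arch_pow[of 2 "K / k0"] by auto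
    then have "K / 2 ^ N \<le> 2 * k0" using assms by (simp add: field_simps)
    then show ?thesis ..
  qed
  define N where "N = (LEAST N. K / 2 ^ N \<le> 2 * k0)"
  have N: "K / 2 ^ N \<le> 2 * k0" unfolding N_def by (rule LeastI_ex[OF ex])
  have "k0 \<le> K / 2 ^ N"
  proof (cases N)
    case 0 then show ?thesis using assms by simp
  next
    case (Suc M)
    then have "\<not> K / 2 ^ M \<le> 2 * k0" unfolding N_def by (intro not_less_Least) simp
    then show ?thesis unfolding Suc by (simp add: field_simps)
  qed
  then show thesis using N by (intro that[of "K / 2 ^ N" N]) auto
qed

text \<open>The superlevel estimates are summed over the dyadic levels \<open>l * 2 ^ k\<close> below the truncation height \<open>K\<close>; the weights \<open>w k\<close> carry the
  factor \<open>\<sigma>\<close> that makes the right-hand side absorbable.\<close>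

lemma gehring_step:
  fixes f :: "real ^ 'n \<Rightarrow> real"
  assumes p: "1 < p" and A: "1 \<le> A" and f: "integrable lebesgue f" "\<And>x. 0 \<le> f x"
    and h: "integrable (lebesgue_on (ball x0 R0)) (\<lambda>x. f x powr (1 / p))"
    and rh: "\<And>y R. 0 < R \<Longrightarrow> cball y R \<subseteq> ball x0 R0 \<Longrightarrow> avg (cball y (R / 2)) f \<le> A * avg (cball y R) (\<lambda>x. f x powr (1 / p)) powr p"
    and st: "0 < s" "s < t" "t < R0" and m: "0 < avg (ball x0 R0) f" and K: "0 < K" and \<sigma>: "0 < \<sigma>" "\<sigma> \<le> 1"
  defines "\<kappa> \<equiv> 2 powr (- p) / A" and "Z \<equiv> \<lambda>s. lint (ball x0 s) (\<lambda>x. f x * min (f x) K powr \<sigma>)"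
  shows "Z s \<le> \<sigma> * (16 * 5 ^ CARD('n) * A powr (1 / p) / ((2 powr (1 - 1 / p) - 1) * \<kappa>\<^sup>2)) * Z t
     + (2 * ((20 * R0 / (t - s)) ^ CARD('n) * avg (ball x0 R0) f)) powr \<sigma> * lint (ball x0 R0) f"
proof -
  define k0 where "k0 = (20 * R0 / (t - s)) ^ CARD('n) * avg (ball x0 R0) f"
  have k0: "0 < k0" using st m by (simp add: k0_def)
  define \<beta> where "\<beta> = 1 - 1 / p"
  have \<beta>: "0 < \<beta>" "\<beta> < 1" using p by (auto simp: \<beta>_def)
  define D where "D = 2 * 5 ^ CARD('n) * A powr (1 / p)"
  have D: "0 \<le> D" using A by (simp add: D_def)
  have \<kappa>: "0 < \<kappa>" "\<kappa> \<le> 1"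
  proof -
    have "2 powr (- p) \<le> (2 :: real) powr 0" using p by (intro powr_mono) auto
    then show "0 < \<kappa>" "\<kappa> \<le> 1" using A by (auto simp: \<kappa>_def divide_le_eq)
  qed
  define C' where "C' = 16 * 5 ^ CARD('n) * A powr (1 / p) / ((2 powr \<beta> - 1) * \<kappa>\<^sup>2)"
  have two\<beta>: "0 < 2 powr \<beta> - 1" using \<beta> by simp
  have C': "0 \<le> C'" unfolding C'_def using two\<beta> by (intro divide_nonneg_nonneg mult_nonneg_nonneg) auto
  have C'D: "C' = 2 * D * (4 / (2 powr \<beta> - 1)) * (1 / \<kappa>\<^sup>2)" by (simp add: C'_def D_def)
  have fm[measurable]: "f \<in> borel_measurable lebesgue" using f by auto
  have fS: "integrable (lebesgue_on S) f" if "S \<in> sets lebesgue" for S by (rule integrable_on_if_integrable[OF f(1) that])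
  have tR: "ball x0 t \<subseteq> ball x0 R0" and sR: "ball x0 s \<subseteq> ball x0 R0" using st by (auto intro!: subset_ball)
  have ZI: "integrable (lebesgue_on S) (\<lambda>x. f x * min (f x) K powr \<sigma>)" if S: "S \<in> sets lebesgue" for S
  proof (rule Bochner_Integration.integrable_bound)
    show "integrable (lebesgue_on S) (\<lambda>x. K powr \<sigma> * f x)" using fS[OF S] by simp
    show "(\<lambda>x. f x * min (f x) K powr \<sigma>) \<in> borel_measurable (lebesgue_on S)"
      by (rule measurable_restrict_space1) measurable
    show "AE x in lebesgue_on S. norm (f x * min (f x) K powr \<sigma>) \<le> norm (K powr \<sigma> * f x)"
    proof (rule AE_I2)
      fix x
      have "min (f x) K powr \<sigma> \<le> K powr \<sigma>" using f K \<sigma> by (intro powr_mono2) auto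
      then show "norm (f x * min (f x) K powr \<sigma>) \<le> norm (K powr \<sigma> * f x)" using f(2)[of x] by (simp add: mult.commute mult_left_mono)
    qed
  qed
  have I0: "lint (ball x0 s) f \<le> lint (ball x0 R0) f" "0 \<le> lint (ball x0 s) f"
    using f sR by (auto intro!: integral_on_mono_set fS integral_nonneg_AE)
  have Zt: "0 \<le> Z t" unfolding Z_def using f by (intro integral_nonneg_AE AE_I2) auto
  have "Z s \<le> \<sigma> * C' * Z t + (2 * k0) powr \<sigma> * lint (ball x0 R0) f"
  proof (cases "K \<le> k0")
    case True
    have "Z s \<le> lint (ball x0 s) (\<lambda>x. (2 * k0) powr \<sigma> * f x)"
      unfolding Z_def
    proof (rule integral_mono[OF ZI])
      fix x
      have "min (f x) K powr \<sigma> \<le> (2 * k0) powr \<sigma>" using f K \<sigma> True k0 by (intro powr_mono2) (auto simp: min_def)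
      then show "f x * min (f x) K powr \<sigma> \<le> (2 * k0) powr \<sigma> * f x" using f(2)[of x] by (simp add: mult.commute mult_left_mono)
    qed (use fS in auto)
    also have "\<dots> = (2 * k0) powr \<sigma> * lint (ball x0 s) f" by simp
    also have "\<dots> \<le> (2 * k0) powr \<sigma> * lint (ball x0 R0) f" using I0 by (intro mult_left_mono) auto
    finally show ?thesis using Zt C' \<sigma> by (simp add: add_increasing)
  next
    case False
    then obtain l N where l: "k0 \<le> l" "l \<le> 2 * k0" "K = l * 2 ^ N"
      using dyadic_descent[OF k0, of K] by auto
    have l0: "0 < l" using l k0 by simp
    define L where "L = (\<lambda>k. l * 2 ^ k)"
    have L0: "0 < L k" for k using l0 by (simp add: L_def)
    have Ll: "k0 \<le> L k" for k
    proof -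
      have "l * 1 \<le> l * 2 ^ k" using l0 by (intro mult_left_mono) auto
      then show ?thesis using l by (simp add: L_def)
    qed
    define w where "w = (\<lambda>k. L (Suc k) powr \<sigma> - L k powr \<sigma>)"
    have w: "0 \<le> w k" "w k \<le> 2 * \<sigma> * L k powr \<sigma>" for k
    proof -
      have "L (Suc k) = 2 * L k" by (simp add: L_def)
      then have "w k = (2 powr \<sigma> - 1) * L k powr \<sigma>" by (simp add: w_def powr_mult left_diff_distrib)
      moreover have "0 \<le> 2 powr \<sigma> - 1" using \<sigma> by (simp add: ge_one_powr_ge_zero)
      ultimately show "0 \<le> w k" "w k \<le> 2 * \<sigma> * L k powr \<sigma>"
        using two_powr_minus_1_le[of \<sigma>] \<sigma> by (auto intro!: mult_right_mono)
    qed
    define F where "F = (\<lambda>k x. if L k < f x then f x else 0)"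
    define H where "H = (\<lambda>k x. if \<kappa> * L k < f x then f x powr (1 / p) else 0)"
    have FI: "integrable (lebesgue_on (ball x0 s)) (F k)" for k
    proof (rule Bochner_Integration.integrable_bound[OF fS[of "ball x0 s"]])
      show "F k \<in> borel_measurable (lebesgue_on (ball x0 s))"
        unfolding F_def by (rule measurable_restrict_space1) measurable
    qed (auto simp: F_def)
    have HI: "integrable (lebesgue_on (ball x0 t)) (H k)" for k
    proof (rule Bochner_Integration.integrable_bound[OF integrable_on_subset_lebesgue[OF h tR]])
      show "H k \<in> borel_measurable (lebesgue_on (ball x0 t))"
        unfolding H_def by (rule measurable_restrict_space1) measurable
    qed (auto simp: H_def)
    have lower: "f x * min (f x) K powr \<sigma> \<le> l powr \<sigma> * f x + (\<Sum>k<N. w k * F k x)" for x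
    proof -
      have "min (f x) K powr \<sigma> - l powr \<sigma> \<le> (\<Sum>k<N. if L k < f x then w k else 0)"
        using sum_levels_lower[OF l0 f(2), of \<sigma> x N] \<sigma> unfolding L_def w_def l(3) by simp
      then have "f x * (min (f x) K powr \<sigma> - l powr \<sigma>) \<le> f x * (\<Sum>k<N. if L k < f x then w k else 0)"
        using f(2) by (intro mult_left_mono) auto
      also have "\<dots> = (\<Sum>k<N. w k * F k x)"
        unfolding sum_distrib_left by (intro sum.cong) (auto simp: F_def)
      finally show ?thesis by (simp add: algebra_simps)
    qed
    have upper: "(\<Sum>k<N. w k * (D * L k powr \<beta>) * H k x) \<le> \<sigma> * C' * (f x * min (f x) K powr \<sigma>)" for x
    proof -
      define b where "b = \<beta> + \<sigma>"
      have b: "0 < b" "\<beta> \<le> b" "b \<le> 2" using \<beta> \<sigma> by (auto simp: b_def)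
      \<comment> \<open>For fixed \<open>x\<close> the levels that contribute satisfy
        \<open>\<kappa> * L k < f x\<close> and lie below \<open>K\<close>, that is, they lie below
        \<open>M\<close>.\<close>
      define M where "M = min (f x / \<kappa>) K"
      have M0: "0 \<le> M" using f(2)[of x] \<kappa> K by (simp add: M_def)
      have "(\<Sum>k<N. w k * (D * L k powr \<beta>) * H k x) \<le> (\<Sum>k<N. 2 * \<sigma> * D * f x powr (1 / p) * (if L k < M then L k powr b else 0))"
      proof (rule sum_mono)
        fix k assume k: "k \<in> {..<N}"
        show "w k * (D * L k powr \<beta>) * H k x \<le> 2 * \<sigma> * D * f x powr (1 / p) * (if L k < M then L k powr b else 0)"
        proof (cases "\<kappa> * L k < f x")
          case True
          have "L k < f x / \<kappa>" using True \<kappa> by (simp add: pos_less_divide_eq mult.commute)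
          moreover have "L k < K" unfolding l(3) L_def using l0 k by simp
          ultimately have "L k < M" by (simp add: M_def)
          have "w k * (D * L k powr \<beta> * f x powr (1 / p)) \<le> 2 * \<sigma> * L k powr \<sigma> * (D * L k powr \<beta> * f x powr (1 / p))"
            using w D by (intro mult_right_mono) auto
          also have "\<dots> = 2 * \<sigma> * D * f x powr (1 / p) * L k powr b" by (simp add: b_def powr_add)
          finally show ?thesis using True \<open>L k < M\<close> by (simp add: H_def mult_ac)
        next
          case False
          then show ?thesis using D \<sigma> by (simp add: H_def)
        qed
      qed
      also have "\<dots> = 2 * \<sigma> * D * f x powr (1 / p) * (\<Sum>k<N. if L k < M then L k powr b else 0)"
        by (simp add: sum_distrib_left)
      also have "\<dots> \<le> 2 * \<sigma> * D * f x powr (1 / p) * (4 / (2 powr \<beta> - 1) * M powr b)"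
      proof (rule mult_left_mono)
        \<comment> \<open>The exponent \<open>b\<close> lies between \<beta> and 2. Estimating with
          these two ends keeps \<open>C'\<close> independent of \<sigma>, which
          \<open>gehring\<close> chooses afterwards to make \<open>\<sigma> * C'\<close> at most
          \<open>1 / 2\<close>.\<close>
        have "2 powr \<beta> \<le> 2 powr b" using b by (intro powr_mono) auto
        moreover have "2 powr b \<le> (2 :: real) powr 2" using b by (intro powr_mono) auto
        then have "2 powr b \<le> (4 :: real)" by simp
        moreover define S where "S = (\<Sum>k<N. if L k < M then L k powr b else 0)"
        moreover have "(2 powr b - 1) * S \<le> 2 powr b * M powr b"
          using sum_levels_upper[OF l0 M0 b(1), of N] unfolding S_def L_def .
        moreover have "0 \<le> S" unfolding S_def by (intro sum_nonneg) auto
        ultimately have "(2 powr \<beta> - 1) * S \<le> 4 * M powr b"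
          by (meson diff_right_mono mult_right_mono order_trans powr_ge_zero)
        then show "S \<le> 4 / (2 powr \<beta> - 1) * M powr b" using two\<beta> by (simp add: pos_le_divide_eq mult.commute)
      qed (use D \<sigma> in auto)
      also have "\<dots> \<le> 2 * \<sigma> * D * f x powr (1 / p) * (4 / (2 powr \<beta> - 1) * (1 / \<kappa>\<^sup>2 * min (f x) K powr b))"
      proof (intro mult_left_mono)
        have "M \<le> min (f x) K / \<kappa>"
        proof -
          have "K \<le> K / \<kappa>" using \<kappa> K by (simp add: le_divide_eq)
          then show ?thesis by (auto simp: M_def min_def)
        qed
        then have "M powr b \<le> (min (f x) K / \<kappa>) powr b" using M0 b by (intro powr_mono2) auto
        also have "\<dots> = min (f x) K powr b / \<kappa> powr b" by (rule powr_divide)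
        also have "\<dots> \<le> min (f x) K powr b / \<kappa>\<^sup>2"
        proof (intro divide_left_mono)
          have "\<kappa> powr 2 \<le> \<kappa> powr b" using \<kappa> b by (intro powr_mono') auto
          then show "\<kappa>\<^sup>2 \<le> \<kappa> powr b" using \<kappa> by (simp add: powr_realpow)
        qed (use \<kappa> in auto)
        finally show "M powr b \<le> 1 / \<kappa>\<^sup>2 * min (f x) K powr b" by simp
      qed (use D \<sigma> two\<beta> in auto)
      also have "\<dots> = \<sigma> * C' * (f x powr (1 / p) * min (f x) K powr \<beta> * min (f x) K powr \<sigma>)"
        unfolding C'D by (simp add: b_def powr_add)
      also have "\<dots> \<le> \<sigma> * C' * (f x * min (f x) K powr \<sigma>)"
      proof (intro mult_left_mono mult_right_mono)
        have "f x powr (1 / p) * min (f x) K powr \<beta> \<le> f x powr (1 / p) * f x powr \<beta>"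
          using f K \<beta> by (intro mult_left_mono powr_mono2) auto
        also have "\<dots> = f x powr (1 / p + \<beta>)" by (simp add: powr_add)
        also have "\<dots> = f x" using f(2)[of x] by (simp add: \<beta>_def)
        finally show "f x powr (1 / p) * min (f x) K powr \<beta> \<le> f x" .
      qed (use C' \<sigma> in auto)
      finally show ?thesis .
    qed
    have "Z s \<le> lint (ball x0 s) (\<lambda>x. l powr \<sigma> * f x + (\<Sum>k<N. w k * F k x))"
      unfolding Z_def using fS[of "ball x0 s"] FI lower
      by (intro integral_mono ZI Bochner_Integration.integrable_add Bochner_Integration.integrable_sum) auto
    also have "\<dots> = l powr \<sigma> * lint (ball x0 s) f + (\<Sum>k<N. w k * lint (ball x0 s) (F k))"
      using fS[of "ball x0 s"] FI by (subst Bochner_Integration.integral_add) (auto simp: Bochner_Integration.integral_sum)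
    also have "\<dots> \<le> (2 * k0) powr \<sigma> * lint (ball x0 R0) f + (\<Sum>k<N. w k * (D * L k powr \<beta> * lint (ball x0 t) (H k)))"
    proof (intro add_mono sum_mono mult_left_mono mult_mono)
      show "l powr \<sigma> \<le> (2 * k0) powr \<sigma>" using l l0 \<sigma> by (intro powr_mono2) auto
      fix k
      have "(20 * R0 / (t - s)) ^ CARD('n) * avg (ball x0 R0) f \<le> L k" using Ll[of k] by (simp add: k0_def)
      from superlevel_estimate[OF p A f h rh st L0 this]
      show "lint (ball x0 s) (F k) \<le> D * L k powr \<beta> * lint (ball x0 t) (H k)"
        by (simp add: F_def H_def D_def \<beta>_def \<kappa>_def)
    qed (use I0 w in auto)
    also have "(\<Sum>k<N. w k * (D * L k powr \<beta> * lint (ball x0 t) (H k))) 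
       = lint (ball x0 t) (\<lambda>x. \<Sum>k<N. w k * (D * L k powr \<beta>) * H k x)"
      using HI by (subst Bochner_Integration.integral_sum) (auto simp: mult.assoc)
    also have "\<dots> \<le> lint (ball x0 t) (\<lambda>x. \<sigma> * C' * (f x * min (f x) K powr \<sigma>))"
      using HI ZI upper by (intro integral_mono Bochner_Integration.integrable_sum) auto
    also have "\<dots> = \<sigma> * C' * Z t" by (simp add: Z_def)
    finally show ?thesis by simp
  qed
  then show ?thesis by (simp add: C'_def \<beta>_def k0_def)
qed

text \<open>Truncating the factor \<open>f x powr \<sigma>\<close> at height \<open>K\<close> makes
  all quantities finite, so that they can be absorbed. The resulting bound does not depend on
  \<open>K\<close>, and monotone convergence removes the truncation. The lower bound 1 makes the
  mean positive and \<open>f x powr (1 / p)\<close> integrable.\<close>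

lemma gehring:
  assumes p: "1 < p" and A: "1 \<le> A"
  obtains \<sigma> C :: real where "0 < \<sigma>" "0 \<le> C"
    "\<And>(f :: real ^ 'n \<Rightarrow> real) x0 R0. 0 < R0 \<Longrightarrow> integrable lebesgue f \<Longrightarrow> (\<And>x. 0 \<le> f x) \<Longrightarrow> (\<And>x. x \<in> ball x0 R0 \<Longrightarrow> 1 \<le> f x) \<Longrightarrow>
      (\<And>y R. 0 < R \<Longrightarrow> cball y R \<subseteq> ball x0 R0 \<Longrightarrow> avg (cball y (R / 2)) f \<le> A * avg (cball y R) (\<lambda>x. f x powr (1 / p)) powr p) \<Longrightarrow>
      integrable (lebesgue_on (ball x0 (2 * R0 / 3))) (\<lambda>x. f x powr (1 + \<sigma>)) \<and>
      avg (ball x0 (2 * R0 / 3)) (\<lambda>x. f x powr (1 + \<sigma>)) \<le> C * avg (ball x0 R0) f powr (1 + \<sigma>)"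
proof -
  define \<kappa> where "\<kappa> = 2 powr (- p) / A"
  define C' where "C' = 16 * 5 ^ CARD('n) * A powr (1 / p) / ((2 powr (1 - 1 / p) - 1) * \<kappa>\<^sup>2)"
  have "0 < 2 powr (1 - 1 / p) - (1 :: real)" using p by simp
  moreover have "0 < \<kappa>" using A by (simp add: \<kappa>_def)
  ultimately have C': "0 < C'" unfolding C'_def using A by (intro divide_pos_pos mult_pos_pos) auto
  define \<sigma> where "\<sigma> = min 1 (1 / (2 * C'))"
  have \<sigma>: "0 < \<sigma>" "\<sigma> \<le> 1" "\<sigma> * C' \<le> 1 / 2"
  proof -
    show "0 < \<sigma>" "\<sigma> \<le> 1" using C' by (auto simp: \<sigma>_def)
    have "\<sigma> * C' \<le> 1 / (2 * C') * C'" using C' by (intro mult_right_mono) (auto simp: \<sigma>_def)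
    then show "\<sigma> * C' \<le> 1 / 2" using C' by simp
  qed
  define n where "n = real CARD('n)"
  have n: "0 < n" by (simp add: n_def)
  \<comment> \<open>The gap between \<open>2 * R0 / 3\<close> and \<open>R0\<close> is
    \<open>R0 / 3\<close>, which turns the 20 of \<open>gehring_step\<close> into 60;
    \<open>3 / 2\<close> is the ratio of the radii of the two balls of averaging.\<close>
  define C where "C = absorb_const (1 / 2) (n * \<sigma>) * (2 * 60 ^ CARD('n)) powr \<sigma> * (3 / 2) ^ CARD('n)"
  have C: "0 \<le> C" unfolding C_def by (intro mult_nonneg_nonneg absorb_const_nonneg) auto
  show thesis
  proof (rule that[OF \<sigma>(1) C])
    fix f :: "real ^ 'n \<Rightarrow> real" and x0 R0
    assume R0: "0 < R0" and fI: "integrable lebesgue f" and f0: "\<And>x. 0 \<le> f x" and f1: "\<And>x. x \<in> ball x0 R0 \<Longrightarrow> 1 \<le> f x"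
      and rh: "\<And>y R. 0 < R \<Longrightarrow> cball y R \<subseteq> ball x0 R0 \<Longrightarrow> avg (cball y (R / 2)) f \<le> A * avg (cball y R) (\<lambda>x. f x powr (1 / p)) powr p"
    have fm[measurable]: "f \<in> borel_measurable lebesgue" using fI by auto
    have fS: "integrable (lebesgue_on S) f" if "S \<in> sets lebesgue" for S by (rule integrable_on_if_integrable[OF fI that])
    define m where "m = avg (ball x0 R0) f"
    define V where "V = ubv TYPE('n)"
    have V: "0 < V" unfolding V_def by (rule ubv_pos)
    have mball: "measure lebesgue (ball x0 R) = V * R ^ CARD('n)" if "0 < R" for R
      using measure_lebesgue_ball[of R x0] that by (simp add: V_def)
    have m: "1 \<le> m"
    proof -
      have pos: "0 < measure lebesgue (ball x0 R0)" unfolding mball[OF R0] using V R0 by simp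
      have "lint (ball x0 R0) (\<lambda>x. 1) \<le> lint (ball x0 R0) f"
        using f1 fS integrable_const_lmeasurable[of "ball x0 R0" 1] by (intro integral_mono) auto
      then have "measure lebesgue (ball x0 R0) \<le> lint (ball x0 R0) f"
        using integral_const_on[of "ball x0 R0" 1] by simp
      then show ?thesis using pos unfolding m_def avg_def by (simp add: pos_le_divide_eq)
    qed
    define I0 where "I0 = lint (ball x0 R0) f"
    have I0: "I0 = m * (V * R0 ^ CARD('n))"
      unfolding I0_def m_def avg_def mball[OF R0] using R0 V by simp
    have h: "integrable (lebesgue_on (ball x0 R0)) (\<lambda>x. f x powr (1 / p))"
    proof (rule Bochner_Integration.integrable_bound[OF fS[of "ball x0 R0"]])
      show "(\<lambda>x. f x powr (1 / p)) \<in> borel_measurable (lebesgue_on (ball x0 R0))"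
        by (rule measurable_restrict_space1) measurable
      show "AE x in lebesgue_on (ball x0 R0). norm (f x powr (1 / p)) \<le> norm (f x)"
      proof (rule AE_I2)
        fix x assume "x \<in> space (lebesgue_on (ball x0 R0))"
        then have "1 \<le> f x" using f1 by simp
        then show "norm (f x powr (1 / p)) \<le> norm (f x)" using powr_mono[of "1 / p" 1 "f x"] p by simp
      qed
    qed simp
    define Z where "Z = (\<lambda>K s. lint (ball x0 s) (\<lambda>x. f x * min (f x) K powr \<sigma>))"
    have ZI: "integrable (lebesgue_on S) (\<lambda>x. f x * min (f x) K powr \<sigma>)" if S: "S \<in> sets lebesgue" and K: "0 < K" for S K
    proof (rule Bochner_Integration.integrable_bound)
      show "integrable (lebesgue_on S) (\<lambda>x. K powr \<sigma> * f x)" using fS[OF S] by simp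
      show "(\<lambda>x. f x * min (f x) K powr \<sigma>) \<in> borel_measurable (lebesgue_on S)"
        by (rule measurable_restrict_space1) measurable
      show "AE x in lebesgue_on S. norm (f x * min (f x) K powr \<sigma>) \<le> norm (K powr \<sigma> * f x)"
      proof (rule AE_I2)
        fix x
        have "min (f x) K powr \<sigma> \<le> K powr \<sigma>" using f0 K \<sigma> by (intro powr_mono2) auto
        then show "norm (f x * min (f x) K powr \<sigma>) \<le> norm (K powr \<sigma> * f x)" using f0[of x] by (simp add: mult.commute mult_left_mono)
      qed
    qed
    have nnZ: "0 \<le> f x * min (f x) K powr \<sigma>" for x K using f0 by simp
    define r0 where "r0 = 2 * R0 / 3"
    have r0: "0 < r0" "r0 < R0" using R0 by (auto simp: r0_def)
    define E where "E = absorb_const (1 / 2) (n * \<sigma>) * (2 * 60 ^ CARD('n)) powr \<sigma> * m powr \<sigma> * I0"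
    have ZE: "Z K r0 \<le> E" if K: "0 < K" for K
    proof -
      define B where "B = (2 * (20 * R0) ^ CARD('n) * m) powr \<sigma> * I0"
      have "Z K r0 \<le> absorb_const (1 / 2) (n * \<sigma>) * B / (R0 - r0) powr (n * \<sigma>)"
      proof (rule absorb_iteration)
        fix s assume s: "r0 \<le> s" "s < R0"
        show "0 \<le> Z K s" unfolding Z_def using f0 by (intro integral_nonneg_AE AE_I2) auto
        show "Z K s \<le> Z K R0" unfolding Z_def
          using s K f0 by (intro integral_on_mono_set ZI subset_ball) auto
      next
        fix s t assume st: "r0 \<le> s" "s < t" "t < R0"
        have s0: "0 < s" using st r0 by simp
        have mp: "0 < avg (ball x0 R0) f" using m by (simp add: m_def)
        have Zt: "0 \<le> Z K t" unfolding Z_def using f0 by (intro integral_nonneg_AE AE_I2) auto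
        have "Z K s \<le> \<sigma> * C' * Z K t + (2 * ((20 * R0 / (t - s)) ^ CARD('n) * m)) powr \<sigma> * I0"
          using gehring_step[OF p A fI f0 h rh s0 st(2,3) mp K \<sigma>(1,2)] by (simp add: Z_def C'_def \<kappa>_def m_def I0_def)
        also have "\<dots> \<le> 1 / 2 * Z K t + (2 * ((20 * R0 / (t - s)) ^ CARD('n) * m)) powr \<sigma> * I0"
          using \<sigma>(3) Zt by (intro add_right_mono mult_right_mono) auto
        also have "2 * ((20 * R0 / (t - s)) ^ CARD('n) * m) = (2 * (20 * R0) ^ CARD('n) * m) / (t - s) ^ CARD('n)"
          by (simp add: power_divide)
        also have "\<dots> powr \<sigma> = (2 * (20 * R0) ^ CARD('n) * m) powr \<sigma> / (t - s) powr (n * \<sigma>)"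
        proof -
          have "((t - s) ^ CARD('n)) powr \<sigma> = (t - s) powr (n * \<sigma>)"
            using st by (simp add: n_def powr_powr flip: powr_realpow)
          then show ?thesis by (simp add: powr_divide)
        qed
        finally show "Z K s \<le> 1 / 2 * Z K t + B / (t - s) powr (n * \<sigma>)" by (simp add: B_def)
      qed (use n \<sigma> r0 in auto)
      also have "\<dots> = E"
      proof -
        have e: "R0 - r0 = R0 / 3" by (simp add: r0_def)
        have a: "(R0 / 3) powr (n * \<sigma>) = ((R0 / 3) ^ CARD('n)) powr \<sigma>"
          using R0 by (simp add: n_def powr_powr flip: powr_realpow)
        have b: "2 * (20 * R0) ^ CARD('n) * m = (2 * 60 ^ CARD('n)) * m * (R0 / 3) ^ CARD('n)"
        proof -
          have "(20 * R0) ^ CARD('n) = (60 * (R0 / 3)) ^ CARD('n)" by simp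
          also have "\<dots> = 60 ^ CARD('n) * (R0 / 3) ^ CARD('n)" by (rule power_mult_distrib)
          finally show ?thesis by simp
        qed
        define P where "P = ((R0 / 3) ^ CARD('n)) powr \<sigma>"
        have P: "P \<noteq> 0" using R0 by (simp add: P_def)
        have "B = (2 * 60 ^ CARD('n)) powr \<sigma> * m powr \<sigma> * P * I0"
          unfolding B_def b P_def by (simp only: powr_mult)
        then have "B / (R0 / 3) powr (n * \<sigma>) = (2 * 60 ^ CARD('n)) powr \<sigma> * m powr \<sigma> * I0"
          unfolding a P_def[symmetric] using P by simp
        then show ?thesis unfolding e E_def by (simp add: mult.assoc times_divide_eq_right[symmetric] del: times_divide_eq_right)
      qed
      finally show ?thesis .
    qed
    have E0: "0 \<le> E"
    proof -
      have "0 \<le> Z 1 r0" unfolding Z_def using f0 by (intro integral_nonneg_AE AE_I2) auto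
      then show ?thesis using ZE[of 1] by simp
    qed
    \<comment> \<open>The heights are \<open>Suc j\<close> because \<open>ZE\<close> requires a
      positive height.\<close>
    define F where "F = (\<lambda>j x. ennreal (f x * min (f x) (real (Suc j)) powr \<sigma>) * indicator (ball x0 r0) x)"
    have SupF: "ennreal (f x powr (1 + \<sigma>)) * indicator (ball x0 r0) x = (SUP j. F j x)" for x
    proof (rule antisym)
      obtain j where "f x \<le> real (Suc j)" using real_arch_simple[of "f x"] by (metis le_Suc_eq of_nat_mono order_trans order_refl le_SucI)
      then have "ennreal (f x powr (1 + \<sigma>)) * indicator (ball x0 r0) x = F j x"
        using f0[of x] by (simp add: F_def powr_add min_absorb1)
      also have "\<dots> \<le> (SUP j. F j x)" by (rule SUP_upper) simp
      finally show "ennreal (f x powr (1 + \<sigma>)) * indicator (ball x0 r0) x \<le> (SUP j. F j x)" .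
      show "(SUP j. F j x) \<le> ennreal (f x powr (1 + \<sigma>)) * indicator (ball x0 r0) x"
      proof (rule SUP_least)
        fix j
        have "f x * min (f x) (real (Suc j)) powr \<sigma> \<le> f x * f x powr \<sigma>"
          using f0[of x] \<sigma> by (intro mult_left_mono powr_mono2) auto
        then show "F j x \<le> ennreal (f x powr (1 + \<sigma>)) * indicator (ball x0 r0) x"
          using f0[of x] by (simp add: F_def powr_add ennreal_leI mult_right_mono)
      qed
    qed
    have inc: "incseq F"
      unfolding F_def incseq_def le_fun_def
      using f0 \<sigma> by (auto intro!: mult_right_mono ennreal_leI mult_left_mono powr_mono2)
    have Fm: "F j \<in> borel_measurable lebesgue" for j
      unfolding F_def by (intro borel_measurable_times_ennreal borel_measurable_indicator measurable_compose[OF _ measurable_ennreal]) (measurable, auto)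
    have "(\<integral>\<^sup>+x\<in>ball x0 r0. ennreal (f x powr (1 + \<sigma>)) \<partial>lebesgue) = (SUP j. integral\<^sup>N lebesgue (F j))"
      unfolding SupF by (rule nn_integral_monotone_convergence_SUP[OF inc Fm])
    also have "\<dots> \<le> ennreal E"
    proof (rule SUP_least)
      fix j
      have "integral\<^sup>N lebesgue (F j) = ennreal (Z (real (Suc j)) r0)"
        unfolding F_def Z_def by (rule nn_set_integral_eq_integral_on[OF ZI]) (use nnZ in auto)
      also have "\<dots> \<le> ennreal E" by (rule ennreal_leI[OF ZE]) simp
      finally show "integral\<^sup>N lebesgue (F j) \<le> ennreal E" .
    qed
    finally have bound: "(\<integral>\<^sup>+x\<in>ball x0 r0. ennreal (f x powr (1 + \<sigma>)) \<partial>lebesgue) \<le> ennreal E" .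
    have I: "integrable (lebesgue_on (ball x0 r0)) (\<lambda>x. f x powr (1 + \<sigma>))"
    proof (rule integrable_on_if_nn_set_integral)
      show "(\<lambda>x. f x powr (1 + \<sigma>)) \<in> borel_measurable (lebesgue_on (ball x0 r0))"
        by (rule measurable_restrict_space1) measurable
      show "(\<integral>\<^sup>+x\<in>ball x0 r0. ennreal (f x powr (1 + \<sigma>)) \<partial>lebesgue) < \<infinity>"
        using bound by (rule order_le_less_trans) simp
    qed auto
    have "lint (ball x0 r0) (\<lambda>x. f x powr (1 + \<sigma>)) \<le> E"
      using bound nn_set_integral_eq_integral_on[OF I] E0 by simp
    then have "avg (ball x0 r0) (\<lambda>x. f x powr (1 + \<sigma>)) \<le> E / (V * r0 ^ CARD('n))"
      unfolding avg_def mball[OF r0(1)] using V r0 by (intro divide_right_mono) auto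
    also have "\<dots> = C * m powr (1 + \<sigma>)"
    proof -
      have "r0 ^ CARD('n) = R0 ^ CARD('n) / (3 / 2) ^ CARD('n)" by (simp add: r0_def power_divide[symmetric] mult.commute)
      moreover have "m powr (1 + \<sigma>) = m * m powr \<sigma>" using m by (simp add: powr_add)
      ultimately show ?thesis using V R0 by (simp add: E_def C_def I0)
    qed
    finally show "integrable (lebesgue_on (ball x0 (2 * R0 / 3))) (\<lambda>x. f x powr (1 + \<sigma>)) \<and>
      avg (ball x0 (2 * R0 / 3)) (\<lambda>x. f x powr (1 + \<sigma>)) \<le> C * avg (ball x0 R0) f powr (1 + \<sigma>)"
      using I by (simp add: r0_def m_def)
  qed
qed

subsection \<open>Higher integrability of quasiminimizers\<close>

text \<open>Links the closed balls of the covering argument with the open balls of the energy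
  estimate.\<close>

lemma avg_cball_eq_ball:
  fixes f :: "real ^ 'n \<Rightarrow> real"
  assumes f: "integrable (lebesgue_on (cball y R)) f" and R: "0 < R"
  shows "avg (cball y R) f = avg (ball y R) f"
proof -
  have "lint (cball y R - ball y R) f = lint (cball y R) f - lint (ball y R) f"
    by (rule integral_on_Diff[OF f ball_subset_cball]) auto
  moreover have "cball y R - ball y R = sphere y R" by auto
  then have "cball y R - ball y R \<in> null_sets lebesgue"
    using negligible_sphere[of y R] by (simp add: negligible_iff_null_sets)
  then have "lint (cball y R - ball y R) f = 0" by (rule integral_eq_zero_null_sets)
  moreover have "measure lebesgue (cball y R) = measure lebesgue (ball y R)"
    using measure_lebesgue_ball[of R y] measure_lebesgue_cball[of R y] R by simp
  ultimately show ?thesis by (simp add: avg_def)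
qed

text \<open>The first factor comes from \<open>energy_bound\<close>, the second from
  \<open>root_jensen\<close>. With the absolute value the constant is visibly at least 1 before any
  quasiminimizer is given; the sign of \<open>rev_const\<close> is established only for
  quasiminimizers.\<close>

definition gehring_const :: "real \<Rightarrow> real \<Rightarrow> real \<Rightarrow> real \<Rightarrow> real \<Rightarrow> real \<Rightarrow> 'n::finite itself \<Rightarrow> real" where
  "gehring_const p q L Lw Q K T = (2 ^ CARD('n) * \<bar>rev_const q L Lw Q K T\<bar> + 1) * (L * 2 powr q * L powr p + 1)"

context quasimin
begin

text \<open>Adding 1 absorbs the additive constant of the energy estimate and yields a homogeneous
  reverse Hoelder inequality. Extension by zero gives a function integrable on the whole space, as
  \<open>gehring\<close> expects.\<close>

definition G where "G x = (if x \<in> ball x0 (2 * r) then g x + 1 else 0)"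

lemma b2_sub: "ball x0 (2 * r) \<subseteq> cball x0 (4 * r)" "ball x0 (2 * r) \<subseteq> \<Omega>"
proof -
  show "ball x0 (2 * r) \<subseteq> cball x0 (4 * r)" using r_pos by auto
  then show "ball x0 (2 * r) \<subseteq> \<Omega>" using ball_sub by blast
qed

lemma G_nonneg: "0 \<le> G x"
  using g_nonneg[of x] b2_sub(2) by (auto simp: G_def)

lemma G_ge_1: "x \<in> ball x0 (2 * r) \<Longrightarrow> 1 \<le> G x"
  using g_nonneg[of x] b2_sub(2) by (auto simp: G_def)

lemma G_integrable: "integrable lebesgue G"
proof -
  have "integrable (lebesgue_on (ball x0 (2 * r))) (\<lambda>x. g x + 1)"
    using g_integrable[OF b2_sub(1)] integrable_const_lmeasurable[of "ball x0 (2 * r)" 1] by auto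
  then show ?thesis unfolding G_def[abs_def] by (subst Lebesgue_Measure.integrable_restrict_UNIV) auto
qed

lemma integral_G:
  assumes "S \<subseteq> ball x0 (2 * r)" "S \<in> lmeasurable"
  shows "lint S G = lint S g + measure lebesgue S"
proof -
  have Ss: "S \<in> sets lebesgue" using assms by (simp add: fmeasurableD)
  have "lint S G = lint S (\<lambda>x. g x + 1)"
    using assms by (intro Bochner_Integration.integral_cong) (auto simp: G_def)
  also have "\<dots> = lint S g + lint S (\<lambda>x. 1)"
    using g_integrable[of S] assms b2_sub Ss by (intro Bochner_Integration.integral_add integrable_const_lmeasurable) auto
  finally show ?thesis using integral_const_on[OF Ss, of 1] by simp
qed

lemma root_G_integrable:
  assumes "S \<subseteq> ball x0 (2 * r)" "S \<in> sets lebesgue"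
  shows "integrable (lebesgue_on S) (\<lambda>x. G x powr (1 / p))"
proof (rule Bochner_Integration.integrable_bound[OF integrable_on_if_integrable[OF G_integrable assms(2)]])
  show "(\<lambda>x. G x powr (1 / p)) \<in> borel_measurable (lebesgue_on S)"
    using G_integrable by (intro powr_real_measurable measurable_restrict_space1) auto
  show "AE x in lebesgue_on S. norm (G x powr (1 / p)) \<le> norm (G x)"
  proof (rule AE_I2)
    fix x assume "x \<in> space (lebesgue_on S)"
    then have "1 \<le> G x" using assms G_ge_1 by auto
    then show "norm (G x powr (1 / p)) \<le> norm (G x)" using powr_mono[of "1 / p" 1 "G x"] p_gt_1 by simp
  qed
qed

text \<open>\<open>energy_bound\<close> controls the left side by \<open>\<psi> a0 + 1\<close>. Then
  \<open>root_jensen\<close> moves \<psi> under the average with exponent \<open>1 / p\<close>,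
  where it is dominated by \<open>G\<close>, and the remaining 1 is at most that average because
  \<open>G\<close> is at least 1.\<close>

lemma reverse_holder:
  assumes R: "0 < R" and sub: "cball y R \<subseteq> ball x0 (2 * r)"
  shows "avg (cball y (R / 2)) G \<le> gehring_const p q L Lw Q K TYPE('n) * avg (cball y R) (\<lambda>x. G x powr (1 / p)) powr p"
proof -
  define \<psi> where "\<psi> = phi_minus \<Omega> \<phi> (ball y R)"
  define a0 where "a0 = avg (ball y R) (\<lambda>x. norm (Du x))"
  define V where "V = ubv TYPE('n)"
  define rc where "rc = rev_const q L Lw Q K TYPE('n)"
  define J where "J = L * 2 powr q * L powr p"
  have J: "0 \<le> J" using L_ge_1 by (simp add: J_def)
  have rc: "0 \<le> rc" unfolding rc_def by (rule rev_const_nonneg)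
  have V: "0 < V" unfolding V_def by (rule ubv_pos)
  have bsub: "ball y R \<subseteq> ball x0 (2 * r)" using sub ball_subset_cball by blast
  have b\<Omega>: "ball y R \<subseteq> \<Omega>" using bsub b2_sub by blast
  have "y \<in> ball y R \<inter> \<Omega>" using R b\<Omega> by auto
  then have ne: "ball y R \<inter> \<Omega> \<noteq> {}" by blast
  interpret m: growth p q L \<psi> unfolding \<psi>_def by (rule growth_phi_minus[OF structure_conds ne])
  have a0: "0 \<le> a0" unfolding a0_def by (rule avg_nonneg) simp
  have h2: "cball y (R / 2) \<subseteq> cball y (3 * R / 4)" "cball y (3 * R / 4) \<subseteq> ball y R" using R by (auto intro!: subset_cball)
  define vol where "vol = V * (R / 2) ^ CARD('n)"
  have vol: "0 < vol" using V R by (simp add: vol_def)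
  have mvol: "measure lebesgue (cball y (R / 2)) = vol" using measure_lebesgue_cball[of "R / 2" y] R by (simp add: vol_def V_def)
  have "lint (cball y (R / 2)) G = lint (cball y (R / 2)) g + vol"
    using integral_G[of "cball y (R / 2)"] h2 bsub mvol by auto
  also have "lint (cball y (R / 2)) g \<le> lint (cball y (3 * R / 4)) g"
  proof (rule integral_on_mono_set[OF g_integrable h2(1)])
    show "cball y (3 * R / 4) \<subseteq> cball x0 (4 * r)" using h2(2) bsub b2_sub(1) by blast
    show "0 \<le> g x" if "x \<in> cball y (3 * R / 4)" for x using that h2(2) b\<Omega> g_nonneg by blast
  qed auto
  also have "\<dots> \<le> rc * (V * R ^ CARD('n)) * (\<psi> a0 + 1)"
    using energy_bound[OF bsub R] by (simp add: rc_def V_def \<psi>_def a0_def)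
  finally have "lint (cball y (R / 2)) G \<le> rc * (V * R ^ CARD('n)) * (\<psi> a0 + 1) + vol" by simp
  also have "V * R ^ CARD('n) = 2 ^ CARD('n) * vol" by (simp add: vol_def power_divide)
  finally have "lint (cball y (R / 2)) G \<le> (2 ^ CARD('n) * rc * (\<psi> a0 + 1) + 1) * vol"
    by (simp add: algebra_simps)
  then have "avg (cball y (R / 2)) G \<le> 2 ^ CARD('n) * rc * (\<psi> a0 + 1) + 1"
    unfolding avg_def mvol using vol by (simp add: pos_divide_le_eq)
  also have "\<dots> \<le> (2 ^ CARD('n) * rc + 1) * (\<psi> a0 + 1)"
    using m.nonneg[OF a0] by (simp add: algebra_simps)
  finally have 1: "avg (cball y (R / 2)) G \<le> (2 ^ CARD('n) * rc + 1) * (\<psi> a0 + 1)" .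
  define X where "X = avg (ball y R) (\<lambda>x. G x powr (1 / p)) powr p"
  have mb: "0 < measure lebesgue (ball y R)" using measure_lebesgue_ball[of R y] R V by (simp add: V_def)
  have GI: "integrable (lebesgue_on (ball y R)) (\<lambda>x. G x powr (1 / p))" by (rule root_G_integrable[OF bsub]) simp
  have \<psi>g: "0 \<le> \<psi> (norm (Du x))" "\<psi> (norm (Du x)) \<le> G x" if "x \<in> ball y R" for x
  proof -
    show "0 \<le> \<psi> (norm (Du x))" by (rule m.nonneg) simp
    have "x \<in> \<Omega>" using that b\<Omega> by auto
    then have "\<psi> (norm (Du x)) \<le> g x" using that unfolding \<psi>_def g_def by (intro phi_minus_le[OF Phi]) auto
    then show "\<psi> (norm (Du x)) \<le> G x" using that bsub by (auto simp: G_def)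
  qed
  have \<psi>I: "integrable (lebesgue_on (ball y R)) (\<lambda>x. \<psi> (norm (Du x)) powr (1 / p))"
  proof (rule Bochner_Integration.integrable_bound[OF GI])
    have "mono (\<lambda>t. \<psi> (max 0 t))" by (intro monoI m.mono) auto
    then have "(\<lambda>t. \<psi> (max 0 t)) \<in> borel_measurable borel" by (rule borel_measurable_mono)
    moreover have "(\<lambda>x. norm (Du x)) \<in> borel_measurable (lebesgue_on (ball y R))"
      using Du_integrable[of "ball y R"] bsub b2_sub(1) by (intro borel_measurable_norm borel_measurable_integrable) auto
    ultimately have "(\<lambda>x. \<psi> (max 0 (norm (Du x)))) \<in> borel_measurable (lebesgue_on (ball y R))"
      by (rule measurable_compose[rotated])
    then show "(\<lambda>x. \<psi> (norm (Du x)) powr (1 / p)) \<in> borel_measurable (lebesgue_on (ball y R))" by simp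
    show "AE x in lebesgue_on (ball y R). norm (\<psi> (norm (Du x)) powr (1 / p)) \<le> norm (G x powr (1 / p))"
      using \<psi>g p_gt_1 by (intro AE_I2) (auto intro!: powr_mono2)
  qed
  have DI: "integrable (lebesgue_on (ball y R)) (\<lambda>x. norm (Du x))"
    using Du_integrable[of "ball y R"] bsub b2_sub(1) by auto
  have "\<psi> a0 \<le> J * avg (ball y R) (\<lambda>x. \<psi> (norm (Du x)) powr (1 / p)) powr p"
    unfolding J_def a0_def by (rule m.root_jensen[OF _ mb DI _ \<psi>I]) auto
  also have "\<dots> \<le> J * X"
  proof -
    have "avg (ball y R) (\<lambda>x. \<psi> (norm (Du x)) powr (1 / p)) \<le> avg (ball y R) (\<lambda>x. G x powr (1 / p))"
      using \<psi>g p_gt_1 by (intro avg_mono \<psi>I GI powr_mono2) auto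
    then show ?thesis unfolding X_def using J p_gt_1 by (intro mult_left_mono powr_mono2 avg_nonneg) auto
  qed
  finally have 2: "\<psi> a0 \<le> J * X" .
  have 3: "1 \<le> X"
  proof -
    have cI: "integrable (lebesgue_on (ball y R)) (\<lambda>x. 1 :: real)" by (intro integrable_const_lmeasurable) simp
    have "avg (ball y R) (\<lambda>x. 1) \<le> avg (ball y R) (\<lambda>x. G x powr (1 / p))"
    proof (rule avg_mono[OF cI GI])
      fix x assume "x \<in> ball y R"
      then have "1 \<le> G x" using G_ge_1 bsub by auto
      then show "1 \<le> G x powr (1 / p)" using p_gt_1 by (intro ge_one_powr_ge_zero) auto
    qed
    moreover have "avg (ball y R) (\<lambda>x. 1) = 1"
      using mb integral_const_on[of "ball y R" 1] by (simp add: avg_def)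
    ultimately show ?thesis unfolding X_def using p_gt_1 by (intro ge_one_powr_ge_zero) auto
  qed
  note 1
  also have "(2 ^ CARD('n) * rc + 1) * (\<psi> a0 + 1) \<le> (2 ^ CARD('n) * rc + 1) * (J * X + X)"
    using 2 3 rc by (intro mult_left_mono add_mono) auto
  also have "\<dots> = gehring_const p q L Lw Q K TYPE('n) * X"
    using rc by (simp add: gehring_const_def J_def rc_def algebra_simps)
  also have "X = avg (cball y R) (\<lambda>x. G x powr (1 / p)) powr p"
    unfolding X_def using avg_cball_eq_ball[OF root_G_integrable[OF sub] R] by simp
  finally show ?thesis .
qed

text \<open>For \<open>R = 2 * r\<close> the energy estimate reaches the radius
  \<open>3 * r / 2\<close>, and the \<open>2 / 3\<close> of \<open>gehring\<close> leads from there
  to \<open>r\<close>. The factor \<open>4 / 3\<close> is the ratio of the first two radii.\<close>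

lemma avg_G_bound:
  "avg (ball x0 (3 * r / 2)) G \<le> ((4 / 3) ^ CARD('n) * rev_const q L Lw Q K TYPE('n) + 1)
     * (phi_minus \<Omega> \<phi> (ball x0 (2 * r)) (avg (ball x0 (2 * r)) (\<lambda>x. norm (Du x))) + 1)"
proof -
  define \<psi>a where "\<psi>a = phi_minus \<Omega> \<phi> (ball x0 (2 * r)) (avg (ball x0 (2 * r)) (\<lambda>x. norm (Du x)))"
  define V where "V = ubv TYPE('n)"
  define rc where "rc = rev_const q L Lw Q K TYPE('n)"
  have V: "0 < V" unfolding V_def by (rule ubv_pos)
  have "x0 \<in> ball x0 (2 * r) \<inter> \<Omega>" using r_pos b2_sub by auto
  then have ne: "ball x0 (2 * r) \<inter> \<Omega> \<noteq> {}" by blast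
  interpret m: growth p q L "phi_minus \<Omega> \<phi> (ball x0 (2 * r))" by (rule growth_phi_minus[OF structure_conds ne])
  have \<psi>a: "0 \<le> \<psi>a" unfolding \<psi>a_def by (intro m.nonneg avg_nonneg) simp
  define vol where "vol = V * (3 * r / 2) ^ CARD('n)"
  have vol: "0 < vol" using V r_pos by (simp add: vol_def)
  have mvol: "measure lebesgue (ball x0 (3 * r / 2)) = vol"
    using measure_lebesgue_ball[of "3 * r / 2" x0] r_pos by (simp add: vol_def V_def)
  have s: "ball x0 (3 * r / 2) \<subseteq> ball x0 (2 * r)" "cball x0 (3 * r / 2) \<subseteq> cball x0 (4 * r)"
    using r_pos by (auto intro!: subset_ball subset_cball)
  have "lint (ball x0 (3 * r / 2)) G = lint (ball x0 (3 * r / 2)) g + vol"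
    using integral_G[OF s(1)] mvol by auto
  also have "lint (ball x0 (3 * r / 2)) g \<le> lint (cball x0 (3 * r / 2)) g"
  proof (rule integral_on_mono_set[OF g_integrable[OF s(2)] ball_subset_cball])
    show "0 \<le> g x" if "x \<in> cball x0 (3 * r / 2)" for x using that s(2) ball_sub g_nonneg by blast
  qed auto
  also have "\<dots> \<le> rc * (V * (2 * r) ^ CARD('n)) * (\<psi>a + 1)"
    using energy_bound[of x0 "2 * r"] r_pos by (simp add: rc_def V_def \<psi>a_def)
  also have "V * (2 * r) ^ CARD('n) = (4 / 3) ^ CARD('n) * vol"
  proof -
    have "2 * r = 4 / 3 * (3 * r / 2)" by simp
    then have "(2 * r) ^ CARD('n) = (4 / 3) ^ CARD('n) * (3 * r / 2) ^ CARD('n)" by (metis power_mult_distrib)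
    then show ?thesis by (simp add: vol_def)
  qed
  finally have "lint (ball x0 (3 * r / 2)) G \<le> ((4 / 3) ^ CARD('n) * rc * (\<psi>a + 1) + 1) * vol"
    by (simp add: algebra_simps)
  then have "avg (ball x0 (3 * r / 2)) G \<le> (4 / 3) ^ CARD('n) * rc * (\<psi>a + 1) + 1"
    unfolding avg_def mvol using vol by (simp add: pos_divide_le_eq)
  also have "\<dots> \<le> ((4 / 3) ^ CARD('n) * rc + 1) * (\<psi>a + 1)"
    using \<psi>a by (simp add: algebra_simps)
  finally show ?thesis by (simp add: rc_def \<psi>a_def)
qed

lemma higher_integrability:
  assumes \<sigma>: "0 < \<sigma>" and C: "0 \<le> C"
    and I: "integrable (lebesgue_on (ball x0 r)) (\<lambda>x. G x powr (1 + \<sigma>))"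
    and bd: "avg (ball x0 r) (\<lambda>x. G x powr (1 + \<sigma>)) \<le> C * avg (ball x0 (3 * r / 2)) G powr (1 + \<sigma>)"
  defines "c \<equiv> C powr (1 / (1 + \<sigma>)) * ((4 / 3) ^ CARD('n) * rev_const q L Lw Q K TYPE('n) + 1)"
  shows "integrable (lebesgue_on (ball x0 r)) (\<lambda>x. g x powr (1 + \<sigma>))"
    and "avg (ball x0 r) (\<lambda>x. g x powr (1 + \<sigma>)) powr (1 / (1 + \<sigma>))
       \<le> c * phi_minus \<Omega> \<phi> (ball x0 (2 * r)) (avg (ball x0 (2 * r)) (\<lambda>x. norm (Du x))) + c"
proof -
  have rsub: "ball x0 r \<subseteq> ball x0 (2 * r)" using r_pos by (intro subset_ball) simp
  have gG: "0 \<le> g x" "g x powr (1 + \<sigma>) \<le> G x powr (1 + \<sigma>)" if x: "x \<in> ball x0 r" for x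
  proof -
    show "0 \<le> g x" using x rsub b2_sub g_nonneg by blast
    moreover have "x \<in> ball x0 (2 * r)" using x rsub by blast
    ultimately show "g x powr (1 + \<sigma>) \<le> G x powr (1 + \<sigma>)" using \<sigma> by (intro powr_mono2) (auto simp: G_def)
  qed
  show gI: "integrable (lebesgue_on (ball x0 r)) (\<lambda>x. g x powr (1 + \<sigma>))"
  proof (rule Bochner_Integration.integrable_bound[OF I])
    have "integrable (lebesgue_on (ball x0 r)) g" using g_integrable[of "ball x0 r"] rsub b2_sub by auto
    then show "(\<lambda>x. g x powr (1 + \<sigma>)) \<in> borel_measurable (lebesgue_on (ball x0 r))" by (intro powr_real_measurable) auto
  qed (use gG(2) in \<open>auto intro!: AE_I2\<close>)
  define \<psi>a where "\<psi>a = phi_minus \<Omega> \<phi> (ball x0 (2 * r)) (avg (ball x0 (2 * r)) (\<lambda>x. norm (Du x)))"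
  define m where "m = avg (ball x0 (3 * r / 2)) G"
  have m0: "0 \<le> m" unfolding m_def by (rule avg_nonneg) (rule G_nonneg)
  have "avg (ball x0 r) (\<lambda>x. g x powr (1 + \<sigma>)) \<le> avg (ball x0 r) (\<lambda>x. G x powr (1 + \<sigma>))"
    by (rule avg_mono[OF gI I gG(2)])
  also have "\<dots> \<le> C * m powr (1 + \<sigma>)" using bd by (simp add: m_def)
  finally have "avg (ball x0 r) (\<lambda>x. g x powr (1 + \<sigma>)) powr (1 / (1 + \<sigma>)) \<le> (C * m powr (1 + \<sigma>)) powr (1 / (1 + \<sigma>))"
    using \<sigma> by (intro powr_mono2 avg_nonneg) auto
  also have "\<dots> = C powr (1 / (1 + \<sigma>)) * m"
    using \<sigma> m0 by (simp add: powr_mult powr_powr)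
  also have "\<dots> \<le> C powr (1 / (1 + \<sigma>)) * (((4 / 3) ^ CARD('n) * rev_const q L Lw Q K TYPE('n) + 1) * (\<psi>a + 1))"
    using avg_G_bound by (intro mult_left_mono) (auto simp: m_def \<psi>a_def)
  also have "\<dots> = c * \<psi>a + c" by (simp add: c_def algebra_simps)
  finally show "avg (ball x0 r) (\<lambda>x. g x powr (1 + \<sigma>)) powr (1 / (1 + \<sigma>))
       \<le> c * phi_minus \<Omega> \<phi> (ball x0 (2 * r)) (avg (ball x0 (2 * r)) (\<lambda>x. norm (Du x))) + c"
    by (simp add: \<psi>a_def)
qed

end

theorem theorem3p11:
  fixes p q L Lw Q K :: real
  assumes "CARD('n) \<ge> 2"
    and "1 < p" and "p \<le> q" and "L \<ge> 1" and "Lw > 0" and "Q \<ge> 1"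
  shows "\<exists>\<sigma>>0. \<exists>c. \<forall>(\<Omega> :: (real ^ 'n) set) \<phi> \<gamma> u Du x0 r.
     open \<Omega> \<and> connected \<Omega> \<and> bounded \<Omega> \<and>
     Phi_w \<Omega> \<phi> \<and> A0 \<Omega> \<phi> L \<and> aInc \<Omega> \<phi> p L \<and> aDec \<Omega> \<phi> q L \<and>
     0 < \<gamma> \<and> \<gamma> < 1 \<and> A1 \<Omega> \<phi> (real CARD('n) / (1 - \<gamma>)) Lw \<and>
     0 < r \<and> cball x0 (4 * r) \<subseteq> \<Omega> \<and>
     W1phi_loc \<phi> \<Omega> u Du \<and> holder_on \<gamma> u (ball x0 (4 * r)) \<and>
     quasiminimizer \<phi> (ball x0 (4 * r)) u Du Q \<and>
     holder_seminorm \<gamma> u (ball x0 (2 * r)) = K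
     \<longrightarrow>
     integrable (lebesgue_on (ball x0 r)) (\<lambda>x. \<phi> x (norm (Du x)) powr (1 + \<sigma>)) \<and>
     avg (ball x0 r) (\<lambda>x. \<phi> x (norm (Du x)) powr (1 + \<sigma>)) powr (1 / (1 + \<sigma>))
       \<le> c * phi_minus \<Omega> \<phi> (ball x0 (2 * r)) (avg (ball x0 (2 * r)) (\<lambda>x. norm (Du x))) + c"
proof -
  define A where "A = gehring_const p q L Lw Q K TYPE('n)"
  have "1 * 1 \<le> A" unfolding A_def gehring_const_def using assms(4) by (intro mult_mono) auto
  then have A: "1 \<le> A" by simp
  \<comment> \<open>Both are obtained from \<open>p\<close>, \<open>A\<close> and the dimension
    alone, before a domain or a function is fixed; this gives the asserted uniformity.\<close>
  obtain \<sigma> C where \<sigma>: "0 < \<sigma>" and C: "0 \<le> C" and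
    gehring: "\<And>(f :: real ^ 'n \<Rightarrow> real) x0 R0. 0 < R0 \<Longrightarrow> integrable lebesgue f \<Longrightarrow> (\<And>x. 0 \<le> f x) \<Longrightarrow> (\<And>x. x \<in> ball x0 R0 \<Longrightarrow> 1 \<le> f x) \<Longrightarrow>
      (\<And>y R. 0 < R \<Longrightarrow> cball y R \<subseteq> ball x0 R0 \<Longrightarrow> avg (cball y (R / 2)) f \<le> A * avg (cball y R) (\<lambda>x. f x powr (1 / p)) powr p) \<Longrightarrow>
      integrable (lebesgue_on (ball x0 (2 * R0 / 3))) (\<lambda>x. f x powr (1 + \<sigma>)) \<and>
      avg (ball x0 (2 * R0 / 3)) (\<lambda>x. f x powr (1 + \<sigma>)) \<le> C * avg (ball x0 R0) f powr (1 + \<sigma>)"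
    using gehring[OF assms(2) A, where 'n = 'n] by blast
  define c where "c = C powr (1 / (1 + \<sigma>)) * ((4 / 3) ^ CARD('n) * rev_const q L Lw Q K TYPE('n) + 1)"
  show ?thesis
  proof (rule exI[of _ \<sigma>], rule conjI[OF \<sigma>], rule exI[of _ c], intro allI impI, elim conjE)
    fix \<Omega> :: "(real ^ 'n) set" and \<phi> \<gamma> u Du x0 r
    assume *: "open \<Omega>" "Phi_w \<Omega> \<phi>" "A0 \<Omega> \<phi> L" "aInc \<Omega> \<phi> p L" "aDec \<Omega> \<phi> q L"
      "0 < \<gamma>" "\<gamma> < 1" "A1 \<Omega> \<phi> (real CARD('n) / (1 - \<gamma>)) Lw" "0 < r" "cball x0 (4 * r) \<subseteq> \<Omega>"
      "W1phi_loc \<phi> \<Omega> u Du" "holder_on \<gamma> u (ball x0 (4 * r))"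
      "quasiminimizer \<phi> (ball x0 (4 * r)) u Du Q" "holder_seminorm \<gamma> u (ball x0 (2 * r)) = K"
    interpret quasimin p q L Lw Q K \<gamma> r \<Omega> \<phi> u Du x0
      by unfold_locales (use assms * in auto)
    have sub: "ball x0 (3 * r / 2) \<subseteq> ball x0 (2 * r)" using r_pos by (intro subset_ball) simp
    have "integrable (lebesgue_on (ball x0 (2 * (3 * r / 2) / 3))) (\<lambda>x. G x powr (1 + \<sigma>)) \<and>
      avg (ball x0 (2 * (3 * r / 2) / 3)) (\<lambda>x. G x powr (1 + \<sigma>)) \<le> C * avg (ball x0 (3 * r / 2)) G powr (1 + \<sigma>)"
    proof (rule gehring[OF _ G_integrable G_nonneg])
      show "1 \<le> G x" if "x \<in> ball x0 (3 * r / 2)" for x using that sub G_ge_1 by blast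
      show "avg (cball y (R / 2)) G \<le> A * avg (cball y R) (\<lambda>x. G x powr (1 / p)) powr p"
        if "0 < R" "cball y R \<subseteq> ball x0 (3 * r / 2)" for y R
        unfolding A_def using that sub by (intro reverse_holder) auto
    qed (use r_pos in simp)
    then have "integrable (lebesgue_on (ball x0 r)) (\<lambda>x. G x powr (1 + \<sigma>))"
      "avg (ball x0 r) (\<lambda>x. G x powr (1 + \<sigma>)) \<le> C * avg (ball x0 (3 * r / 2)) G powr (1 + \<sigma>)" by simp_all
    from higher_integrability[OF \<sigma> C this]
    show "integrable (lebesgue_on (ball x0 r)) (\<lambda>x. \<phi> x (norm (Du x)) powr (1 + \<sigma>)) \<and>
     avg (ball x0 r) (\<lambda>x. \<phi> x (norm (Du x)) powr (1 + \<sigma>)) powr (1 / (1 + \<sigma>))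
       \<le> c * phi_minus \<Omega> \<phi> (ball x0 (2 * r)) (avg (ball x0 (2 * r)) (\<lambda>x. norm (Du x))) + c"
      unfolding c_def g_def by blast
  qed
qed

end
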